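(* Let $J$ be an $N\times N$ complex Jordan matrix, $\lambda'$ an eigenvalue of $J$, $n=\dim\ker(J-\lambda' I)$, $m=N-n=\operatorname{rank}(J-\lambda' I)$, with $0<n<N$. Let $V=\mathbb{C}^N=F\oplus E$, where $F$ is spanned by the first $n$ and $E$ by the last $m$ vectors of the fixed basis. Then the isomorphism $$(\!(\mathcal O'(J))\!)_{E}\ \stackrel{\sim}{\to}\ \mathcal E(F\oplus E)\times \mathcal O(J\setminus\{\lambda'\}),$$ given on points $A\in(\!(\mathcal O(J))\!)_E$ by $A\mapsto (\mathcal B,\tilde A)$, where $\mathcal B=\begin{pmatrix}0&P\\ Q&0\end{pmatrix}$ and $P,Q,\tilde A$ are the blocks determined by $$A=\begin{pmatrix} I&0\\ Q&I\end{pmatrix}\begin{pmatrix}\lambda' I&P\\0&\tilde A\end{pmatrix}\begin{pmatrix} I&0\\ Q&I\end{pmatrix}^{-1},$$ is birational and symplectic: $$\omega_{\mathcal O(J)}=\pi^*_{\mathcal E(F\oplus E)}\,\omega_{\mathcal E(F\oplus E)}+\pi^*_{\{\lambda'\}}\,\omega_{\mathcal O(J\setminus\{\lambda'\})},$$ where $\pi_{\mathcal E(F\oplus E)}: A\mapsto \mathcal B$ and $\pi_{\{\lambda'\}}:A\mapsto\tilde A$ are the projections on the two Cartesian factors.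
   Context: All spaces are over $\mathbb{C}$; "open" means Zariski-open. $\mathcal O(J)=\{gJg^{-1}: g\in \mathrm{GL}(N,\mathbb{C})\}$ is the set of all matrices similar to $J$. Symplectic form on an orbit: for vectors $\xi_1,\xi_2$ tangent at $A=gJg^{-1}$ to curves $A_i(t)=g_i(t)Jg_i(t)^{-1}$, $g_1(0)=g_2(0)=g$, $$\omega_{\mathcal O(J)}(\xi_1,\xi_2)=\operatorname{tr} J[g^{-1}\dot g_1,g^{-1}\dot g_2]=\operatorname{tr}\,(\dot g_1g^{-1})\dot A_2 ,$$ where dots denote derivatives at $t=0$. Jordan structure of a linear transformation: its set of eigenvalues together with the number and lengths of the Jordan chains for each eigenvalue. $J\setminus\{\lambda'\}$ denotes the Jordan structure obtained from that of $J$ as follows: chains for eigenvalues $\ne\lambda'$ are kept; each chain for $\lambda'$ of length greater than one is shortened by one unit; chains for $\lambda'$ of length one are deleted. $\mathcal O(J\setminus\{\lambda'\})\subset\operatorname{End}E\simeq \mathrm{gl}(m,\mathbb{C})$ is the set of all transformations of $E$ with this Jordan structure; it is an orbit of $\mathrm{GL}(m,\mathbb{C})$ and carries its own form $\omega_{\mathcal O(J\setminus\{\lambda'\})}$ defined by the same formula. $(\!(\mathcal O(J))\!)_E$ is the open set of $A\in\mathcal O(J)$ with $\ker(A-\lambda' I)\cap E=0$. Every such $A$ is uniquely of the displayed block form with $Q\in\operatorname{Hom}(F,E)$, $P\in\operatorname{Hom}(E,F)$, $\tilde A\in\mathcal O(J\setminus\{\lambda'\})$; for given $Q,\tilde A$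 the admissible $P$ form an open subset of $\operatorname{Hom}(E,F)$. The enlarged manifold $(\!(\mathcal O'(J))\!)_E\supset(\!(\mathcal O(J))\!)_E$ is obtained by enlarging each of these fibers to the whole of $\operatorname{Hom}(E,F)$ (i.e. dropping the restriction on $P$); the form $\omega_{\mathcal O(J)}$ is given on the open part $(\!(\mathcal O(J))\!)_E$. $\mathcal E(F\oplus E)\subset\operatorname{End}V$ is the $2nm$-dimensional linear space of transformations $\mathcal B$ that are block off-diagonal with respect to $V=F\oplus E$, i.e. $\mathcal B=\begin{pmatrix}0&b_{12}\\ b_{21}&0\end{pmatrix}$ with $b_{12}\in\operatorname{Hom}(E,F)$, $b_{21}\in\operatorname{Hom}(F,E)$. It carries the constant symplectic form $$\omega_{\mathcal E(F\oplus E)}(\mathcal B_1,\mathcal B_2)=\operatorname{tr} b^2_{21}b^1_{12}-\operatorname{tr} b^2_{12}b^1_{21},$$ where $b^i_{jk}$ are the blocks of $\mathcal B_i$.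
   Formalization: The form on E(F⊕E) is taken with the opposite sign, tr b¹₂₁b²₁₂ − tr b¹₁₂b²₂₁, because with the printed sign the identity fails: for J=diag(λ',μ), λ'≠μ, at A=J, the orbit form is Q₁'P₂'−P₁'Q₂', the negative of the printed form. *)

theory Defs
  imports
    "Jordan_Normal_Form.Jordan_Normal_Form_Uniqueness"
    "Jordan_Normal_Form.Gauss_Jordan_Elimination"
    "HOL-Analysis.Abstract_Topology"
begin

section \<open>Zariski topology, regular maps, birational maps\<close>

text \<open>
  A quasi-affine variety is given by its set of points \<open>X\<close> together with the set \<open>C\<close> of
  coordinate functions of the ambient affine space. As the ground field is infinite,
  polynomials are identified with polynomial functions.
\<close>

inductive_set poly_funs :: "('p \<Rightarrow> complex) set \<Rightarrow> ('p \<Rightarrow> complex) set"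
  for C :: "('p \<Rightarrow> complex) set" where
  const: "(\<lambda>_. c) \<in> poly_funs C"
| coord: "f \<in> C \<Longrightarrow> f \<in> poly_funs C"
| add: "f \<in> poly_funs C \<Longrightarrow> g \<in> poly_funs C \<Longrightarrow> (\<lambda>x. f x + g x) \<in> poly_funs C"
| mult: "f \<in> poly_funs C \<Longrightarrow> g \<in> poly_funs C \<Longrightarrow> (\<lambda>x. f x * g x) \<in> poly_funs C"

definition zariski :: "('p \<Rightarrow> complex) set \<Rightarrow> 'p set \<Rightarrow> 'p topology" where
  "zariski C X = subtopology (topology_generated_by {{x. f x \<noteq> 0} | f. f \<in> poly_funs C}) X"

definition dense_open :: "('p \<Rightarrow> complex) set \<Rightarrow> 'p set \<Rightarrow> 'p set \<Rightarrow> bool" where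
  "dense_open C X U \<longleftrightarrow> openin (zariski C X) U \<and> zariski C X closure_of U = X"

definition regular_fun :: "('p \<Rightarrow> complex) set \<Rightarrow> 'p set \<Rightarrow> ('p \<Rightarrow> complex) \<Rightarrow> bool" where
  "regular_fun C X f \<longleftrightarrow>
     (\<forall>x\<in>X. \<exists>U p q. openin (zariski C X) U \<and> x \<in> U \<and> p \<in> poly_funs C \<and> q \<in> poly_funs C \<and>
        (\<forall>y\<in>U. q y \<noteq> 0 \<and> f y = p y / q y))"

definition regular_map ::
  "('p \<Rightarrow> complex) set \<Rightarrow> 'p set \<Rightarrow> ('q \<Rightarrow> complex) set \<Rightarrow> 'q set \<Rightarrow> ('p \<Rightarrow> 'q) \<Rightarrow> bool" where
  "regular_map C X D Y f \<longleftrightarrow> f ` X \<subseteq> Y \<and> (\<forall>d\<in>D. regular_fun C X (d \<circ> f))"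

definition biregular ::
  "('p \<Rightarrow> complex) set \<Rightarrow> 'p set \<Rightarrow> ('q \<Rightarrow> complex) set \<Rightarrow> 'q set \<Rightarrow> ('p \<Rightarrow> 'q) \<Rightarrow> bool" where
  "biregular C X D Y f \<longleftrightarrow>
     bij_betw f X Y \<and> regular_map C X D Y f \<and> regular_map D Y C X (inv_into X f)"

text \<open>
  \<open>f\<close>, defined on the dense open subset \<open>W\<close> of \<open>X\<close>, represents a birational map from \<open>X\<close> to \<open>Y\<close>.
\<close>

definition birational ::
  "('p \<Rightarrow> complex) set \<Rightarrow> 'p set \<Rightarrow> 'p set \<Rightarrow> ('q \<Rightarrow> complex) set \<Rightarrow> 'q set \<Rightarrow> ('p \<Rightarrow> 'q) \<Rightarrow> bool"
  where
  "birational C X W D Y f \<longleftrightarrow>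
     dense_open C X W \<and> regular_map C W D Y f \<and>
     (\<exists>U V. U \<subseteq> W \<and> dense_open C X U \<and> dense_open D Y V \<and> biregular C U D V f)"

definition mat_coords :: "nat \<Rightarrow> nat \<Rightarrow> (complex mat \<Rightarrow> complex) set" where
  "mat_coords r c = {\<lambda>A. A $$ (i, j) | i j. i < r \<and> j < c}"

definition prod_coords ::
  "('p \<Rightarrow> complex) set \<Rightarrow> ('q \<Rightarrow> complex) set \<Rightarrow> ('p \<times> 'q \<Rightarrow> complex) set" where
  "prod_coords C D = {f \<circ> fst | f. f \<in> C} \<union> {f \<circ> snd | f. f \<in> D}"


section \<open>Orbits and their symplectic forms\<close>

definition mat_inv :: "complex mat \<Rightarrow> complex mat" where
  "mat_inv A = the (mat_inverse A)"

definition mat_trace :: "complex mat \<Rightarrow> complex" where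
  "mat_trace A = (\<Sum>i<dim_row A. A $$ (i, i))"

definition commutator :: "complex mat \<Rightarrow> complex mat \<Rightarrow> complex mat" where
  "commutator A B = A * B - B * A"

definition sim_orbit :: "complex mat \<Rightarrow> complex mat set" where
  "sim_orbit J = {A. similar_mat A J}"

text \<open>\<open>\<gamma>\<close> is a germ at \<open>t = 0\<close> of a curve of matrices with derivative \<open>\<xi>\<close> at \<open>t = 0\<close>.\<close>

definition has_velocity :: "(real \<Rightarrow> complex mat) \<Rightarrow> complex mat \<Rightarrow> bool" where
  "has_velocity \<gamma> \<xi> \<longleftrightarrow>
     (\<forall>\<^sub>F t in nhds 0. \<gamma> t \<in> carrier_mat (dim_row \<xi>) (dim_col \<xi>)) \<and>
     (\<forall>i<dim_row \<xi>. \<forall>j<dim_col \<xi>. ((\<lambda>t. \<gamma> t $$ (i, j)) has_vector_derivative \<xi> $$ (i, j)) (at 0))"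

text \<open>\<open>g\<close> is a curve in the general linear group of the size of \<open>J\<close>, with derivative \<open>g'\<close>
  at \<open>t = 0\<close>, and the curve \<open>g(t) J g(t)\<^sup>-\<^sup>1\<close> in the orbit of \<open>J\<close> has the tangent vector \<open>\<xi>\<close>
  at its point \<open>A\<close>, \<open>t = 0\<close>.\<close>

definition conj_curve :: "complex mat \<Rightarrow> (real \<Rightarrow> complex mat) \<Rightarrow> real \<Rightarrow> complex mat" where
  "conj_curve J g t = g t * J * mat_inv (g t)"

definition orbit_curve ::
  "complex mat \<Rightarrow> complex mat \<Rightarrow> (real \<Rightarrow> complex mat) \<Rightarrow> complex mat \<Rightarrow> complex mat \<Rightarrow> bool" where
  "orbit_curve J A g g' \<xi> \<longleftrightarrow>
     g' \<in> carrier_mat (dim_row J) (dim_row J) \<and> has_velocity g g' \<and>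
     (\<forall>\<^sub>F t in nhds 0. invertible_mat (g t)) \<and>
     conj_curve J g 0 = A \<and> has_velocity (conj_curve J g) \<xi>"

definition tangent_vectors :: "complex mat \<Rightarrow> complex mat \<Rightarrow> complex mat set" where
  "tangent_vectors J A = {\<xi>. \<exists>g g'. orbit_curve J A g g' \<xi>}"

text \<open>The value does not depend on the curves representing \<open>\<xi>\<^sub>1\<close> and \<open>\<xi>\<^sub>2\<close>.\<close>

definition orbit_form :: "complex mat \<Rightarrow> complex mat \<Rightarrow> complex mat \<Rightarrow> complex mat \<Rightarrow> complex" where
  "orbit_form J A \<xi>\<^sub>1 \<xi>\<^sub>2 = (THE w. \<exists>g\<^sub>1 g\<^sub>1' g\<^sub>2 g\<^sub>2'.
     orbit_curve J A g\<^sub>1 g\<^sub>1' \<xi>\<^sub>1 \<and> orbit_curve J A g\<^sub>2 g\<^sub>2' \<xi>\<^sub>2 \<and> g\<^sub>1 0 = g\<^sub>2 0 \<and>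
     w = mat_trace (J * commutator (mat_inv (g\<^sub>1 0) * g\<^sub>1') (mat_inv (g\<^sub>1 0) * g\<^sub>2')))"

text \<open>The differential at \<open>A\<close>, along the orbit of \<open>J\<close>, of a matrix-valued map \<open>\<pi>\<close> that is regular
  on a neighbourhood of \<open>A\<close> in the orbit, and the pullback under \<open>\<pi>\<close> of a two-form \<open>\<omega>\<close>
  (a function of a base point and two tangent vectors).\<close>

definition orbit_differential ::
  "complex mat \<Rightarrow> (complex mat \<Rightarrow> complex mat) \<Rightarrow> complex mat \<Rightarrow> complex mat \<Rightarrow> complex mat" where
  "orbit_differential J \<pi> A \<xi> =
     (THE \<eta>. \<exists>g g'. orbit_curve J A g g' \<xi> \<and> has_velocity (\<pi> \<circ> conj_curve J g) \<eta>)"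

definition orbit_pullback ::
  "complex mat \<Rightarrow> (complex mat \<Rightarrow> complex mat) \<Rightarrow>
   (complex mat \<Rightarrow> complex mat \<Rightarrow> complex mat \<Rightarrow> complex) \<Rightarrow>
   complex mat \<Rightarrow> complex mat \<Rightarrow> complex mat \<Rightarrow> complex" where
  "orbit_pullback J \<pi> \<omega> A \<xi>\<^sub>1 \<xi>\<^sub>2 =
     \<omega> (\<pi> A) (orbit_differential J \<pi> A \<xi>\<^sub>1) (orbit_differential J \<pi> A \<xi>\<^sub>2)"


section \<open>Off-diagonal matrices\<close>

definition offdiag :: "nat \<Rightarrow> nat \<Rightarrow> complex mat set" where
  "offdiag n m = {four_block_mat (0\<^sub>m n n) b\<^sub>1\<^sub>2 b\<^sub>2\<^sub>1 (0\<^sub>m m m) | b\<^sub>1\<^sub>2 b\<^sub>2\<^sub>1.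
     b\<^sub>1\<^sub>2 \<in> carrier_mat n m \<and> b\<^sub>2\<^sub>1 \<in> carrier_mat m n}"

text \<open>
  Sign convention: with the blocks \<open>b\<^sub>1\<^sub>2 = P\<close>, \<open>b\<^sub>2\<^sub>1 = Q\<close> this is \<open>tr Q\<^sub>1 P\<^sub>2 - tr P\<^sub>1 Q\<^sub>2\<close>. The
  source of the theorem prints \<open>B\<^sub>1\<close> and \<open>B\<^sub>2\<close> interchanged, that is the opposite
  sign; this is not compatible with the orbit form \<open>tr J [g\<^sup>-\<^sup>1 g\<^sub>1', g\<^sup>-\<^sup>1 g\<^sub>2']\<close>. For
  \<open>J = diag (\<lambda>, \<mu>)\<close> with \<open>\<lambda> \<noteq> \<mu>\<close>, at the point \<open>J\<close> of its orbit, the orbit form is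
  \<open>Q\<^sub>1' P\<^sub>2' - P\<^sub>1' Q\<^sub>2'\<close>.
\<close>

definition offdiag_form :: "nat \<Rightarrow> complex mat \<Rightarrow> complex mat \<Rightarrow> complex" where
  "offdiag_form n B\<^sub>1 B\<^sub>2 =
     (case (split_block B\<^sub>1 n n, split_block B\<^sub>2 n n) of
        ((_, p\<^sub>1\<^sub>2, p\<^sub>2\<^sub>1, _), (_, q\<^sub>1\<^sub>2, q\<^sub>2\<^sub>1, _)) \<Rightarrow>
          mat_trace (p\<^sub>2\<^sub>1 * q\<^sub>1\<^sub>2) - mat_trace (p\<^sub>1\<^sub>2 * q\<^sub>2\<^sub>1))"


section \<open>The block decomposition\<close>

text \<open>A Jordan structure is a list of pairs (length of the chain, eigenvalue), as in
  \<^const>\<open>jordan_matrix\<close>.\<close>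

definition shorten_chains :: "complex \<Rightarrow> (nat \<times> complex) list \<Rightarrow> (nat \<times> complex) list" where
  "shorten_chains ev bs =
     map (\<lambda>(k, \<mu>). if \<mu> = ev then (k - 1, \<mu>) else (k, \<mu>))
       (filter (\<lambda>(k, \<mu>). \<not> (\<mu> = ev \<and> k = 1)) bs)"

definition jordan_class :: "nat \<Rightarrow> (nat \<times> complex) list \<Rightarrow> complex mat set" where
  "jordan_class m bs = {A \<in> carrier_mat m m. jordan_nf A bs}"

definition last_coords :: "nat \<Rightarrow> nat \<Rightarrow> complex vec set" where
  "last_coords N n = {v \<in> carrier_vec N. \<forall>i<n. v $ i = 0}"

definition transverse_orbit :: "complex mat \<Rightarrow> complex \<Rightarrow> nat \<Rightarrow> complex mat set" where
  "transverse_orbit J ev n =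
     {A \<in> sim_orbit J.
        mat_kernel (A - ev \<cdot>\<^sub>m 1\<^sub>m (dim_row J)) \<inter> last_coords (dim_row J) n = {0\<^sub>v (dim_row J)}}"

definition assemble ::
  "complex \<Rightarrow> nat \<Rightarrow> nat \<Rightarrow> complex mat \<times> complex mat \<times> complex mat \<Rightarrow> complex mat" where
  "assemble ev n m = (\<lambda>(Q, P, A').
     let U = four_block_mat (1\<^sub>m n) (0\<^sub>m n m) Q (1\<^sub>m m)
     in U * four_block_mat (ev \<cdot>\<^sub>m 1\<^sub>m n) P (0\<^sub>m m n) A' * mat_inv U)"

definition is_block_form ::
  "complex \<Rightarrow> nat \<Rightarrow> nat \<Rightarrow> (nat \<times> complex) list \<Rightarrow> complex mat \<Rightarrow>
   complex mat \<times> complex mat \<times> complex mat \<Rightarrow> bool" where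
  "is_block_form ev n m bs A = (\<lambda>(Q, P, A').
     Q \<in> carrier_mat m n \<and> P \<in> carrier_mat n m \<and> A' \<in> jordan_class m (shorten_chains ev bs) \<and>
     A = assemble ev n m (Q, P, A'))"

definition block_coords ::
  "complex \<Rightarrow> nat \<Rightarrow> nat \<Rightarrow> (nat \<times> complex) list \<Rightarrow> complex mat \<Rightarrow>
   complex mat \<times> complex mat \<times> complex mat" where
  "block_coords ev n m bs A = (THE c. is_block_form ev n m bs A c)"

text \<open>
  The enlarged manifold. Its points are triples \<open>(Q, P, A')\<close>, and the transverse part of the orbit
  lies in it by \<^const>\<open>block_coords\<close>; that part is fibred over the pairs \<open>(Q, A')\<close>, and each of its
  (nonempty) fibres is enlarged to all \<open>P\<close>. Triples and not matrices are needed, as the map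
  \<^const>\<open>assemble\<close> is in general not injective on the enlarged manifold.
\<close>

definition enlarged_orbit ::
  "complex \<Rightarrow> nat \<Rightarrow> nat \<Rightarrow> (nat \<times> complex) list \<Rightarrow>
   (complex mat \<times> complex mat \<times> complex mat) set" where
  "enlarged_orbit ev n m bs =
     {(Q, P, A') | Q P A'. P \<in> carrier_mat n m \<and>
        (\<exists>P\<^sub>0. (Q, P\<^sub>0, A') \<in> block_coords ev n m bs ` transverse_orbit (jordan_matrix bs) ev n)}"

definition triple_coords ::
  "nat \<Rightarrow> nat \<Rightarrow> (complex mat \<times> complex mat \<times> complex mat \<Rightarrow> complex) set" where
  "triple_coords n m = prod_coords (mat_coords m n) (prod_coords (mat_coords n m) (mat_coords m m))"

definition darboux_map ::
  "nat \<Rightarrow> nat \<Rightarrow> complex mat \<times> complex mat \<times> complex mat \<Rightarrow> complex mat \<times> complex mat" where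
  "darboux_map n m = (\<lambda>(Q, P, A'). (four_block_mat (0\<^sub>m n n) P Q (0\<^sub>m m m), A'))"

definition proj_offdiag ::
  "complex \<Rightarrow> nat \<Rightarrow> nat \<Rightarrow> (nat \<times> complex) list \<Rightarrow> complex mat \<Rightarrow> complex mat" where
  "proj_offdiag ev n m bs A = fst (darboux_map n m (block_coords ev n m bs A))"

definition proj_reduced ::
  "complex \<Rightarrow> nat \<Rightarrow> nat \<Rightarrow> (nat \<times> complex) list \<Rightarrow> complex mat \<Rightarrow> complex mat" where
  "proj_reduced ev n m bs A = snd (darboux_map n m (block_coords ev n m bs A))"

end

theory Submission
  imports Defs "Jordan_Normal_Form.DL_Rank" "Jordan_Normal_Form.Jordan_Normal_Form_Existence"
begin

text \<open>
  Let \<open>S\<^sub>1\<close>, \<open>S\<^sub>2\<close> be the inclusions of \<open>F\<close> and \<open>E\<close>. If \<open>ker (A - \<lambda>')\<close> meets \<open>E\<close> trivially, it is the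
  graph of a unique \<open>Q : F \<rightarrow> E\<close>, i.e. \<open>(A - \<lambda>') G = 0\<close> for \<open>G = S\<^sub>1 + S\<^sub>2 Q\<close>. With
  \<open>R = S\<^sub>2\<^sup>T - Q S\<^sub>1\<^sup>T\<close> the matrices \<open>(G, S\<^sub>2)\<close> and \<open>(S\<^sub>1\<^sup>T; R)\<close> are inverse to each other, and
  \<open>P = S\<^sub>1\<^sup>T A S\<^sub>2\<close>, \<open>A' = R A S\<^sub>2\<close> are the remaining blocks. If \<open>L\<close> is a left inverse of
  \<open>(A - \<lambda>') S\<^sub>2\<close> then \<open>Q = - (L (B - \<lambda>') S\<^sub>2)\<^sup>-\<^sup>1 L (B - \<lambda>') S\<^sub>1\<close> for all \<open>B\<close> near \<open>A\<close>, so \<open>Q\<close> is regular.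

  The image consists of the triples \<open>(Q, P, A')\<close> with \<open>ker P \<inter> ker (A' - \<lambda>') = 0\<close>. Under this condition
  \<open>dim ker (A - \<lambda>')\<^sup>k\<^sup>+\<^sup>1 = n + dim ker (A' - \<lambda>')\<^sup>k\<close>, while for the other eigenvalues the generalized
  eigenspaces of \<open>A\<close> and \<open>A'\<close> have equal dimensions; these dimensions determine the Jordan structure.
  Density holds because two points of the orbit are joined by a rational curve,
  \<open>t \<mapsto> g(t) J g(t)\<^sup>-\<^sup>1\<close> with \<open>g(t)\<close> on the line through two invertible matrices.

  A tangent vector is \<open>\<xi> = [Y, A]\<close>, and the orbit form is \<open>tr (Y\<^sub>1 \<xi>\<^sub>2)\<close>. Differentiating
  \<open>(A - \<lambda>') G = 0\<close> along the orbit gives the velocities \<open>R Y G\<close> of \<open>Q\<close> and \<open>[R Y S\<^sub>2, A']\<close> of \<open>A'\<close>.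
  The symplectic identity then results from expanding \<open>tr (Y\<^sub>1 \<xi>\<^sub>2)\<close> in the blocks with respect to
  \<open>(G, S\<^sub>2)\<close>.
\<close>

section \<open>Inverses and kernels\<close>

text \<open>The obstacle is that \<open>Q\<close> is given by a kernel, hence only implicitly. The
  matrix \<open>L\<close> makes it explicit near one point: \<open>L\<close> is chosen there and
  then kept fixed, so that \<open>Q\<close> becomes rational in the matrix entries with a single
  determinant as denominator. One formula thus yields regularity on Zariski neighbourhoods and
  differentiability along curves near time zero; only the value of the derivative is taken from the
  implicit equation. In the same way injectivity is witnessed by left inverses throughout, which
  turns conditions on kernels into nonvanishing of determinants, that is into open conditions. The
  condition on \<open>P\<close> arises because, in the basis \<open>(G, S2)\<close>, the kernel of
  \<open>(A - ev) S2\<close> is the joint kernel of \<open>P\<close> and \<open>A' - ev\<close>.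
  Some \<open>P\<close> satisfies it over every pair \<open>(Q, A')\<close>, as \<open>A'\<close>
  has at most \<open>n\<close> chains for \<open>ev\<close>. Hence the enlarged manifold is a full
  product, and in the target a line in the direction of \<open>P\<close> alone leads from any point
  to admissible ones.\<close>

lemma mult_assoc_dim:
  fixes A B C :: "'a :: semiring_0 mat"
  assumes "dim_col A = dim_row B" and "dim_col B = dim_row C"
  shows "A * B * C = A * (B * C)"
  using assms by (intro assoc_mult_mat) (auto intro: carrier_matI)

text \<open>Fits products that \<open>mult_assoc_dim\<close> has nested to the right: a pair of
  inverse factors cancels at the head of such a product, under side conditions that the simplifier
  can compute.\<close>

lemma mult_cancel_dim:
  fixes A B C :: "'a :: semiring_1 mat"
  assumes "A * B = 1\<^sub>m k" and "dim_col A = dim_row B" and "dim_col B = dim_row C"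
  shows "A * (B * C) = C"
proof -
  have "dim_row C = k"
    using assms by (metis index_mult_mat(3) index_one_mat(3))
  then show ?thesis
    using assms by (metis mult_assoc_dim left_mult_one_mat')
qed

lemma invertible_mat_iff_det:
  fixes A :: "'a :: field mat"
  assumes A: "A \<in> carrier_mat n n"
  shows "invertible_mat A \<longleftrightarrow> det A \<noteq> 0"
proof
  assume "invertible_mat A"
  then obtain B where B: "A * B = 1\<^sub>m n" "B * A = 1\<^sub>m (dim_row B)"
    using A by (auto simp: invertible_mat_def inverts_mat_def)
  have "dim_row B = n"
    using B(2) A by (metis carrier_matD(2) index_mult_mat(3) index_one_mat(3))
  moreover have "dim_col B = n"
    using B(1) by (metis index_mult_mat(3) index_one_mat(3))
  ultimately have "det A * det B = 1"
    using det_mult[OF A] B(1) by (metis carrier_matI det_one)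
  then show "det A \<noteq> 0" by auto
next
  assume "det A \<noteq> 0"
  from det_non_zero_imp_unit[OF A this, of "()"]
  obtain B where "B \<in> carrier_mat n n" "A * B = 1\<^sub>m n" "B * A = 1\<^sub>m n"
    by (auto simp: Units_def ring_mat_simps)
  then show "invertible_mat A"
    using A by (auto simp: invertible_mat_def inverts_mat_def intro!: exI[of _ B])
qed

lemma mat_inv:
  assumes A: "A \<in> carrier_mat n n" and "det A \<noteq> 0"
  shows "mat_inv A \<in> carrier_mat n n" and "A * mat_inv A = 1\<^sub>m n" and "mat_inv A * A = 1\<^sub>m n"
proof -
  obtain B where "mat_inverse A = Some B"
    using mat_inverse(1)[OF A, of "()"] det_non_zero_imp_unit[OF assms, of "()"]
    by (cases "mat_inverse A") auto
  with mat_inverse(2)[OF A this]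
  show "mat_inv A \<in> carrier_mat n n" and "A * mat_inv A = 1\<^sub>m n" and "mat_inv A * A = 1\<^sub>m n"
    by (auto simp: mat_inv_def)
qed

lemma det_nonzero_right_inverse:
  fixes A :: "'a :: field mat"
  assumes "A \<in> carrier_mat n n" and "B \<in> carrier_mat n n" and "A * B = 1\<^sub>m n"
  shows "det A \<noteq> 0"
  using det_mult[OF assms(1,2)] assms(3) by auto

lemma mat_inv_unique:
  assumes A: "A \<in> carrier_mat n n" and B: "B \<in> carrier_mat n n" and AB: "A * B = 1\<^sub>m n"
  shows "mat_inv A = B"
proof -
  note inv = mat_inv[OF A det_nonzero_right_inverse[OF assms]]
  have "mat_inv A = mat_inv A * (A * B)"
    using inv AB by simp
  also have "\<dots> = B"
    using inv A B by (intro mult_cancel_dim) auto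
  finally show ?thesis .
qed

text \<open>Gives the entries of the inverse as polynomials in the entries of \<open>A\<close> over
  the one denominator \<open>det A\<close>; regularity and differentiability of inverses both rest
  on this.\<close>

lemma mat_inv_adj_mat:
  assumes A: "A \<in> carrier_mat n n" and "det A \<noteq> 0"
  shows "mat_inv A = inverse (det A) \<cdot>\<^sub>m adj_mat A"
proof (rule mat_inv_unique[OF A])
  note adj = adj_mat[OF A]
  show "inverse (det A) \<cdot>\<^sub>m adj_mat A \<in> carrier_mat n n"
    using adj by simp
  have "A * (inverse (det A) \<cdot>\<^sub>m adj_mat A) = inverse (det A) \<cdot>\<^sub>m (A * adj_mat A)"
    by (rule mult_smult_distrib[OF A adj(1)])
  also have "\<dots> = 1\<^sub>m n"
    unfolding adj(2) using assms(2) by (intro eq_matI) auto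
  finally show "A * (inverse (det A) \<cdot>\<^sub>m adj_mat A) = 1\<^sub>m n" .
qed

lemma sim_orbit_iff:
  assumes J: "J \<in> carrier_mat N N"
  shows "A \<in> sim_orbit J \<longleftrightarrow>
    (\<exists>g \<in> carrier_mat N N. det g \<noteq> 0 \<and> A = g * J * mat_inv g)"
proof
  assume "A \<in> sim_orbit J"
  then obtain k P Q where *: "{A, J, P, Q} \<subseteq> carrier_mat k k" "P * Q = 1\<^sub>m k" "A = P * J * Q"
    unfolding sim_orbit_def by (blast dest: similar_matD)
  have "k = N" using * J by auto
  moreover have "mat_inv P = Q" using * by (intro mat_inv_unique) auto
  ultimately show "\<exists>g \<in> carrier_mat N N. det g \<noteq> 0 \<and> A = g * J * mat_inv g"
    using * det_nonzero_right_inverse[of P k Q] by auto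
next
  assume "\<exists>g \<in> carrier_mat N N. det g \<noteq> 0 \<and> A = g * J * mat_inv g"
  then obtain g where g: "g \<in> carrier_mat N N" "det g \<noteq> 0" "A = g * J * mat_inv g" by auto
  show "A \<in> sim_orbit J"
    using mat_inv[OF g(1,2)] g J unfolding sim_orbit_def
    by (auto intro!: similar_matI[where P = g and Q = "mat_inv g" and n = N])
qed

lemma sim_orbit_carrier:
  assumes "J \<in> carrier_mat N N" and "A \<in> sim_orbit J"
  shows "A \<in> carrier_mat N N"
  using assms unfolding sim_orbit_def by (auto dest!: similar_matD)

section \<open>Kernels, left inverses and kernel bases\<close>

lemma det_nonzero_iff_kernel:
  fixes A :: "'a :: field mat"
  assumes A: "A \<in> carrier_mat n n"
  shows "det A \<noteq> 0 \<longleftrightarrow> mat_kernel A = {0\<^sub>v n}"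
proof -
  have "0\<^sub>v n \<in> mat_kernel A"
    using A by (auto simp: mat_kernel_def)
  then show ?thesis
    using det_0_iff_vec_prod_zero[OF A] unfolding mat_kernel[OF A] by blast
qed

text \<open>The Gram matrix of an injective complex matrix is invertible, which yields the left inverse.\<close>

lemma left_inverse_of_injective:
  fixes C :: "complex mat"
  assumes C: "C \<in> carrier_mat r m" and inj: "mat_kernel C = {0\<^sub>v m}"
  obtains L where "L \<in> carrier_mat m r" and "L * C = 1\<^sub>m m"
proof -
  define H where "H = map_mat cnj C\<^sup>T"
  have H: "H \<in> carrier_mat m r" using C by (auto simp: H_def)
  have HC: "H * C \<in> carrier_mat m m" using H C by auto
  have "x = 0\<^sub>v m" if x: "x \<in> carrier_vec m" and 0: "(H * C) *\<^sub>v x = 0\<^sub>v m" for x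
  proof -
    define w where "w = C *\<^sub>v x"
    have w: "w \<in> carrier_vec r" using C x by (auto simp: w_def)
    have Hw: "H *\<^sub>v w = 0\<^sub>v m" using 0 H C x by (auto simp: w_def)
    have "C\<^sup>T *\<^sub>v map_vec cnj w = map_vec cnj (H *\<^sub>v w)"
      using C w by (intro eq_vecI) (auto simp: H_def scalar_prod_def row_def)
    also have "\<dots> = 0\<^sub>v m"
      unfolding Hw by (intro eq_vecI) auto
    finally have "0 = (C\<^sup>T *\<^sub>v map_vec cnj w) \<bullet> x"
      using x by simp
    also have "\<dots> = map_vec cnj w \<bullet> w"
      unfolding w_def using transpose_vec_mult_scalar[OF C x, of "map_vec cnj w"] w
      by (simp add: w_def)
    also have "\<dots> = of_real (\<Sum>i<r. (cmod (w $ i))\<^sup>2)"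
      using w by (simp add: scalar_prod_def lessThan_atLeast0 complex_norm_square mult.commute del: of_real_power)
    finally have "(\<Sum>i<r. (cmod (w $ i))\<^sup>2) = 0"
      by (metis of_real_eq_0_iff)
    then have "\<forall>i<r. w $ i = 0"
      by (subst (asm) sum_nonneg_eq_0_iff) auto
    then have "w = 0\<^sub>v r" using w by (intro eq_vecI) auto
    then have "x \<in> mat_kernel C"
      using mat_kernelI[OF C x] by (simp add: w_def)
    then show ?thesis using inj by auto
  qed
  then have det: "det (H * C) \<noteq> 0"
    using det_0_iff_vec_prod_zero[OF HC] by blast
  show thesis
  proof (rule that)
    show "mat_inv (H * C) * H \<in> carrier_mat m r"
      using mat_inv(1)[OF HC det] H by auto
    show "mat_inv (H * C) * H * C = 1\<^sub>m m"
      using mat_inv[OF HC det] H C by (simp add: assoc_mult_mat[of _ m m H r C m])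
  qed
qed

lemma injective_of_left_inverse:
  fixes C :: "'a :: field mat"
  assumes C: "C \<in> carrier_mat r m" and L: "L \<in> carrier_mat m r" and "det (L * C) \<noteq> 0"
  shows "mat_kernel C = {0\<^sub>v m}"
proof -
  have "mat_kernel C \<subseteq> mat_kernel (L * C)"
    by (rule mat_kernel_mult_subset[OF C L])
  moreover have "mat_kernel (L * C) = {0\<^sub>v m}"
    using det_nonzero_iff_kernel[of "L * C" m] assms by auto
  moreover have "0\<^sub>v m \<in> mat_kernel C"
    using C by (auto simp: mat_kernel_def)
  ultimately show ?thesis by auto
qed

text \<open>Makes a basis of the kernel the columns of an injective matrix, so that arguments on
  kernels become matrix identities. Span and linear dependence inside the kernel agree with those of
  the ambient space (\<open>span_same\<close>, \<open>lindep_same\<close>), where they translate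
  into products with \<open>K\<close>.\<close>

lemma kernel_basis_mat:
  fixes A :: "'a :: field mat"
  assumes A: "A \<in> carrier_mat nr nc"
  obtains K where "K \<in> carrier_mat nc (kernel_dim A)" and "mat_kernel K = {0\<^sub>v (kernel_dim A)}"
    and "mat_kernel A = {K *\<^sub>v v | v. v \<in> carrier_vec (kernel_dim A)}"
proof -
  interpret kernel nr nc A by unfold_locales (rule A)
  obtain B where fin: "finite B" and B: "basis B"
    using kernel_basis_exists[OF A] by auto
  have sub: "B \<subseteq> mat_kernel A" and span: "span B = mat_kernel A" and indpt: "\<not> lin_dep B"
    using B unfolding Ker.basis_def by auto
  have BV: "B \<subseteq> carrier_vec nc" using sub mat_kernel_carrier[OF A] by auto
  obtain bl where bl: "set bl = B" "distinct bl"
    using finite_distinct_list[OF fin] by auto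
  have len: "length bl = kernel_dim A"
    using Ker.dim_basis[OF fin B] distinct_card[OF bl(2)] bl(1) by simp
  define K where "K = mat_of_cols nc bl"
  have K: "K \<in> carrier_mat nc (kernel_dim A)" using len by (auto simp: K_def)
  have cols: "cols K = bl" using BV bl by (simp add: K_def)
  have "v = 0\<^sub>v (kernel_dim A)" if "v \<in> carrier_vec (kernel_dim A)" "K *\<^sub>v v = 0\<^sub>v nc" for v
  proof (rule ccontr)
    assume "v \<noteq> 0\<^sub>v (kernel_dim A)"
    from NC.lin_depI[OF K that(1) this that(2)] have "NC.lin_dep B"
      using bl cols by simp
    with indpt lindep_same[OF sub] show False by simp
  qed
  then have inj: "mat_kernel K = {0\<^sub>v (kernel_dim A)}"
    unfolding mat_kernel[OF K] using K by auto
  have "K *\<^sub>v v \<in> mat_kernel A" if "v \<in> carrier_vec (kernel_dim A)" for v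
  proof -
    have "K *\<^sub>v v = NC.lincomb (\<lambda>a. v $ find_first a (cols K)) B"
      using NC.lincomb_eq_mat_mult[OF K that] bl cols by simp
    also have "\<dots> \<in> NC.span B"
      unfolding NC.span_def using fin by auto
    finally show ?thesis using span span_same[OF sub] by simp
  qed
  moreover have "\<exists>v \<in> carrier_vec (kernel_dim A). u = K *\<^sub>v v" if "u \<in> mat_kernel A" for u
  proof -
    have "u \<in> NC.span B" using that span span_same[OF sub] by simp
    then obtain a where "u = NC.lincomb a B"
      using NC.finite_span[OF fin BV] by auto
    also have "\<dots> = K *\<^sub>v vec (kernel_dim A) (\<lambda>i. a (col K i))"
      using NC.mat_mult_eq_lincomb[OF K, of a] bl cols by simp
    finally show ?thesis by (intro bexI) auto
  qed
  ultimately have "mat_kernel A = {K *\<^sub>v v | v. v \<in> carrier_vec (kernel_dim A)}"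
    by blast
  with K inj show thesis by (rule that)
qed

section \<open>Jordan structure of block triangular matrices\<close>

lemma jordan_matrix_append:
  "jordan_matrix (as @ bs) =
    four_block_mat (jordan_matrix as) (0\<^sub>m (sum_list (map fst as)) (sum_list (map fst bs)))
      (0\<^sub>m (sum_list (map fst bs)) (sum_list (map fst as))) (jordan_matrix bs)"
  using jordan_matrix_dim[of as] jordan_matrix_dim[of bs]
  by (simp add: jordan_matrix_def diag_block_mat_append Let_def)

text \<open>Conjugation by the permutation matrix \<open>W\<close> that exchanges the two groups of
  coordinates; its inverse is the same matrix with the block sizes exchanged.\<close>

lemma similar_mat_swap_blocks:
  fixes A B :: "'a :: comm_ring_1 mat"
  assumes A: "A \<in> carrier_mat n n" and B: "B \<in> carrier_mat m m"
  shows "similar_mat (four_block_mat A (0\<^sub>m n m) (0\<^sub>m m n) B)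
    (four_block_mat B (0\<^sub>m m n) (0\<^sub>m n m) A)"
proof -
  define W where "W = (\<lambda>a b. four_block_mat (0\<^sub>m a b) (1\<^sub>m a) (1\<^sub>m b) (0\<^sub>m b a) :: 'a mat)"
  have W: "W a b \<in> carrier_mat (a + b) (a + b)" for a b
    unfolding W_def four_block_mat_def by (auto simp: Let_def)
  have inv: "W a b * W b a = 1\<^sub>m (a + b)" for a b
    unfolding W_def
    by (subst mult_four_block_mat[of _ a b _ a _ b _ _ a _ b]) (auto intro!: eq_matI)
  have "W n m * four_block_mat B (0\<^sub>m m n) (0\<^sub>m n m) A =
    four_block_mat (0\<^sub>m n m) A B (0\<^sub>m m n)"
    unfolding W_def using A B
    by (subst mult_four_block_mat[of _ n m _ n _ m _ _ m _ n]) auto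
  then have "W n m * four_block_mat B (0\<^sub>m m n) (0\<^sub>m n m) A * W m n =
    four_block_mat A (0\<^sub>m n m) (0\<^sub>m m n) B"
    unfolding W_def using A B
    by (simp, subst mult_four_block_mat[of _ n m _ n _ m _ _ n _ m]) auto
  then show ?thesis
    using inv[of n m] inv[of m n] W[of n m] W[of m n] A B
    by (intro similar_matI[where n = "n + m" and P = "W n m" and Q = "W m n"])
      (auto simp: add.commute)
qed

lemma similar_jordan_matrix_append:
  fixes as bs :: "(nat \<times> 'a :: comm_ring_1) list"
  shows "similar_mat (jordan_matrix (as @ bs)) (jordan_matrix (bs @ as))"
  unfolding jordan_matrix_append by (rule similar_mat_swap_blocks) auto

lemma similar_jordan_matrix_Cons:
  fixes as bs :: "(nat \<times> 'a :: comm_ring_1) list"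
  assumes "similar_mat (jordan_matrix as) (jordan_matrix bs)"
  shows "similar_mat (jordan_matrix (x # as)) (jordan_matrix (x # bs))"
proof -
  have len: "sum_list (map fst as) = sum_list (map fst bs)"
    using similar_matD[OF assms] by (metis insert_subset jordan_matrix_dim(1) carrier_matD(1))
  let ?a = "sum_list (map fst [x])" and ?b = "sum_list (map fst bs)"
  have "similar_mat
    (four_block_mat (jordan_matrix [x]) (0\<^sub>m ?a ?b) (0\<^sub>m ?b ?a) (jordan_matrix as))
    (four_block_mat (jordan_matrix [x]) (0\<^sub>m ?a ?b) (0\<^sub>m ?b ?a) (jordan_matrix bs))"
    by (rule similar_mat_four_block_0_0[OF similar_mat_refl[OF jordan_matrix_carrier] assms
          jordan_matrix_carrier jordan_matrix_carrier[of as, unfolded len]])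
  then show ?thesis
    using jordan_matrix_append[of "[x]" as] jordan_matrix_append[of "[x]" bs] len by simp
qed

lemma similar_jordan_matrix_of_mset:
  fixes as bs :: "(nat \<times> 'a :: comm_ring_1) list"
  assumes "mset as = mset bs"
  shows "similar_mat (jordan_matrix as) (jordan_matrix bs)"
  using assms
proof (induction as arbitrary: bs)
  case Nil
  then show ?case using similar_mat_refl[OF jordan_matrix_carrier] by auto
next
  case (Cons x as)
  then obtain ys zs where bs: "bs = ys @ x # zs"
    by (metis list.set_intros(1) set_mset_mset split_list)
  \<comment> \<open>The remaining blocks are taken in the order \<open>zs @ ys\<close>, so that a
    single rotation turns \<open>x # zs @ ys\<close> into \<open>bs\<close>.\<close>
  have "similar_mat (jordan_matrix as) (jordan_matrix (zs @ ys))"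
    using Cons bs by (intro Cons.IH) auto
  from similar_jordan_matrix_Cons[OF this]
  have "similar_mat (jordan_matrix (x # as)) (jordan_matrix ((x # zs) @ ys))" by simp
  from similar_mat_trans[OF this similar_jordan_matrix_append]
  show ?case by (simp add: bs)
qed

lemma jordan_nf_complex_exists:
  fixes A :: "complex mat"
  assumes "A \<in> carrier_mat n n"
  obtains as where "jordan_nf A as"
  using char_poly_factorized[OF assms] jordan_nf_exists[OF assms] by auto

text \<open>The number of chains of length \<open>k\<close> is a second difference of the kernel
  dimensions (\<open>compute_nr_of_jordan_blocks\<close>). Hence the two Jordan structures agree as
  multisets, and the order of the blocks does not matter up to similarity. The count is valid for
  positive \<open>k\<close>; a Jordan normal form has no chains of length zero.\<close>

lemma similar_mat_of_dim_gen_eigenspace: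
  fixes A B :: "complex mat"
  assumes A: "A \<in> carrier_mat n n" and B: "B \<in> carrier_mat k k"
    and eq: "dim_gen_eigenspace A = dim_gen_eigenspace B"
  shows "similar_mat A B"
proof -
  obtain as where as: "jordan_nf A as" using jordan_nf_complex_exists[OF A] .
  obtain bs where bs: "jordan_nf B bs" using jordan_nf_complex_exists[OF B] .
  have "count (mset as) x = count (mset bs) x" for x
  proof (cases x)
    case (Pair k ev)
    show ?thesis
    proof (cases "k = 0")
      case True
      then have "x \<notin> set as" "x \<notin> set bs"
        using as bs Pair unfolding jordan_nf_def by force+
      then show ?thesis by (metis count_mset_0_iff)
    next
      case False
      have "compute_nr_of_jordan_blocks A ev k = compute_nr_of_jordan_blocks B ev k"
        unfolding compute_nr_of_jordan_blocks_def eq ..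
      then show ?thesis
        using compute_nr_of_jordan_blocks[OF as False] compute_nr_of_jordan_blocks[OF bs False] Pair
        by (simp add: count_mset count_list_eq_length_filter)
    qed
  qed
  then have "mset as = mset bs" by (rule multiset_eqI)
  then have "similar_mat (jordan_matrix as) (jordan_matrix bs)"
    by (rule similar_jordan_matrix_of_mset)
  then show ?thesis
    using as bs unfolding jordan_nf_def by (meson similar_mat_trans similar_mat_sym)
qed

section \<open>Shortened chains and generalized eigenspaces\<close>

lemma shorten_chains_nonzero:
  assumes "0 \<notin> fst ` set bs"
  shows "0 \<notin> fst ` set (shorten_chains ev bs)"
proof
  assume "0 \<in> fst ` set (shorten_chains ev bs)"
  then obtain k \<mu> where "(k, \<mu>) \<in> set bs" "\<not> (\<mu> = ev \<and> k = 1)" "0 = (if \<mu> = ev then k - 1 else k)"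
    unfolding shorten_chains_def by (auto split: if_splits)
  moreover have "k \<noteq> 0" using assms calculation(1) by force
  ultimately show False by (auto split: if_splits)
qed

text \<open>A chain of length \<open>l\<close> contributes \<open>min k l\<close> to the kernel
  dimension at exponent \<open>k\<close>, and \<open>min (Suc k) l = 1 + min k (l - 1)\<close> for
  \<open>l > 0\<close>. A deleted chain of length one would contribute zero on the right. Exponent
  one counts the chains, which is also the loss in total size.\<close>

lemma dim_gen_eigenspace_shorten_chains:
  assumes "0 \<notin> fst ` set bs"
  shows "dim_gen_eigenspace (jordan_matrix bs) ev (Suc k) =
      dim_gen_eigenspace (jordan_matrix bs) ev 1 +
      dim_gen_eigenspace (jordan_matrix (shorten_chains ev bs)) ev k" (is ?A)
    and "\<mu> \<noteq> ev \<Longrightarrow> dim_gen_eigenspace (jordan_matrix bs) \<mu> k =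
      dim_gen_eigenspace (jordan_matrix (shorten_chains ev bs)) \<mu> k" (is "_ \<Longrightarrow> ?B")
    and "sum_list (map fst bs) =
      dim_gen_eigenspace (jordan_matrix bs) ev 1 + sum_list (map fst (shorten_chains ev bs))" (is ?C)
proof -
  have cons: "shorten_chains ev ((l, \<nu>) # cs) = (if \<nu> = ev then if l = 1 then [] else [(l - 1, \<nu>)]
    else [(l, \<nu>)]) @ shorten_chains ev cs" for l \<nu> cs
    by (simp add: shorten_chains_def)
  have nil: "shorten_chains ev [] = []" by (simp add: shorten_chains_def)
  show ?A
    using assms unfolding dim_gen_eigenspace_jordan_matrix
  proof (induction bs)
    case (Cons b cs)
    obtain l \<nu> where b: "b = (l, \<nu>)" by force
    have "min (Suc k) l = min 1 l + (if l = 1 then 0 else min k (l - 1))" if "l \<noteq> 0" using that by auto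
    then show ?case using Cons unfolding b cons by (cases "\<nu> = ev"; cases "l = 1") auto
  qed (simp add: nil)
  show ?B if "\<mu> \<noteq> ev"
    using that unfolding dim_gen_eigenspace_jordan_matrix
  proof (induction bs)
    case (Cons b cs)
    then show ?case by (cases b) (simp add: cons)
  qed (simp add: nil)
  show ?C
    using assms unfolding dim_gen_eigenspace_jordan_matrix
  proof (induction bs)
    case (Cons b cs)
    then show ?case by (cases b) (auto simp: cons)
  qed (simp add: nil)
qed

text \<open>The zero matrix is viewed as the \<open>n\<close>-th power of a nilpotent Jordan block,
  whose kernel dimension is already known.\<close>

lemma kernel_dim_zero_mat: "kernel_dim (0\<^sub>m n n :: 'a :: field mat) = n"
proof -
  have "jordan_block n (0 :: 'a) ^\<^sub>m n = 0\<^sub>m n n"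
    unfolding jordan_block_zero_pow by (intro eq_matI) auto
  then show ?thesis
    using dim_kernel_zero_jordan_block_pow[of n n, where ?'a = 'a] by (simp add: kernel_dim_def)
qed

lemma kernel_dim_cong:
  assumes "mat_kernel A = mat_kernel B" and "dim_col A = dim_col B"
  shows "kernel_dim A = kernel_dim B"
  using assms by (simp add: kernel_dim_def)

lemma pow_mat_commute:
  assumes "(A :: 'a :: semiring_1 mat) \<in> carrier_mat n n"
  shows "A ^\<^sub>m k * A = A * A ^\<^sub>m k"
proof (induction k)
  case (Suc k)
  show ?case
    using Suc assms assoc_mult_mat[OF assms pow_carrier_mat[OF assms, of k] assms] by simp
qed (use assms in auto)

lemma char_matrix_four_block:
  assumes "P \<in> carrier_mat n m" and "B \<in> carrier_mat m m"
  shows "char_matrix (four_block_mat (c \<cdot>\<^sub>m 1\<^sub>m n) P (0\<^sub>m m n) B) \<mu> =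
    four_block_mat ((c - \<mu>) \<cdot>\<^sub>m 1\<^sub>m n) P (0\<^sub>m m n) (char_matrix B \<mu>)"
  using assms unfolding char_matrix_def by (intro eq_matI) auto

lemma zero_mat_mult_vec:
  assumes "v \<in> carrier_vec k"
  shows "0\<^sub>m r k *\<^sub>v v = (0\<^sub>v r :: 'a :: semiring_0 vec)"
  using assms by (intro eq_vecI) auto

context
  fixes n m :: nat and P B :: "complex mat" and ev :: complex
  assumes P: "P \<in> carrier_mat n m" and B: "B \<in> carrier_mat m m"
begin

text \<open>The corner entry \<open>ev - \<mu>\<close> is nonzero, so the \<open>k\<close>-th power
  of the shifted matrix is the block diagonal matrix with blocks \<open>1\<close> and
  \<open>D^k\<close> times the invertible matrix \<open>?W\<close>. The upper right block
  \<open>Y\<close> of the power is absorbed in \<open>?W\<close>, so its exact value is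
  irrelevant.\<close>

lemma dim_gen_eigenspace_block_other:
  assumes "\<mu> \<noteq> ev"
  shows "dim_gen_eigenspace (four_block_mat (ev \<cdot>\<^sub>m 1\<^sub>m n) P (0\<^sub>m m n) B) \<mu> k =
    dim_gen_eigenspace B \<mu> k"
proof -
  define c where "c = ev - \<mu>"
  define D where "D = char_matrix B \<mu>"
  have D: "D \<in> carrier_mat m m" using B by (simp add: D_def)
  note Dk = pow_carrier_mat[OF D, of k]
  let ?X = "four_block_mat (c \<cdot>\<^sub>m 1\<^sub>m n) P (0\<^sub>m m n) D"
  have "\<exists>Y \<in> carrier_mat n m. ?X ^\<^sub>m k = four_block_mat (c ^ k \<cdot>\<^sub>m 1\<^sub>m n) Y (0\<^sub>m m n) (D ^\<^sub>m k)"
  proof (induction k)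
    case 0
    show ?case using D by (intro bexI[of _ "0\<^sub>m n m"]) (auto intro!: eq_matI)
  next
    case (Suc k)
    then obtain Y where Y: "Y \<in> carrier_mat n m"
      "?X ^\<^sub>m k = four_block_mat (c ^ k \<cdot>\<^sub>m 1\<^sub>m n) Y (0\<^sub>m m n) (D ^\<^sub>m k)" by auto
    have "?X ^\<^sub>m Suc k = four_block_mat ((c ^ k \<cdot>\<^sub>m 1\<^sub>m n) * (c \<cdot>\<^sub>m 1\<^sub>m n) + Y * 0\<^sub>m m n)
       ((c ^ k \<cdot>\<^sub>m 1\<^sub>m n) * P + Y * D)
       (0\<^sub>m m n * (c \<cdot>\<^sub>m 1\<^sub>m n) + D ^\<^sub>m k * 0\<^sub>m m n) (0\<^sub>m m n * P + D ^\<^sub>m k * D)"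
      using Y D P pow_carrier_mat[OF D, of k]
      by (simp, subst mult_four_block_mat[of _ n n _ m _ m _ _ n _ m]) auto
    moreover have "(c ^ k \<cdot>\<^sub>m 1\<^sub>m n) * (c \<cdot>\<^sub>m 1\<^sub>m n) + Y * 0\<^sub>m m n = c ^ Suc k \<cdot>\<^sub>m 1\<^sub>m n"
      using Y by (subst mult_smult_distrib[of _ n n _ n]) (auto intro!: eq_matI)
    moreover have "0\<^sub>m m n * (c \<cdot>\<^sub>m 1\<^sub>m n) + D ^\<^sub>m k * 0\<^sub>m m n = 0\<^sub>m m n"
      using D by (auto intro!: eq_matI)
    moreover have "0\<^sub>m m n * P + D ^\<^sub>m k * D = D ^\<^sub>m Suc k"
      using P D left_add_zero_mat[OF mult_carrier_mat[OF pow_carrier_mat[OF D, of k] D]] by simp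
    ultimately show ?case
      using Y P D by (intro bexI[of _ "(c ^ k \<cdot>\<^sub>m 1\<^sub>m n) * P + Y * D"]) auto
  qed
  then obtain Y where Y: "Y \<in> carrier_mat n m"
    and X: "?X ^\<^sub>m k = four_block_mat (c ^ k \<cdot>\<^sub>m 1\<^sub>m n) Y (0\<^sub>m m n) (D ^\<^sub>m k)" by auto
  let ?M = "four_block_mat (1\<^sub>m n) (0\<^sub>m n m) (0\<^sub>m m n) (D ^\<^sub>m k)"
  let ?W = "four_block_mat (c ^ k \<cdot>\<^sub>m 1\<^sub>m n) Y (0\<^sub>m m n) (1\<^sub>m m)"
  have W: "?W \<in> carrier_mat (n + m) (n + m)" using Y by auto
  have "det ?W = det (c ^ k \<cdot>\<^sub>m 1\<^sub>m n :: complex mat) * det (1\<^sub>m m)"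
    using Y by (intro det_four_block_mat_lower_left_zero) auto
  then have "det ?W \<noteq> 0" using assms by (simp add: c_def)
  note inv = mat_inv[OF W this]
  have "?X ^\<^sub>m k = ?M * ?W"
    unfolding X using Y right_mult_one_mat[OF Dk] right_mult_zero_mat[OF Dk] left_add_zero_mat[OF Dk]
    by (subst mult_four_block_mat[OF _ _ _ Dk, of _ n n]) auto
  then have "kernel_dim (?X ^\<^sub>m k) = kernel.dim (n + m) (?M * ?W)"
    using Y by (simp add: kernel_dim_def)
  also have "\<dots> = kernel.dim (n + m) ?M"
    by (rule mat_kernel_dim_mult_eq_right[OF four_block_carrier_mat[OF one_carrier_mat Dk] W inv(1,2)])
  also have "\<dots> = kernel.dim n (1\<^sub>m n :: complex mat) + kernel.dim m (D ^\<^sub>m k)"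
    using Dk by (intro kernel_four_block_0_mat) auto
  also have "\<dots> = kernel_dim (D ^\<^sub>m k)"
    using Dk kernel_one_mat(1)[of n, where ?'a = complex]
    by (simp add: kernel_dim_def del: pow_mat_dim)
  finally show ?thesis
    unfolding dim_gen_eigenspace_def char_matrix_four_block[OF P B] c_def D_def .
qed

text \<open>On a vector \<open>(a, d)\<close> the power with exponent \<open>Suc k\<close> depends
  only on \<open>y = D^k d\<close>, and it vanishes iff \<open>P y = 0\<close> and
  \<open>D y = 0\<close>, which by \<open>inj\<close> means \<open>y = 0\<close>. So its kernel is
  that of the block diagonal matrix with blocks \<open>0\<close> and \<open>D^k\<close>; the zero
  block accounts for the summand \<open>n\<close>.\<close>

lemma dim_gen_eigenspace_block_Suc:
  assumes inj: "mat_kernel P \<inter> mat_kernel (char_matrix B ev) \<subseteq> {0\<^sub>v m}"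
  shows "dim_gen_eigenspace (four_block_mat (ev \<cdot>\<^sub>m 1\<^sub>m n) P (0\<^sub>m m n) B) ev (Suc k) =
    n + dim_gen_eigenspace B ev k"
proof -
  define D where "D = char_matrix B ev"
  have D: "D \<in> carrier_mat m m" using B by (simp add: D_def)
  note Dk = pow_carrier_mat[OF D, of k]
  let ?X = "four_block_mat (0\<^sub>m n n) P (0\<^sub>m m n) D"
  have "?X ^\<^sub>m Suc k = four_block_mat (0\<^sub>m n n) (P * D ^\<^sub>m k) (0\<^sub>m m n) (D ^\<^sub>m Suc k)" for k
  proof (induction k)
    case 0
    show ?case using D P by (intro eq_matI) auto
  next
    case (Suc k)
    have "?X ^\<^sub>m Suc (Suc k) = four_block_mat (0\<^sub>m n n) (P * D ^\<^sub>m k) (0\<^sub>m m n) (D ^\<^sub>m Suc k) * ?X"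
      using Suc by simp
    also have "\<dots> = four_block_mat (0\<^sub>m n n) (P * D ^\<^sub>m Suc k) (0\<^sub>m m n) (D ^\<^sub>m Suc (Suc k))"
      using P D pow_carrier_mat[OF D, of k]
      by (subst mult_four_block_mat[of _ n n _ m _ m _ _ n _ m])
        (auto simp: assoc_mult_mat[of P n m "D ^\<^sub>m k" m D m])
    finally show ?case .
  qed
  then have X: "?X ^\<^sub>m Suc k = four_block_mat (0\<^sub>m n n) (P * D ^\<^sub>m k) (0\<^sub>m m n) (D * D ^\<^sub>m k)"
    using pow_mat_commute[OF D, of k] by simp
  let ?Y = "four_block_mat (0\<^sub>m n n) (0\<^sub>m n m) (0\<^sub>m m n) (D ^\<^sub>m k)"
  have "mat_kernel (?X ^\<^sub>m Suc k) = mat_kernel ?Y"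
  proof (rule Set.set_eqI)
    fix v :: "complex vec"
    show "v \<in> mat_kernel (?X ^\<^sub>m Suc k) \<longleftrightarrow> v \<in> mat_kernel ?Y"
    proof (cases "v \<in> carrier_vec (n + m)")
      case True
      define a d where "a = vec_first v n" and "d = vec_last v m"
      have v: "v = a @\<^sub>v d" and a: "a \<in> carrier_vec n" and d: "d \<in> carrier_vec m"
        using True by (auto simp: a_def d_def)
      define y where "y = D ^\<^sub>m k *\<^sub>v d"
      have y: "y \<in> carrier_vec m" using Dk d by (auto simp: y_def)
      have "?X ^\<^sub>m Suc k *\<^sub>v v = (P *\<^sub>v y) @\<^sub>v (D *\<^sub>v y)"
        unfolding X v y_def using a d P D Dk
        by (subst four_block_mat_mult_vec[of _ n n _ m _ m])
          (auto simp: zero_mat_mult_vec assoc_mult_mat_vec[of _ _ m _ m])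
      moreover have "?Y *\<^sub>v v = 0\<^sub>v n @\<^sub>v y"
        unfolding v y_def using a d Dk by (subst four_block_mat_mult_vec[of _ n n _ m _ m]) (auto simp: zero_mat_mult_vec)
      moreover have "0\<^sub>v (n + m) = 0\<^sub>v n @\<^sub>v 0\<^sub>v m" by auto
      moreover have "P *\<^sub>v y = 0\<^sub>v n \<and> D *\<^sub>v y = 0\<^sub>v m \<longleftrightarrow> y = 0\<^sub>v m"
      proof
        assume "P *\<^sub>v y = 0\<^sub>v n \<and> D *\<^sub>v y = 0\<^sub>v m"
        then have "y \<in> mat_kernel P \<inter> mat_kernel D"
          using mat_kernelI[OF P y] mat_kernelI[OF D y] by auto
        then show "y = 0\<^sub>v m" using inj by (auto simp: D_def)
      qed (use P D in auto)
      moreover have X': "?X ^\<^sub>m Suc k \<in> carrier_mat (n + m) (n + m)"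
        using D by (intro pow_carrier_mat) auto
      moreover have Y': "?Y \<in> carrier_mat (n + m) (n + m)" using Dk by auto
      ultimately show ?thesis
        unfolding mat_kernel[OF X'] mat_kernel[OF Y']
        using True P D y append_vec_eq[of "P *\<^sub>v y" n "0\<^sub>v n" "D *\<^sub>v y" "0\<^sub>v m"]
          append_vec_eq[of "0\<^sub>v n" n "0\<^sub>v n" y "0\<^sub>v m"]
        by (auto simp del: pow_mat.simps)
    qed (use Dk D in \<open>auto simp: mat_kernel_def\<close>)
  qed
  then have "kernel_dim (?X ^\<^sub>m Suc k) = kernel_dim ?Y"
    using D Dk by (intro kernel_dim_cong) auto
  also have "\<dots> = kernel.dim n (0\<^sub>m n n :: complex mat) + kernel.dim m (D ^\<^sub>m k)"
    using kernel_four_block_0_mat[OF refl zero_carrier_mat Dk] Dk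
    by (simp add: kernel_dim_def del: pow_mat_dim)
  also have "\<dots> = n + kernel_dim (D ^\<^sub>m k)"
    using Dk kernel_dim_zero_mat[of n, where ?'a = complex]
    by (simp add: kernel_dim_def del: pow_mat_dim)
  also have "?X = four_block_mat ((ev - ev) \<cdot>\<^sub>m 1\<^sub>m n) P (0\<^sub>m m n) D"
    using D by (intro eq_matI) auto
  finally show ?thesis
    unfolding dim_gen_eigenspace_def char_matrix_four_block[OF P B] D_def .
qed

end

text \<open>By the two preceding lemmas, passing from \<open>B\<close> to the block matrix lengthens each chain for
  \<open>ev\<close> by one unit and adds chains of length one until there are \<open>n\<close> chains.\<close>

lemma block_sim_orbit_iff:
  assumes bs: "0 \<notin> fst ` set bs" and P: "P \<in> carrier_mat n m" and B: "B \<in> carrier_mat m m"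
    and inj: "mat_kernel P \<inter> mat_kernel (char_matrix B ev) \<subseteq> {0\<^sub>v m}"
    and n: "dim_gen_eigenspace (jordan_matrix bs) ev 1 = n"
  shows "four_block_mat (ev \<cdot>\<^sub>m 1\<^sub>m n) P (0\<^sub>m m n) B \<in> sim_orbit (jordan_matrix bs) \<longleftrightarrow>
    B \<in> jordan_class m (shorten_chains ev bs)"
proof -
  let ?T = "four_block_mat (ev \<cdot>\<^sub>m 1\<^sub>m n) P (0\<^sub>m m n) B" and ?J = "jordan_matrix bs"
    and ?J' = "jordan_matrix (shorten_chains ev bs)"
  have T: "?T \<in> carrier_mat (n + m) (n + m)" using B by auto
  note short = dim_gen_eigenspace_shorten_chains[OF bs, where ev = ev, unfolded n]
  note block = dim_gen_eigenspace_block_Suc[OF P B inj] dim_gen_eigenspace_block_other[OF P B]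
  \<comment> \<open>At \<open>ev\<close> the comparison shifts exponents by one, so exponent zero of
    the large matrices has to be treated apart.\<close>
  have zero: "dim_gen_eigenspace A \<mu> 0 = 0" if "A \<in> carrier_mat k k" for A :: "complex mat" and \<mu> k
    using char_matrix_closed[OF that, of \<mu>] kernel_one_mat(1)[of k, where ?'a = complex]
    by (simp add: dim_gen_eigenspace_def kernel_dim_def)
  have "similar_mat ?T ?J \<longleftrightarrow> dim_gen_eigenspace ?T = dim_gen_eigenspace ?J"
    using similar_mat_of_dim_gen_eigenspace[OF T jordan_matrix_carrier] dim_gen_eigenspace_similar
    by auto
  also have "\<dots> \<longleftrightarrow> dim_gen_eigenspace B = dim_gen_eigenspace ?J'"
  proof
    assume eq: "dim_gen_eigenspace ?T = dim_gen_eigenspace ?J"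
    have "dim_gen_eigenspace B \<mu> k = dim_gen_eigenspace ?J' \<mu> k" for \<mu> k
      using block short(1)[of k] short(2)[of \<mu> k] fun_cong[OF fun_cong[OF eq], of ev "Suc k"]
        fun_cong[OF fun_cong[OF eq], of \<mu> k]
      by (cases "\<mu> = ev") auto
    then show "dim_gen_eigenspace B = dim_gen_eigenspace ?J'" by blast
  next
    assume eq: "dim_gen_eigenspace B = dim_gen_eigenspace ?J'"
    have "dim_gen_eigenspace ?T \<mu> k = dim_gen_eigenspace ?J \<mu> k" for \<mu> k
      using block short(1)[of "k - 1"] short(2)[of \<mu> k] zero[OF T] zero[OF jordan_matrix_carrier[of bs]] eq
      by (cases "\<mu> = ev"; cases k) auto
    then show "dim_gen_eigenspace ?T = dim_gen_eigenspace ?J" by blast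
  qed
  also have "\<dots> \<longleftrightarrow> similar_mat B ?J'"
    using similar_mat_of_dim_gen_eigenspace[OF B jordan_matrix_carrier] dim_gen_eigenspace_similar
    by auto
  finally show ?thesis
    using B shorten_chains_nonzero[OF bs] by (auto simp: sim_orbit_def jordan_class_def jordan_nf_def)
qed

section \<open>The block form\<close>

lemma add_mult_dim:
  fixes A B C :: "'a :: semiring_0 mat"
  assumes "dim_row A = dim_row B" "dim_col A = dim_col B" "dim_col B = dim_row C"
  shows "(A + B) * C = A * C + B * C"
  using assms by (intro add_mult_distrib_mat) (auto intro: carrier_matI)

lemma mult_add_dim:
  fixes A B C :: "'a :: semiring_0 mat"
  assumes "dim_row B = dim_row C" "dim_col B = dim_col C" "dim_col A = dim_row B"
  shows "A * (B + C) = A * B + A * C"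
  using assms by (intro mult_add_distrib_mat) (auto intro: carrier_matI)

lemma minus_mult_dim:
  fixes A B C :: "'a :: ring mat"
  assumes "dim_row A = dim_row B" "dim_col A = dim_col B" "dim_col B = dim_row C"
  shows "(A - B) * C = A * C - B * C"
  using assms by (intro minus_mult_distrib_mat) (auto intro: carrier_matI)

lemma mult_minus_dim:
  fixes A B C :: "'a :: ring mat"
  assumes "dim_row B = dim_row C" "dim_col B = dim_col C" "dim_col A = dim_row B"
  shows "A * (B - C) = A * B - A * C"
  using assms by (intro mult_minus_distrib_mat) (auto intro: carrier_matI)

lemma smult_mult_dim:
  fixes A B :: "'a :: comm_semiring_1 mat"
  assumes "dim_col A = dim_row B"
  shows "(c \<cdot>\<^sub>m A) * B = c \<cdot>\<^sub>m (A * B)" and "A * (c \<cdot>\<^sub>m B) = c \<cdot>\<^sub>m (A * B)"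
  using assms mult_smult_assoc_mat[of A _ _ B] mult_smult_distrib[of A _ _ B]
  by (auto intro: carrier_matI)

lemma mult_zero_cancel_dim:
  fixes A B C :: "'a :: semiring_0 mat"
  assumes "A * B = 0\<^sub>m k l" and "dim_col A = dim_row B" and "dim_col B = dim_row C"
  shows "A * (B * C) = 0\<^sub>m k (dim_col C)"
proof -
  have "dim_col B = l" using assms(1) by (metis index_mult_mat(3) index_zero_mat(3))
  then show ?thesis
    using mult_assoc_dim[OF assms(2,3)] assms(1,3) by simp
qed

text \<open>Together with \<open>mult_assoc_dim\<close> these expand matrix expressions into sums of
  right-nested products by rewriting. Premises with \<open>carrier_mat\<close> would mention
  dimensions that do not occur in the rewritten term, so that the simplifier would have to guess
  them.\<close>

lemmas mat_distribs = add_mult_dim mult_add_dim minus_mult_dim mult_minus_dim smult_mult_dim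

section \<open>Selection of blocks by matrices\<close>

definition sel1 :: "nat \<Rightarrow> nat \<Rightarrow> complex mat" where
  "sel1 n m = mat (n + m) n (\<lambda>(i, j). if i = j then 1 else 0)"

definition sel2 :: "nat \<Rightarrow> nat \<Rightarrow> complex mat" where
  "sel2 n m = mat (n + m) m (\<lambda>(i, j). if i = n + j then 1 else 0)"

lemma sel_dim [simp]:
  "dim_row (sel1 n m) = n + m" "dim_col (sel1 n m) = n"
  "dim_row (sel2 n m) = n + m" "dim_col (sel2 n m) = m"
  by (simp_all add: sel1_def sel2_def)

lemma sel_carrier [simp]:
  "sel1 n m \<in> carrier_mat (n + m) n" "sel2 n m \<in> carrier_mat (n + m) m"
  by (simp_all add: sel1_def sel2_def)

lemma col_sel:
  "j < n \<Longrightarrow> col (sel1 n m) j = unit_vec (n + m) j"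
  "j < m \<Longrightarrow> col (sel2 n m) j = unit_vec (n + m) (n + j)"
  by (auto simp: sel1_def sel2_def unit_vec_def)

lemma index_mult_sel:
  assumes "dim_col A = n + m" and "i < dim_row A"
  shows "j < n \<Longrightarrow> (A * sel1 n m) $$ (i, j) = A $$ (i, j)"
    and "j < m \<Longrightarrow> (A * sel2 n m) $$ (i, j) = A $$ (i, n + j)"
  using assms by (simp_all add: col_sel)

lemma index_sel_mult:
  assumes "dim_row A = n + m" and "j < dim_col A"
  shows "i < n \<Longrightarrow> ((sel1 n m)\<^sup>T * A) $$ (i, j) = A $$ (i, j)"
    and "i < m \<Longrightarrow> ((sel2 n m)\<^sup>T * A) $$ (i, j) = A $$ (n + i, j)"
  using assms by (simp_all add: col_sel scalar_prod_left_unit[of "col A j" "n + m"] carrier_dim_vec)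

lemma index_sel_mult_vec:
  assumes "dim_vec v = n + m"
  shows "i < n \<Longrightarrow> ((sel1 n m)\<^sup>T *\<^sub>v v) $ i = v $ i"
    and "i < m \<Longrightarrow> ((sel2 n m)\<^sup>T *\<^sub>v v) $ i = v $ (n + i)"
  using assms carrier_vecI[OF assms] by (simp_all add: col_sel)

text \<open>Blocks are cut out by products with \<open>sel1\<close>, \<open>sel2\<close> and their
  transposes. With these relations and \<open>sel_complete\<close>, block computations become
  rewriting in an associative algebra instead of bookkeeping of index ranges.\<close>

lemma sel_orthonormal:
  "(sel1 n m)\<^sup>T * sel1 n m = 1\<^sub>m n" "(sel2 n m)\<^sup>T * sel2 n m = 1\<^sub>m m"
  "(sel1 n m)\<^sup>T * sel2 n m = 0\<^sub>m n m" "(sel2 n m)\<^sup>T * sel1 n m = 0\<^sub>m m n"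
  by (intro eq_matI; simp add: index_sel_mult del: index_mult_mat(1); simp add: sel1_def sel2_def)+

lemma sel_cancel:
  "dim_row X = n \<Longrightarrow> (sel1 n m)\<^sup>T * (sel1 n m * X) = X"
  "dim_row X = m \<Longrightarrow> (sel2 n m)\<^sup>T * (sel2 n m * X) = X"
  "dim_row X = m \<Longrightarrow> (sel1 n m)\<^sup>T * (sel2 n m * X) = 0\<^sub>m n (dim_col X)"
  "dim_row X = n \<Longrightarrow> (sel2 n m)\<^sup>T * (sel1 n m * X) = 0\<^sub>m m (dim_col X)"
  using mult_cancel_dim[OF sel_orthonormal(1), of n m X] mult_cancel_dim[OF sel_orthonormal(2), of n m X]
    mult_zero_cancel_dim[OF sel_orthonormal(3), of n m X]
    mult_zero_cancel_dim[OF sel_orthonormal(4), of n m X]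
  by simp_all

lemma eq_mat_blocksI:
  assumes "X \<in> carrier_mat (n + m) k" and "Y \<in> carrier_mat (n + m) k"
    and "(sel1 n m)\<^sup>T * X = (sel1 n m)\<^sup>T * Y" and "(sel2 n m)\<^sup>T * X = (sel2 n m)\<^sup>T * Y"
  shows "X = Y"
proof (intro eq_matI)
  fix i j assume "i < dim_row Y" "j < dim_col Y"
  then have i: "i < n + m" and j: "j < k" using assms by auto
  show "X $$ (i, j) = Y $$ (i, j)"
  proof (cases "i < n")
    case True
    then show ?thesis
      using index_sel_mult(1)[of X n m j i] index_sel_mult(1)[of Y n m j i] assms(1-3) j by auto
  next
    case False
    then have "i - n < m" "n + (i - n) = i" using i by auto
    then show ?thesis
      using index_sel_mult(2)[of X n m j "i - n"] index_sel_mult(2)[of Y n m j "i - n"] assms(1,2,4) j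
      by auto
  qed
qed (use assms in auto)

lemma sel_complete: "sel1 n m * (sel1 n m)\<^sup>T + sel2 n m * (sel2 n m)\<^sup>T = 1\<^sub>m (n + m)"
proof (rule eq_mat_blocksI)
  show "(sel1 n m)\<^sup>T * (sel1 n m * (sel1 n m)\<^sup>T + sel2 n m * (sel2 n m)\<^sup>T) = (sel1 n m)\<^sup>T * 1\<^sub>m (n + m)"
    by (simp add: mat_distribs sel_cancel)
  show "(sel2 n m)\<^sup>T * (sel1 n m * (sel1 n m)\<^sup>T + sel2 n m * (sel2 n m)\<^sup>T) = (sel2 n m)\<^sup>T * 1\<^sub>m (n + m)"
    by (simp add: mat_distribs sel_cancel)
qed auto

lemma four_block_eq_sel:
  assumes "a \<in> carrier_mat n n" "b \<in> carrier_mat n m" "c \<in> carrier_mat m n" "d \<in> carrier_mat m m"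
  shows "(sel1 n m)\<^sup>T * (four_block_mat a b c d * sel1 n m) = a"
    "(sel1 n m)\<^sup>T * (four_block_mat a b c d * sel2 n m) = b"
    "(sel2 n m)\<^sup>T * (four_block_mat a b c d * sel1 n m) = c"
    "(sel2 n m)\<^sup>T * (four_block_mat a b c d * sel2 n m) = d"
  using assms
  by (intro eq_matI; simp add: index_sel_mult index_mult_sel del: index_mult_mat(1); fail)+

lemma eq_mat_four_blocksI:
  assumes X: "X \<in> carrier_mat (n + m) (n + m)" and Y: "Y \<in> carrier_mat (n + m) (n + m)"
    and "(sel1 n m)\<^sup>T * (X * sel1 n m) = (sel1 n m)\<^sup>T * (Y * sel1 n m)"
    and "(sel1 n m)\<^sup>T * (X * sel2 n m) = (sel1 n m)\<^sup>T * (Y * sel2 n m)"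
    and "(sel2 n m)\<^sup>T * (X * sel1 n m) = (sel2 n m)\<^sup>T * (Y * sel1 n m)"
    and "(sel2 n m)\<^sup>T * (X * sel2 n m) = (sel2 n m)\<^sup>T * (Y * sel2 n m)"
  shows "X = Y"
proof -
  have 1: "X * sel1 n m = Y * sel1 n m" and 2: "X * sel2 n m = Y * sel2 n m"
    using assms by (auto intro!: eq_mat_blocksI[of _ n m])
  have decomp: "Z = Z * sel1 n m * (sel1 n m)\<^sup>T + Z * sel2 n m * (sel2 n m)\<^sup>T"
    if "Z \<in> carrier_mat (n + m) (n + m)" for Z
  proof -
    have "Z = Z * (sel1 n m * (sel1 n m)\<^sup>T + sel2 n m * (sel2 n m)\<^sup>T)"
      using that by (simp add: sel_complete)
    then show ?thesis
      using that by (simp add: mat_distribs mult_assoc_dim)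
  qed
  show ?thesis
    using decomp[OF X] decomp[OF Y] 1 2 by simp
qed

text \<open>\<open>(graph_mat, sel2)\<close> is the lower unitriangular matrix of the block form, and
  \<open>(sel1\<^sup>T; cograph_mat)\<close> is its inverse.\<close>

definition graph_mat :: "nat \<Rightarrow> nat \<Rightarrow> complex mat \<Rightarrow> complex mat" where
  "graph_mat n m Q = sel1 n m + sel2 n m * Q"

definition cograph_mat :: "nat \<Rightarrow> nat \<Rightarrow> complex mat \<Rightarrow> complex mat" where
  "cograph_mat n m Q = (sel2 n m)\<^sup>T - Q * (sel1 n m)\<^sup>T"

context
  fixes n m :: nat and Q :: "complex mat"
  assumes Q: "Q \<in> carrier_mat m n"
begin

lemma graph_mat_carrier [simp]:
  "graph_mat n m Q \<in> carrier_mat (n + m) n" "cograph_mat n m Q \<in> carrier_mat m (n + m)"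
  "dim_row (graph_mat n m Q) = n + m" "dim_col (graph_mat n m Q) = n"
  "dim_row (cograph_mat n m Q) = m" "dim_col (cograph_mat n m Q) = n + m"
  using Q by (auto simp: graph_mat_def cograph_mat_def)

lemma graph_mat_relations:
  "cograph_mat n m Q * graph_mat n m Q = 0\<^sub>m m n" "cograph_mat n m Q * sel2 n m = 1\<^sub>m m"
  "(sel1 n m)\<^sup>T * graph_mat n m Q = 1\<^sub>m n"
  using Q sel_orthonormal[of n m]
  by (auto simp: graph_mat_def cograph_mat_def mat_distribs mult_assoc_dim sel_cancel intro!: eq_matI
      simp del: index_mult_mat(1))

lemma graph_mat_complete:
  "graph_mat n m Q * (sel1 n m)\<^sup>T + sel2 n m * cograph_mat n m Q = 1\<^sub>m (n + m)"
proof -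
  have "graph_mat n m Q * (sel1 n m)\<^sup>T + sel2 n m * cograph_mat n m Q =
      sel1 n m * (sel1 n m)\<^sup>T + sel2 n m * (sel2 n m)\<^sup>T"
    using Q by (auto simp: graph_mat_def cograph_mat_def mat_distribs mult_assoc_dim intro!: eq_matI
      simp del: index_mult_mat(1))
  then show ?thesis by (simp add: sel_complete)
qed

text \<open>Expansion in the basis formed by the columns of \<open>graph_mat\<close> and
  \<open>sel2\<close>; the coefficients come from the rows of the inverse matrix.\<close>

lemma graph_mat_decompose:
  assumes "X \<in> carrier_mat (n + m) k"
  shows "X = graph_mat n m Q * ((sel1 n m)\<^sup>T * X) + sel2 n m * (cograph_mat n m Q * X)"
proof -
  have "X = (graph_mat n m Q * (sel1 n m)\<^sup>T + sel2 n m * cograph_mat n m Q) * X"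
    using assms by (simp add: graph_mat_complete)
  then show ?thesis
    using assms by (simp add: mat_distribs mult_assoc_dim)
qed

abbreviation (input) "lower \<equiv> four_block_mat (1\<^sub>m n) (0\<^sub>m n m) Q (1\<^sub>m m)"

lemma lower_inverse:
  "lower * four_block_mat (1\<^sub>m n) (0\<^sub>m n m) (- Q) (1\<^sub>m m) = 1\<^sub>m (n + m)"
  using Q by (subst mult_four_block_mat[of _ n n _ m _ m _ _ n _ m]) (auto intro!: eq_matI)

lemma mat_inv_lower: "mat_inv lower = four_block_mat (1\<^sub>m n) (0\<^sub>m n m) (- Q) (1\<^sub>m m)"
  using Q by (intro mat_inv_unique[of _ "n + m"] lower_inverse) auto

text \<open>Multiplied out, the entries are visibly polynomial in those of \<open>Q\<close>,
  \<open>P\<close>, \<open>A'\<close>, which makes \<open>assemble\<close> a regular map.\<close>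

lemma assemble_eq:
  assumes P: "P \<in> carrier_mat n m" and A': "A' \<in> carrier_mat m m"
  shows "assemble ev n m (Q, P, A') =
    four_block_mat (ev \<cdot>\<^sub>m 1\<^sub>m n - P * Q) P (ev \<cdot>\<^sub>m Q - (Q * P + A') * Q) (Q * P + A')"
proof -
  have "assemble ev n m (Q, P, A') =
    lower * four_block_mat (ev \<cdot>\<^sub>m 1\<^sub>m n) P (0\<^sub>m m n) A' *
      four_block_mat (1\<^sub>m n) (0\<^sub>m n m) (- Q) (1\<^sub>m m)"
    by (simp add: assemble_def Let_def mat_inv_lower)
  also have "lower * four_block_mat (ev \<cdot>\<^sub>m 1\<^sub>m n) P (0\<^sub>m m n) A' =
    four_block_mat (ev \<cdot>\<^sub>m 1\<^sub>m n) P (ev \<cdot>\<^sub>m Q) (Q * P + A')"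
    using Q P A' by (subst mult_four_block_mat[of _ n n _ m _ m _ _ n _ m])
      (auto simp: mat_distribs)
  also have "\<dots> * four_block_mat (1\<^sub>m n) (0\<^sub>m n m) (- Q) (1\<^sub>m m) =
    four_block_mat (ev \<cdot>\<^sub>m 1\<^sub>m n - P * Q) P (ev \<cdot>\<^sub>m Q - (Q * P + A') * Q) (Q * P + A')"
    using Q P A' by (subst mult_four_block_mat[of _ n n _ m _ m _ _ n _ m])
      (auto intro!: eq_matI simp del: index_mult_mat(1))
  finally show ?thesis .
qed

lemma assemble_similar:
  assumes P: "P \<in> carrier_mat n m" and A': "A' \<in> carrier_mat m m"
  shows "similar_mat (assemble ev n m (Q, P, A')) (four_block_mat (ev \<cdot>\<^sub>m 1\<^sub>m n) P (0\<^sub>m m n) A')"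
proof (rule similar_matI[of _ _ lower "mat_inv lower" "n + m"])
  have L: "lower \<in> carrier_mat (n + m) (n + m)" using Q by auto
  have det: "det lower \<noteq> 0"
    using lower_inverse Q by (intro det_nonzero_right_inverse[OF L]) auto
  show "lower * mat_inv lower = 1\<^sub>m (n + m)" "mat_inv lower * lower = 1\<^sub>m (n + m)"
    using mat_inv[OF L det] by auto
  have "assemble ev n m (Q, P, A') \<in> carrier_mat (n + m) (n + m)"
    unfolding assemble_eq[OF P A'] using Q P A' by auto
  then show "{assemble ev n m (Q, P, A'), four_block_mat (ev \<cdot>\<^sub>m 1\<^sub>m n) P (0\<^sub>m m n) A', lower,
      mat_inv lower} \<subseteq> carrier_mat (n + m) (n + m)"
    using L mat_inv[OF L det] P A' by auto
qed (simp add: assemble_def Let_def)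

text \<open>Column by column, the block form says \<open>A G = ev G\<close> and
  \<open>A S2 = G P + S2 A'\<close>. The second equation is solved for \<open>P\<close> and
  \<open>A'\<close> by the inverse of \<open>(G, S2)\<close>. So \<open>Q\<close> is the only true
  unknown, and it is constrained by the kernel equation alone.\<close>

lemma assemble_iff:
  assumes A: "A \<in> carrier_mat (n + m) (n + m)"
    and P: "P \<in> carrier_mat n m" and A': "A' \<in> carrier_mat m m"
  shows "A = assemble ev n m (Q, P, A') \<longleftrightarrow>
    char_matrix A ev * graph_mat n m Q = 0\<^sub>m (n + m) n \<and>
    P = (sel1 n m)\<^sup>T * (A * sel2 n m) \<and> A' = cograph_mat n m Q * (A * sel2 n m)"
    (is "_ = ?B \<longleftrightarrow> _")
proof
  assume eq: "A = assemble ev n m (Q, P, A')"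
  note fb = eq[unfolded assemble_eq[OF P A']]
  note blocks = four_block_eq_sel[of "ev \<cdot>\<^sub>m 1\<^sub>m n - P * Q" n P m "ev \<cdot>\<^sub>m Q - (Q * P + A') * Q"
      "Q * P + A'", folded fb]
  have b: "(sel1 n m)\<^sup>T * (A * sel1 n m) = ev \<cdot>\<^sub>m 1\<^sub>m n - P * Q"
    "(sel1 n m)\<^sup>T * (A * sel2 n m) = P"
    "(sel2 n m)\<^sup>T * (A * sel1 n m) = ev \<cdot>\<^sub>m Q - (Q * P + A') * Q"
    "(sel2 n m)\<^sup>T * (A * sel2 n m) = Q * P + A'"
    using Q P A' by (auto intro!: blocks)
  have "(sel1 n m)\<^sup>T * (A * (sel2 n m * Q)) = (sel1 n m)\<^sup>T * (A * sel2 n m) * Q"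
    "(sel2 n m)\<^sup>T * (A * (sel2 n m * Q)) = (sel2 n m)\<^sup>T * (A * sel2 n m) * Q"
    using A Q by (auto simp: mult_assoc_dim)
  then have b': "(sel1 n m)\<^sup>T * (A * (sel2 n m * Q)) = P * Q"
    "(sel2 n m)\<^sup>T * (A * (sel2 n m * Q)) = (Q * P + A') * Q"
    unfolding b .
  have "char_matrix A ev * graph_mat n m Q =
      A * sel1 n m + A * (sel2 n m * Q) - ev \<cdot>\<^sub>m graph_mat n m Q"
    using A Q by (auto simp: char_matrix_def graph_mat_def mat_distribs algebra_simps intro!: eq_matI
        simp del: index_mult_mat(1))
  also have "\<dots> = 0\<^sub>m (n + m) n"
  proof (rule eq_mat_blocksI)
    have "(sel1 n m)\<^sup>T * (A * sel1 n m + A * (sel2 n m * Q) - ev \<cdot>\<^sub>m graph_mat n m Q) = 0\<^sub>m n n"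
      using A Q P graph_mat_relations(3)
      by (auto simp: mat_distribs b b' intro!: eq_matI simp del: index_mult_mat(1))
    then show "(sel1 n m)\<^sup>T * (A * sel1 n m + A * (sel2 n m * Q) - ev \<cdot>\<^sub>m graph_mat n m Q) =
      (sel1 n m)\<^sup>T * 0\<^sub>m (n + m) n" by simp
    have "(sel2 n m)\<^sup>T * graph_mat n m Q = Q"
      using Q sel_orthonormal by (auto simp: graph_mat_def mat_distribs sel_cancel)
    then have "(sel2 n m)\<^sup>T * (A * sel1 n m + A * (sel2 n m * Q) - ev \<cdot>\<^sub>m graph_mat n m Q) = 0\<^sub>m m n"
      using A Q P A'
      by (auto simp: mat_distribs b b' intro!: eq_matI simp del: index_mult_mat(1))
    then show "(sel2 n m)\<^sup>T * (A * sel1 n m + A * (sel2 n m * Q) - ev \<cdot>\<^sub>m graph_mat n m Q) =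
      (sel2 n m)\<^sup>T * 0\<^sub>m (n + m) n" by simp
  qed (use A Q in auto)
  moreover have "cograph_mat n m Q * (A * sel2 n m) = A'"
    using A Q P A' b
    by (auto simp: cograph_mat_def mat_distribs mult_assoc_dim intro!: eq_matI simp del: index_mult_mat(1))
  ultimately show "char_matrix A ev * graph_mat n m Q = 0\<^sub>m (n + m) n \<and>
    P = (sel1 n m)\<^sup>T * (A * sel2 n m) \<and> A' = cograph_mat n m Q * (A * sel2 n m)"
    using b by auto
next
  assume *: "char_matrix A ev * graph_mat n m Q = 0\<^sub>m (n + m) n \<and>
    P = (sel1 n m)\<^sup>T * (A * sel2 n m) \<and> A' = cograph_mat n m Q * (A * sel2 n m)"
  have "A * sel1 n m + A * (sel2 n m * Q) - ev \<cdot>\<^sub>m (sel1 n m + sel2 n m * Q) = 0\<^sub>m (n + m) n"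
    (is "?L = _")
  proof -
    have "?L = char_matrix A ev * graph_mat n m Q"
      using A Q by (auto simp: char_matrix_def graph_mat_def mat_distribs algebra_simps intro!: eq_matI
        simp del: index_mult_mat(1))
    then show ?thesis using * by simp
  qed
  then have "?L $$ (i, j) = 0" if "i < n + m" "j < n" for i j
    using that by simp
  \<comment> \<open>The kernel equation expresses the first \<open>n\<close> columns of
    \<open>A\<close> by the last \<open>m\<close> columns and \<open>Q\<close>.\<close>
  then have AG: "A * sel1 n m = ev \<cdot>\<^sub>m sel1 n m + ev \<cdot>\<^sub>m (sel2 n m * Q) - A * (sel2 n m * Q)"
    using A Q by (intro eq_matI) (auto simp: algebra_simps simp del: index_mult_mat(1))
  have d: "(sel2 n m)\<^sup>T * (A * sel2 n m) = Q * P + A'"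
    using A Q * by (auto simp: cograph_mat_def mat_distribs mult_assoc_dim intro!: eq_matI
        simp del: index_mult_mat(1))
  have PQ: "(sel1 n m)\<^sup>T * (A * (sel2 n m * Q)) = P * Q"
    using A Q * by (auto simp: mult_assoc_dim)
  have dQ: "(sel2 n m)\<^sup>T * (A * (sel2 n m * Q)) = (Q * P + A') * Q"
    unfolding d[symmetric] using A Q by (auto simp: mult_assoc_dim)
  note blocks = four_block_eq_sel[of "ev \<cdot>\<^sub>m 1\<^sub>m n - P * Q" n P m "ev \<cdot>\<^sub>m Q - (Q * P + A') * Q"
      "Q * P + A'", folded assemble_eq[OF P A']]
  have b: "(sel1 n m)\<^sup>T * (?B * sel1 n m) = ev \<cdot>\<^sub>m 1\<^sub>m n - P * Q"
    "(sel1 n m)\<^sup>T * (?B * sel2 n m) = P"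
    "(sel2 n m)\<^sup>T * (?B * sel1 n m) = ev \<cdot>\<^sub>m Q - (Q * P + A') * Q"
    "(sel2 n m)\<^sup>T * (?B * sel2 n m) = Q * P + A'"
    using Q P A' by (auto intro!: blocks)
  show "A = ?B"
  proof (rule eq_mat_four_blocksI[OF A])
    show "?B \<in> carrier_mat (n + m) (n + m)"
      unfolding assemble_eq[OF P A'] using Q P A' by auto
    show "(sel1 n m)\<^sup>T * (A * sel1 n m) = (sel1 n m)\<^sup>T * (?B * sel1 n m)"
      unfolding b AG
      using A Q P sel_orthonormal[of n m]
      by (auto simp: sel_cancel mat_distribs PQ intro!: eq_matI simp del: index_mult_mat(1))
    show "(sel2 n m)\<^sup>T * (A * sel1 n m) = (sel2 n m)\<^sup>T * (?B * sel1 n m)"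
      unfolding b AG
      using A Q P A' sel_orthonormal[of n m]
      by (auto simp: sel_cancel mat_distribs dQ intro!: eq_matI simp del: index_mult_mat(1))
    show "(sel1 n m)\<^sup>T * (A * sel2 n m) = (sel1 n m)\<^sup>T * (?B * sel2 n m)"
      unfolding b using * by simp
    show "(sel2 n m)\<^sup>T * (A * sel2 n m) = (sel2 n m)\<^sup>T * (?B * sel2 n m)"
      unfolding b d ..
  qed
qed

end

section \<open>Transversality of the kernel, and the kernel as a graph\<close>

lemma char_matrix_eq_minus:
  assumes "A \<in> carrier_mat N N"
  shows "A - ev \<cdot>\<^sub>m 1\<^sub>m N = char_matrix A ev"
  using assms by (intro eq_matI) (auto simp: char_matrix_def)

lemma mult_vec_assoc_dim:
  fixes A B :: "'a :: comm_semiring_1 mat"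
  assumes "dim_col A = dim_row B" "dim_col B = dim_vec v"
  shows "A * B *\<^sub>v v = A *\<^sub>v (B *\<^sub>v v)"
  using assms by (intro assoc_mult_mat_vec) (auto intro: carrier_matI carrier_vecI)

lemma mult_zero_vec:
  fixes A :: "'a :: comm_ring_1 mat"
  assumes "dim_col A = k"
  shows "A *\<^sub>v 0\<^sub>v k = 0\<^sub>v (dim_row A)"
  using assms by (intro eq_vecI) (auto simp: scalar_prod_def)

lemma sel_mult_vec_carrier [simp]:
  "y \<in> carrier_vec m \<Longrightarrow> sel2 n m *\<^sub>v y \<in> carrier_vec (n + m)"
  "v \<in> carrier_vec (n + m) \<Longrightarrow> (sel1 n m)\<^sup>T *\<^sub>v v \<in> carrier_vec n"
  "v \<in> carrier_vec (n + m) \<Longrightarrow> (sel2 n m)\<^sup>T *\<^sub>v v \<in> carrier_vec m"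
  using mult_mat_vec_carrier[of "sel2 n m" "n + m" m] mult_mat_vec_carrier[of "(sel1 n m)\<^sup>T" n "n + m"]
    mult_mat_vec_carrier[of "(sel2 n m)\<^sup>T" m "n + m"] by auto

lemma last_coords_iff:
  assumes v: "v \<in> carrier_vec (n + m)"
  shows "v \<in> last_coords (n + m) n \<longleftrightarrow> (sel1 n m)\<^sup>T *\<^sub>v v = 0\<^sub>v n"
proof -
  have "(sel1 n m)\<^sup>T *\<^sub>v v = 0\<^sub>v n \<longleftrightarrow> (\<forall>i<n. v $ i = 0)"
  proof
    assume 0: "(sel1 n m)\<^sup>T *\<^sub>v v = 0\<^sub>v n"
    show "\<forall>i<n. v $ i = 0"
      using index_sel_mult_vec(1)[of v n m] v unfolding 0 by auto
  next
    assume "\<forall>i<n. v $ i = 0"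
    then show "(sel1 n m)\<^sup>T *\<^sub>v v = 0\<^sub>v n"
      using index_sel_mult_vec(1)[of v n m] v by (intro eq_vecI) auto
  qed
  then show ?thesis using v by (simp add: last_coords_def)
qed

text \<open>The last coordinates are the image of the injective matrix \<open>sel2\<close>, so the
  intersection is the image of the kernel of \<open>M * sel2 n m\<close>. Transversality thereby
  becomes injectivity of one matrix, which a left inverse can witness.\<close>

lemma kernel_transverse_iff:
  assumes M: "M \<in> carrier_mat (n + m) (n + m)"
  shows "mat_kernel M \<inter> last_coords (n + m) n = {0\<^sub>v (n + m)} \<longleftrightarrow>
    mat_kernel (M * sel2 n m) = {0\<^sub>v m}"
proof -
  have MS: "M * sel2 n m \<in> carrier_mat (n + m) m" using M by auto
  have 0: "0\<^sub>v (n + m) \<in> mat_kernel M \<inter> last_coords (n + m) n" "0\<^sub>v m \<in> mat_kernel (M * sel2 n m)"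
    using M by (auto simp: mat_kernel[OF M] mat_kernel[OF MS] last_coords_def mult_zero_vec)
  have up: "sel2 n m *\<^sub>v y \<in> mat_kernel M \<inter> last_coords (n + m) n"
    if "y \<in> mat_kernel (M * sel2 n m)" for y
  proof -
    have y: "y \<in> carrier_vec m" "M *\<^sub>v (sel2 n m *\<^sub>v y) = 0\<^sub>v (n + m)"
      using mat_kernelD[OF MS that] M by (auto simp: mult_vec_assoc_dim)
    have "(sel1 n m)\<^sup>T *\<^sub>v (sel2 n m *\<^sub>v y) = 0\<^sub>v n"
      using y mult_vec_assoc_dim[of "(sel1 n m)\<^sup>T" "sel2 n m" y, symmetric]
      by (simp add: sel_orthonormal zero_mat_mult_vec)
    then have "sel2 n m *\<^sub>v y \<in> last_coords (n + m) n"
      using last_coords_iff[OF sel_mult_vec_carrier(1)[OF y(1)]] by simp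
    then show ?thesis
      using y by (simp add: mat_kernel[OF M])
  qed
  have down: "\<exists>y. v = sel2 n m *\<^sub>v y \<and> y \<in> mat_kernel (M * sel2 n m)"
    if "v \<in> mat_kernel M \<inter> last_coords (n + m) n" for v
  proof -
    have v: "v \<in> carrier_vec (n + m)" "M *\<^sub>v v = 0\<^sub>v (n + m)" "(sel1 n m)\<^sup>T *\<^sub>v v = 0\<^sub>v n"
      using that last_coords_iff[of v n m] by (auto simp: mat_kernel[OF M])
    have "v = (sel1 n m * (sel1 n m)\<^sup>T + sel2 n m * (sel2 n m)\<^sup>T) *\<^sub>v v"
      using v by (simp add: sel_complete)
    also have "\<dots> = sel1 n m *\<^sub>v ((sel1 n m)\<^sup>T *\<^sub>v v) + sel2 n m *\<^sub>v ((sel2 n m)\<^sup>T *\<^sub>v v)"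
      using v by (subst add_mult_distrib_mat_vec[of _ "n + m" "n + m"]) (auto simp: mult_vec_assoc_dim)
    also have "\<dots> = sel2 n m *\<^sub>v ((sel2 n m)\<^sup>T *\<^sub>v v)"
      using v left_zero_vec[OF sel_mult_vec_carrier(1), of "(sel2 n m)\<^sup>T *\<^sub>v v" m n]
      by (simp add: mult_zero_vec)
    finally have eq: "v = sel2 n m *\<^sub>v ((sel2 n m)\<^sup>T *\<^sub>v v)" .
    have "(sel2 n m)\<^sup>T *\<^sub>v v \<in> mat_kernel (M * sel2 n m)"
      using v M eq[symmetric] by (simp add: mat_kernel[OF MS] mult_vec_assoc_dim)
    with eq show ?thesis by blast
  qed
  have inj: "y = 0\<^sub>v m" if "sel2 n m *\<^sub>v y = 0\<^sub>v (n + m)" "y \<in> carrier_vec m" for y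
  proof -
    have "y = (sel2 n m)\<^sup>T *\<^sub>v (sel2 n m *\<^sub>v y)"
      using that(2) mult_vec_assoc_dim[of "(sel2 n m)\<^sup>T" "sel2 n m" y, symmetric]
      by (simp add: sel_orthonormal)
    then show ?thesis using that by (simp add: mult_zero_vec)
  qed
  show ?thesis
  proof
    assume "mat_kernel M \<inter> last_coords (n + m) n = {0\<^sub>v (n + m)}"
    then have "y = 0\<^sub>v m" if "y \<in> mat_kernel (M * sel2 n m)" for y
      using up[OF that] inj mat_kernelD(1)[OF MS that] by auto
    then show "mat_kernel (M * sel2 n m) = {0\<^sub>v m}" using 0 by blast
  next
    assume eq: "mat_kernel (M * sel2 n m) = {0\<^sub>v m}"
    have "v = 0\<^sub>v (n + m)" if "v \<in> mat_kernel M \<inter> last_coords (n + m) n" for v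
      using down[OF that] unfolding eq by (auto simp: mult_zero_vec)
    then show "mat_kernel M \<inter> last_coords (n + m) n = {0\<^sub>v (n + m)}" using 0 by blast
  qed
qed

text \<open>Multiply \<open>M S1 + M S2 Q = 0\<close> by \<open>L\<close> and solve for
  \<open>Q\<close>. Only invertibility of \<open>L * (M * sel2 n m)\<close> is asked for, so that an
  \<open>L\<close> chosen at one matrix serves for all \<open>M\<close> in a neighbourhood.\<close>

lemma graph_mat_formula:
  assumes M: "M \<in> carrier_mat (n + m) (n + m)" and Q: "Q \<in> carrier_mat m n"
    and L: "L \<in> carrier_mat m (n + m)" and det: "det (L * (M * sel2 n m)) \<noteq> 0"
    and 0: "M * graph_mat n m Q = 0\<^sub>m (n + m) n"
  shows "Q = - (mat_inv (L * (M * sel2 n m)) * (L * (M * sel1 n m)))"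
proof -
  let ?X = "L * (M * sel2 n m)"
  have X: "?X \<in> carrier_mat m m" using L M by auto
  note inv = mat_inv[OF X det]
  have "L * (M * sel1 n m) + ?X * Q = L * (M * graph_mat n m Q)"
    using M Q L by (simp add: graph_mat_def mat_distribs mult_assoc_dim)
  also have "\<dots> = 0\<^sub>m m n" using 0 L by simp
  finally have "(L * (M * sel1 n m) + ?X * Q) $$ (i, j) = 0" if "i < m" "j < n" for i j
    using that by simp
  then have "?X * Q = - (L * (M * sel1 n m))"
    using M L Q by (intro eq_matI) (auto simp: add_eq_0_iff simp del: index_mult_mat(1))
  then have "mat_inv ?X * (?X * Q) = mat_inv ?X * - (L * (M * sel1 n m))" by simp
  also have "\<dots> = - (mat_inv ?X * (L * (M * sel1 n m)))"
    using inv L M by (intro uminus_mult_right_mat) auto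
  finally show ?thesis
    using inv Q L M mult_cancel_dim[OF inv(3), of Q] by simp
qed

text \<open>Let the columns of \<open>K\<close> be a basis of the kernel. Transversality makes
  \<open>S1^T K\<close> injective, and it is square because the kernel has dimension
  \<open>n\<close>. Normalizing \<open>K\<close> to \<open>G = K (S1^T K)^-1\<close> makes its upper
  block the identity, and its lower block is \<open>Q\<close>.\<close>

lemma graph_mat_exists:
  assumes M: "M \<in> carrier_mat (n + m) (n + m)" and dim: "kernel_dim M = n"
    and inj: "mat_kernel (M * sel2 n m) = {0\<^sub>v m}"
  obtains Q where "Q \<in> carrier_mat m n" and "M * graph_mat n m Q = 0\<^sub>m (n + m) n"
proof -
  obtain K where K: "K \<in> carrier_mat (n + m) n" and injK: "mat_kernel K = {0\<^sub>v n}"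
    and ker: "mat_kernel M = {K *\<^sub>v v | v. v \<in> carrier_vec n}"
    using kernel_basis_mat[OF M] unfolding dim .
  let ?S1 = "sel1 n m" and ?S2 = "sel2 n m"
  have SK: "?S1\<^sup>T * K \<in> carrier_mat n n" using K by auto
  have trans: "mat_kernel M \<inter> last_coords (n + m) n = {0\<^sub>v (n + m)}"
    using inj kernel_transverse_iff[OF M] by simp
  have "v = 0\<^sub>v n" if "v \<in> mat_kernel (?S1\<^sup>T * K)" for v
  proof -
    have v: "v \<in> carrier_vec n" "?S1\<^sup>T *\<^sub>v (K *\<^sub>v v) = 0\<^sub>v n"
      using mat_kernelD[OF SK that] K by (auto simp: mult_vec_assoc_dim)
    then have "K *\<^sub>v v \<in> mat_kernel M \<inter> last_coords (n + m) n"
      using K ker last_coords_iff[of "K *\<^sub>v v" n m] by auto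
    then have "v \<in> mat_kernel K"
      unfolding trans using v K by (auto simp: mat_kernel)
    then show ?thesis using injK by simp
  qed
  then have "mat_kernel (?S1\<^sup>T * K) = {0\<^sub>v n}"
    using SK by (auto simp: mat_kernel mult_zero_vec)
  then have det: "det (?S1\<^sup>T * K) \<noteq> 0" using det_nonzero_iff_kernel[OF SK] by simp
  note inv = mat_inv[OF SK det]
  define G where "G = K * mat_inv (?S1\<^sup>T * K)"
  have G: "G \<in> carrier_mat (n + m) n" using K inv by (auto simp: G_def)
  have SG: "?S1\<^sup>T * G = 1\<^sub>m n"
    using inv K mult_assoc_dim[of "?S1\<^sup>T" K "mat_inv (?S1\<^sup>T * K)"] by (simp add: G_def)
  have MK: "M * K = 0\<^sub>m (n + m) n"
  proof (rule eq_matI)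
    fix i j assume *: "i < dim_row (0\<^sub>m (n + m) n :: complex mat)" "j < dim_col (0\<^sub>m (n + m) n :: complex mat)"
    have "K *\<^sub>v unit_vec n j \<in> mat_kernel M" using ker * by auto
    then have "M *\<^sub>v (K *\<^sub>v unit_vec n j) = 0\<^sub>v (n + m)" using mat_kernelD(2)[OF M] by blast
    moreover have "K *\<^sub>v unit_vec n j = col K j"
      using K * by (intro eq_vecI) auto
    ultimately have "(M *\<^sub>v col K j) $ i = 0" using * by simp
    then show "(M * K) $$ (i, j) = 0\<^sub>m (n + m) n $$ (i, j)"
      using * M K by simp
  qed (use M K in auto)
  show thesis
  proof (rule that)
    show Q: "?S2\<^sup>T * G \<in> carrier_mat m n" using G by auto
    have "G = (?S1 * ?S1\<^sup>T + ?S2 * ?S2\<^sup>T) * G" using G by (simp add: sel_complete)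
    also have "\<dots> = graph_mat n m (?S2\<^sup>T * G)"
      using G SG by (simp add: mat_distribs mult_assoc_dim graph_mat_def)
    finally have "M * graph_mat n m (?S2\<^sup>T * G) = M * G" by simp
    also have "\<dots> = 0\<^sub>m (n + m) n"
      using mult_zero_cancel_dim[OF MK] M K inv by (simp add: G_def)
    finally show "M * graph_mat n m (?S2\<^sup>T * G) = 0\<^sub>m (n + m) n" .
  qed
qed

lemma char_matrix_blocks:
  assumes A: "A \<in> carrier_mat (n + m) (n + m)" and Q: "Q \<in> carrier_mat m n"
  shows "(sel1 n m)\<^sup>T * (char_matrix A ev * sel2 n m) = (sel1 n m)\<^sup>T * (A * sel2 n m)"
    and "cograph_mat n m Q * (char_matrix A ev * sel2 n m) =
      char_matrix (cograph_mat n m Q * (A * sel2 n m)) ev"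
  using A Q sel_orthonormal[of n m] graph_mat_relations[OF Q] graph_mat_carrier[OF Q]
  by (auto simp: char_matrix_def mat_distribs intro!: eq_matI simp del: index_mult_mat(1))

text \<open>The rows of \<open>S1^T\<close> and \<open>cograph_mat\<close> together form an
  invertible matrix, so the kernel of \<open>(A - ev) S2\<close> is the joint kernel of its two
  products with them, which are \<open>P\<close> and \<open>A' - ev\<close>. Thus transversality of
  \<open>A\<close> becomes a condition on \<open>P\<close> and \<open>A'\<close>.\<close>

lemma kernel_char_matrix_sel2:
  assumes A: "A \<in> carrier_mat (n + m) (n + m)" and Q: "Q \<in> carrier_mat m n"
  shows "mat_kernel (char_matrix A ev * sel2 n m) =
    mat_kernel ((sel1 n m)\<^sup>T * (A * sel2 n m)) \<inter>
    mat_kernel (char_matrix (cograph_mat n m Q * (A * sel2 n m)) ev)"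
proof -
  note gr = graph_mat_carrier[OF Q]
  let ?C = "char_matrix A ev * sel2 n m"
  have C: "?C \<in> carrier_mat (n + m) m"
    by (rule mult_carrier_mat[OF char_matrix_closed[OF A] sel_carrier(2)])
  have RC: "cograph_mat n m Q * ?C \<in> carrier_mat m m" and SC: "(sel1 n m)\<^sup>T * ?C \<in> carrier_mat n m"
    using C gr by auto
  have "v \<in> mat_kernel ?C" if "v \<in> mat_kernel ((sel1 n m)\<^sup>T * ?C)" "v \<in> mat_kernel (cograph_mat n m Q * ?C)" for v
  proof -
    have v: "v \<in> carrier_vec m" "(sel1 n m)\<^sup>T * ?C *\<^sub>v v = 0\<^sub>v n" "cograph_mat n m Q * ?C *\<^sub>v v = 0\<^sub>v m"
      using mat_kernelD[OF SC that(1)] mat_kernelD[OF RC that(2)] by auto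
    have "?C *\<^sub>v v = (graph_mat n m Q * ((sel1 n m)\<^sup>T * ?C) + sel2 n m * (cograph_mat n m Q * ?C)) *\<^sub>v v"
      using graph_mat_decompose[OF Q C] by simp
    also have "\<dots> = graph_mat n m Q *\<^sub>v ((sel1 n m)\<^sup>T * ?C *\<^sub>v v) + sel2 n m *\<^sub>v (cograph_mat n m Q * ?C *\<^sub>v v)"
      using v(1) C gr A
      by (subst add_mult_distrib_mat_vec[of _ "n + m" m])
        (auto simp: mult_vec_assoc_dim[of "graph_mat n m Q"] mult_vec_assoc_dim[of "sel2 n m"])
    also have "\<dots> = 0\<^sub>v (n + m)"
      unfolding v using gr by (simp add: mult_zero_vec)
    finally show ?thesis using v C by (auto simp: mat_kernel)
  qed
  then show ?thesis
    using mat_kernel_mult_subset[OF C, of "(sel1 n m)\<^sup>T" n] mat_kernel_mult_subset[OF C gr(2)]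
    unfolding char_matrix_blocks[OF A Q, where ev = ev, symmetric] by auto
qed

text \<open>\<open>P\<close> computes the coordinates with respect to a basis \<open>K\<close> of
  the kernel of \<open>D\<close>, by a left inverse \<open>L\<close> of \<open>K\<close>, and is
  padded by zero rows. The bound on \<open>kernel_dim D\<close> makes room for all rows of
  \<open>L\<close>.\<close>

lemma injective_extension_exists:
  assumes D: "D \<in> carrier_mat m m" and "kernel_dim D \<le> n"
  obtains P :: "complex mat" where "P \<in> carrier_mat n m" and "mat_kernel P \<inter> mat_kernel D = {0\<^sub>v m}"
proof -
  let ?d = "kernel_dim D"
  obtain K where K: "K \<in> carrier_mat m ?d" and injK: "mat_kernel K = {0\<^sub>v ?d}"
    and ker: "mat_kernel D = {K *\<^sub>v v | v. v \<in> carrier_vec ?d}"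
    using kernel_basis_mat[OF D] .
  obtain L where L: "L \<in> carrier_mat ?d m" and LK: "L * K = 1\<^sub>m ?d"
    using left_inverse_of_injective[OF K injK] .
  define P where "P = mat n m (\<lambda>(i, j). if i < ?d then L $$ (i, j) else 0)"
  have P: "P \<in> carrier_mat n m" by (simp add: P_def)
  have "v = 0\<^sub>v m" if vP: "v \<in> mat_kernel P" and vD: "v \<in> mat_kernel D" for v
  proof -
    obtain w where w: "v = K *\<^sub>v w" "w \<in> carrier_vec ?d" using vD ker by auto
    have v: "v \<in> carrier_vec m" "P *\<^sub>v v = 0\<^sub>v n" using mat_kernelD[OF P vP] by auto
    have "w = L *\<^sub>v v"
      using w K L LK by (simp add: assoc_mult_mat_vec[of L ?d m K ?d w, symmetric])
    also have "\<dots> = 0\<^sub>v ?d"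
    proof (rule eq_vecI)
      fix i assume "i < dim_vec (0\<^sub>v ?d :: complex vec)"
      then have i: "i < ?d" by simp
      then have "row P i = row L i" using L assms(2) by (intro eq_vecI) (auto simp: P_def)
      then have "(L *\<^sub>v v) $ i = (P *\<^sub>v v) $ i" using i L P assms(2) by simp
      then show "(L *\<^sub>v v) $ i = 0\<^sub>v ?d $ i" using i v assms(2) by simp
    qed (use L in simp)
    finally show ?thesis using w K by (simp add: mult_zero_vec)
  qed
  moreover have "0\<^sub>v m \<in> mat_kernel P \<inter> mat_kernel D"
    using P D by (auto simp: mat_kernel mult_zero_vec)
  ultimately show thesis using that[OF P] by blast
qed

text \<open>Chain by chain \<open>min 2 l \<le> 2 * min 1 l\<close>. This bounds the number of
  chains that survive the shortening.\<close>

lemma dim_gen_eigenspace_jordan_matrix_2_le: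
  "dim_gen_eigenspace (jordan_matrix as) \<mu> 2 \<le> 2 * dim_gen_eigenspace (jordan_matrix as) \<mu> 1"
  unfolding dim_gen_eigenspace_jordan_matrix by (induction as) auto

section \<open>Block coordinates on the transverse part of the orbit\<close>

locale block_setting =
  fixes bs :: "(nat \<times> complex) list" and ev :: complex and n m :: nat
  assumes bs_nonzero: "0 \<notin> fst ` set bs"
    and size: "sum_list (map fst bs) = n + m"
    and kernel: "dim_gen_eigenspace (jordan_matrix bs) ev 1 = n"
begin

abbreviation "J \<equiv> jordan_matrix bs"
abbreviation "bs' \<equiv> shorten_chains ev bs"
abbreviation "S1 \<equiv> sel1 n m"
abbreviation "S2 \<equiv> sel2 n m"
abbreviation "transverse \<equiv> transverse_orbit J ev n"
abbreviation "reduced \<equiv> jordan_class m bs'"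

definition admissible :: "(complex mat \<times> complex mat \<times> complex mat) set" where
  "admissible = {(Q, P, A'). Q \<in> carrier_mat m n \<and> P \<in> carrier_mat n m \<and> A' \<in> reduced \<and>
     mat_kernel P \<inter> mat_kernel (char_matrix A' ev) = {0\<^sub>v m}}"

lemma J_carrier: "J \<in> carrier_mat (n + m) (n + m)"
  using jordan_matrix_carrier[of bs] by (simp add: size)

lemma reduced_carrier: "A' \<in> reduced \<Longrightarrow> A' \<in> carrier_mat m m"
  by (simp add: jordan_class_def)

lemma reduced_size: "sum_list (map fst bs') = m"
  using dim_gen_eigenspace_shorten_chains(3)[OF bs_nonzero, of ev] unfolding kernel size by simp

lemma reduced_eq_sim_orbit: "reduced = sim_orbit (jordan_matrix bs')"
  using sim_orbit_carrier[OF jordan_matrix_carrier[of bs']] shorten_chains_nonzero[OF bs_nonzero]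
  by (auto simp: jordan_class_def jordan_nf_def sim_orbit_def reduced_size)

lemma transverse_iff:
  "A \<in> transverse \<longleftrightarrow> A \<in> sim_orbit J \<and> mat_kernel (char_matrix A ev * S2) = {0\<^sub>v m}"
  using kernel_transverse_iff[of "char_matrix A ev" n m] sim_orbit_carrier[OF J_carrier, of A]
    char_matrix_eq_minus[of A "n + m" ev]
  by (auto simp: transverse_orbit_def size)

lemma transverse_carrier: "A \<in> transverse \<Longrightarrow> A \<in> carrier_mat (n + m) (n + m)"
  using sim_orbit_carrier[OF J_carrier, of A] by (auto simp: transverse_iff)

lemma assemble_sim_orbit_iff:
  assumes Q: "Q \<in> carrier_mat m n" and P: "P \<in> carrier_mat n m" and A': "A' \<in> carrier_mat m m"
    and inj: "mat_kernel P \<inter> mat_kernel (char_matrix A' ev) = {0\<^sub>v m}"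
  shows "assemble ev n m (Q, P, A') \<in> sim_orbit J \<longleftrightarrow> A' \<in> reduced"
proof -
  have "assemble ev n m (Q, P, A') \<in> sim_orbit J \<longleftrightarrow>
      four_block_mat (ev \<cdot>\<^sub>m 1\<^sub>m n) P (0\<^sub>m m n) A' \<in> sim_orbit J"
    using assemble_similar[OF Q P A', of ev]
    by (auto simp: sim_orbit_def intro: similar_mat_trans similar_mat_sym)
  also have "\<dots> \<longleftrightarrow> A' \<in> reduced"
    using inj by (intro block_sim_orbit_iff[OF bs_nonzero P A' _ kernel]) auto
  finally show ?thesis .
qed

lemma assemble_admissible:
  assumes "c \<in> admissible"
  shows "assemble ev n m c \<in> transverse" and "is_block_form ev n m bs (assemble ev n m c) c"
proof -
  obtain Q P A' where c: "c = (Q, P, A')" by (cases c)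
  have Q: "Q \<in> carrier_mat m n" and P: "P \<in> carrier_mat n m" and A': "A' \<in> reduced"
    and inj: "mat_kernel P \<inter> mat_kernel (char_matrix A' ev) = {0\<^sub>v m}"
    using assms by (auto simp: c admissible_def)
  note A'c = reduced_carrier[OF A']
  have orbit: "assemble ev n m c \<in> sim_orbit J"
    using assemble_sim_orbit_iff[OF Q P A'c inj] A' by (simp add: c)
  note carrier = sim_orbit_carrier[OF J_carrier orbit]
  show "assemble ev n m c \<in> transverse"
    unfolding transverse_iff kernel_char_matrix_sel2[OF carrier Q]
    using orbit inj assemble_iff[OF Q carrier P A'c, of ev] by (simp add: c)
  show "is_block_form ev n m bs (assemble ev n m c) c"
    using Q P A' by (simp add: is_block_form_def c)
qed

lemma block_form_exists:
  assumes "A \<in> transverse"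
  obtains c where "c \<in> admissible" and "A = assemble ev n m c"
proof -
  have orbit: "A \<in> sim_orbit J" and inj: "mat_kernel (char_matrix A ev * S2) = {0\<^sub>v m}"
    using assms by (auto simp: transverse_iff)
  note A = sim_orbit_carrier[OF J_carrier orbit]
  have "dim_gen_eigenspace A ev 1 = n"
    using dim_gen_eigenspace_similar[of A J] orbit kernel by (simp add: sim_orbit_def)
  then have "kernel_dim (char_matrix A ev) = n"
    using A by (simp add: dim_gen_eigenspace_def)
  then obtain Q where Q: "Q \<in> carrier_mat m n"
    and 0: "char_matrix A ev * graph_mat n m Q = 0\<^sub>m (n + m) n"
    using graph_mat_exists[OF _ _ inj] A by (metis char_matrix_closed)
  define P where "P = S1\<^sup>T * (A * S2)"
  define A' where "A' = cograph_mat n m Q * (A * S2)"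
  have P: "P \<in> carrier_mat n m" and A': "A' \<in> carrier_mat m m"
    using A graph_mat_carrier[OF Q] by (auto simp: P_def A'_def)
  have eq: "A = assemble ev n m (Q, P, A')"
    unfolding assemble_iff[OF Q A P A'] using 0 by (simp add: P_def A'_def)
  have inj': "mat_kernel P \<inter> mat_kernel (char_matrix A' ev) = {0\<^sub>v m}"
    using inj unfolding kernel_char_matrix_sel2[OF A Q] by (simp add: P_def A'_def)
  have "A' \<in> reduced"
    using assemble_sim_orbit_iff[OF Q P A' inj'] orbit eq by simp
  then show thesis
    using Q P inj' eq by (intro that[of "(Q, P, A')"]) (auto simp: admissible_def)
qed

text \<open>With a left inverse \<open>L\<close> of \<open>(A - ev) S2\<close>, the explicit formula
  gives the same \<open>Q\<close> for both triples; the other two blocks are functions of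
  \<open>A\<close> and \<open>Q\<close>.\<close>

lemma is_block_form_unique:
  assumes A: "A \<in> transverse" and "is_block_form ev n m bs A c" "is_block_form ev n m bs A d"
  shows "c = d"
proof -
  obtain Q P A' Q1 P1 A1 where c: "c = (Q, P, A')" and d: "d = (Q1, P1, A1)" by (cases c, cases d)
  note Ac = transverse_carrier[OF A]
  have carr: "Q \<in> carrier_mat m n" "Q1 \<in> carrier_mat m n" "P \<in> carrier_mat n m" "P1 \<in> carrier_mat n m"
    "A' \<in> carrier_mat m m" "A1 \<in> carrier_mat m m"
    using assms by (auto simp: is_block_form_def c d reduced_carrier)
  have "A = assemble ev n m (Q, P, A')" "A = assemble ev n m (Q1, P1, A1)"
    using assms(2,3) by (auto simp: is_block_form_def c d)
  note eqs = this(1)[unfolded assemble_iff[OF carr(1) Ac carr(3,5)]]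
    this(2)[unfolded assemble_iff[OF carr(2) Ac carr(4,6)]]
  have C: "char_matrix A ev * S2 \<in> carrier_mat (n + m) m"
    by (rule mult_carrier_mat[OF char_matrix_closed[OF Ac] sel_carrier(2)])
  obtain L where L: "L \<in> carrier_mat m (n + m)" "L * (char_matrix A ev * S2) = 1\<^sub>m m"
    using left_inverse_of_injective[OF C] A by (auto simp: transverse_iff)
  have M: "char_matrix A ev \<in> carrier_mat (n + m) (n + m)" using Ac by simp
  have "Q = Q1"
    using graph_mat_formula[OF M carr(1) L(1)] graph_mat_formula[OF M carr(2) L(1)] L(2) eqs by simp
  then show ?thesis using eqs by (simp add: c d)
qed

lemma block_form_ex1:
  assumes "A \<in> transverse"
  shows "\<exists>!c. is_block_form ev n m bs A c"
  using block_form_exists[OF assms] assemble_admissible(2) is_block_form_unique[OF assms] by metis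

lemma block_coords_assemble:
  assumes "c \<in> admissible"
  shows "block_coords ev n m bs (assemble ev n m c) = c"
  unfolding block_coords_def
  using assemble_admissible[OF assms] is_block_form_unique by (intro the_equality) auto

lemma block_coords_transverse:
  assumes "A \<in> transverse"
  shows "block_coords ev n m bs A \<in> admissible" and "assemble ev n m (block_coords ev n m bs A) = A"
  using block_form_exists[OF assms] block_coords_assemble by metis+

lemma block_coords_image: "block_coords ev n m bs ` transverse = admissible"
proof
  show "admissible \<subseteq> block_coords ev n m bs ` transverse"
  proof
    fix c assume c: "c \<in> admissible"
    show "c \<in> block_coords ev n m bs ` transverse"
      using assemble_admissible(1)[OF c] block_coords_assemble[OF c] by (intro image_eqI[of c]) auto
  qed
qed (use block_coords_transverse in auto)

text \<open>The chains of \<open>A'\<close> for \<open>ev\<close> come from chains of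
  \<open>J\<close> of length at least two, so there are at most \<open>n\<close> of them. In terms
  of dimensions: at exponent two \<open>J\<close> has \<open>n\<close> plus the kernel dimension of
  \<open>A' - ev\<close>, and at most \<open>2 * n\<close>.\<close>

lemma fibre_nonempty:
  assumes A': "A' \<in> reduced"
  obtains P where "P \<in> carrier_mat n m" and "mat_kernel P \<inter> mat_kernel (char_matrix A' ev) = {0\<^sub>v m}"
proof -
  have A'c: "A' \<in> carrier_mat m m" using A' by (rule reduced_carrier)
  have "dim_gen_eigenspace A' ev 1 = dim_gen_eigenspace (jordan_matrix bs') ev 1"
    using A' dim_gen_eigenspace_similar[of A' "jordan_matrix bs'"]
    by (simp add: reduced_eq_sim_orbit sim_orbit_def)
  also have "\<dots> \<le> n"
    using dim_gen_eigenspace_shorten_chains(1)[OF bs_nonzero, where ev = ev and k = 1]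
      dim_gen_eigenspace_jordan_matrix_2_le[of bs ev]
    unfolding kernel by (simp add: numeral_2_eq_2)
  finally have "kernel_dim (char_matrix A' ev) \<le> n"
    using A'c by (simp add: dim_gen_eigenspace_def)
  then show thesis
    using injective_extension_exists[of "char_matrix A' ev" m n] A'c that by auto
qed

text \<open>Since no fibre over a pair \<open>(Q, A')\<close> is empty, enlarging all fibres gives a
  full product.\<close>

lemma enlarged_orbit_eq:
  "enlarged_orbit ev n m bs = {(Q, P, A'). Q \<in> carrier_mat m n \<and> P \<in> carrier_mat n m \<and> A' \<in> reduced}"
proof -
  have "(\<exists>P\<^sub>0. (Q, P\<^sub>0, A') \<in> admissible) \<longleftrightarrow> Q \<in> carrier_mat m n \<and> A' \<in> reduced" for Q A'
    using fibre_nonempty[of A'] by (auto simp: admissible_def)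
  then show ?thesis
    unfolding enlarged_orbit_def block_coords_image by auto
qed

lemma reduced_nonempty: "jordan_matrix bs' \<in> reduced"
  unfolding reduced_eq_sim_orbit sim_orbit_def by (auto intro: similar_mat_refl[OF jordan_matrix_carrier])

lemma transverse_nonempty: "transverse \<noteq> {}"
proof -
  obtain P where "P \<in> carrier_mat n m"
    "mat_kernel P \<inter> mat_kernel (char_matrix (jordan_matrix bs') ev) = {0\<^sub>v m}"
    using fibre_nonempty[OF reduced_nonempty] .
  then have "(0\<^sub>m m n, P, jordan_matrix bs') \<in> admissible"
    using reduced_nonempty by (simp add: admissible_def)
  then show ?thesis using assemble_admissible(1) by blast
qed

end

section \<open>Zariski topology and rings of functions\<close>

lemma topspace_zariski [simp]: "topspace (zariski C X) = X"
proof -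
  have "{x. (1 :: complex) \<noteq> 0} \<in> {{x. f x \<noteq> 0} | f. f \<in> poly_funs C}"
    by (intro CollectI exI[of _ "\<lambda>_. 1"] conjI refl poly_funs.const)
  then have "\<Union> {{x. f x \<noteq> 0} | f. f \<in> poly_funs C} = UNIV" by auto
  then show ?thesis
    by (simp add: zariski_def topspace_subtopology topology_generated_by_topspace)
qed

lemma openin_zariski_basic:
  assumes "f \<in> poly_funs C"
  shows "openin (zariski C X) {y \<in> X. f y \<noteq> 0}"
  unfolding zariski_def openin_subtopology
  using topology_generated_by_Basis[of "{x. f x \<noteq> 0}" "{{x. f x \<noteq> 0} | f. f \<in> poly_funs C}"] assms
  by (intro exI[of _ "{x. f x \<noteq> 0}"]) auto

text \<open>The generating sets already form a base: the intersection of \<open>f \<noteq> 0\<close>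
  and \<open>g \<noteq> 0\<close> is the set where the product does not vanish.\<close>

lemma openin_zariski_iff:
  "openin (zariski C X) U \<longleftrightarrow>
    U \<subseteq> X \<and> (\<forall>x\<in>U. \<exists>f\<in>poly_funs C. f x \<noteq> 0 \<and> {y \<in> X. f y \<noteq> 0} \<subseteq> U)"
proof
  assume "openin (zariski C X) U"
  then obtain T where T: "generate_topology_on {{x. f x \<noteq> 0} | f. f \<in> poly_funs C} T" "U = T \<inter> X"
    unfolding zariski_def openin_subtopology openin_topology_generated_by_iff by auto
  have "\<exists>f\<in>poly_funs C. f x \<noteq> 0 \<and> {y. f y \<noteq> 0} \<subseteq> T" if "x \<in> T" for x
    using T(1) that
  proof (induction T arbitrary: x)
    case (Int a b)
    then obtain f g where "f \<in> poly_funs C" "f x \<noteq> 0" "{y. f y \<noteq> 0} \<subseteq> a"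
      "g \<in> poly_funs C" "g x \<noteq> 0" "{y. g y \<noteq> 0} \<subseteq> b" by (meson IntD1 IntD2)
    then show ?case
      by (intro bexI[of _ "\<lambda>x. f x * g x"] poly_funs.mult) auto
  next
    case (UN K)
    then obtain k where "k \<in> K" "x \<in> k" by blast
    then show ?case using UN.IH by blast
  qed auto
  then show "U \<subseteq> X \<and> (\<forall>x\<in>U. \<exists>f\<in>poly_funs C. f x \<noteq> 0 \<and> {y \<in> X. f y \<noteq> 0} \<subseteq> U)"
    using T(2) by blast
next
  assume *: "U \<subseteq> X \<and> (\<forall>x\<in>U. \<exists>f\<in>poly_funs C. f x \<noteq> 0 \<and> {y \<in> X. f y \<noteq> 0} \<subseteq> U)"
  show "openin (zariski C X) U"
  proof (subst openin_subopen, intro ballI)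
    fix x assume x: "x \<in> U"
    then obtain f where "f \<in> poly_funs C" "f x \<noteq> 0" "{y \<in> X. f y \<noteq> 0} \<subseteq> U" using * by blast
    then show "\<exists>T. openin (zariski C X) T \<and> x \<in> T \<and> T \<subseteq> U"
      using openin_zariski_basic[of f C X] x * by (intro exI[of _ "{y \<in> X. f y \<noteq> 0}"]) auto
  qed
qed

lemma openin_zariski_trans:
  assumes Y: "openin (zariski C X) Y" and U: "openin (zariski C Y) U"
  shows "openin (zariski C X) U"
  unfolding openin_zariski_iff
proof (intro conjI ballI)
  show "U \<subseteq> X" using assms by (auto simp: openin_zariski_iff)
  fix x assume "x \<in> U"
  then obtain g where g: "g \<in> poly_funs C" "g x \<noteq> 0" "{y \<in> Y. g y \<noteq> 0} \<subseteq> U" "x \<in> Y"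
    using U unfolding openin_zariski_iff by blast
  then obtain f where f: "f \<in> poly_funs C" "f x \<noteq> 0" "{y \<in> X. f y \<noteq> 0} \<subseteq> Y"
    using Y unfolding openin_zariski_iff by blast
  show "\<exists>f\<in>poly_funs C. f x \<noteq> 0 \<and> {y \<in> X. f y \<noteq> 0} \<subseteq> U"
    using f g by (intro bexI[of _ "\<lambda>x. f x * g x"] poly_funs.mult) auto
qed

lemma dense_openI:
  assumes "openin (zariski C X) U"
    and "\<And>x f. x \<in> X \<Longrightarrow> f \<in> poly_funs C \<Longrightarrow> f x \<noteq> 0 \<Longrightarrow> \<exists>y\<in>U. f y \<noteq> 0"
  shows "dense_open C X U"
proof -
  have UX: "U \<subseteq> X" using assms(1) by (auto simp: openin_zariski_iff)
  have "x \<in> zariski C X closure_of U" if x: "x \<in> X" for x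
    unfolding in_closure_of
  proof (intro conjI allI impI)
    fix T assume T: "x \<in> T \<and> openin (zariski C X) T"
    then obtain f where "f \<in> poly_funs C" "f x \<noteq> 0" "{y \<in> X. f y \<noteq> 0} \<subseteq> T"
      unfolding openin_zariski_iff by blast
    then show "\<exists>y. y \<in> U \<and> y \<in> T" using assms(2)[OF x] UX by blast
  qed (use x in simp)
  then show ?thesis
    using assms(1) closure_of_subset_topspace[of "zariski C X" U] by (auto simp: dense_open_def)
qed

text \<open>Agreement is asked for on \<open>X\<close> only: off \<open>X\<close> matrices may have
  the wrong size, and matrix entries arbitrary values. This provides the closure under
  \<open>cong\<close> of a \<open>function_ring\<close>.\<close>

definition poly_on :: "('p \<Rightarrow> complex) set \<Rightarrow> 'p set \<Rightarrow> ('p \<Rightarrow> complex) set" where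
  "poly_on C X = {f. \<exists>p\<in>poly_funs C. \<forall>x\<in>X. f x = p x}"

lemma openin_zariski_poly_on:
  assumes "f \<in> poly_on C X"
  shows "openin (zariski C X) {x \<in> X. f x \<noteq> 0}"
proof -
  obtain p where p: "p \<in> poly_funs C" "\<forall>x\<in>X. f x = p x" using assms unfolding poly_on_def by blast
  then have "{x \<in> X. f x \<noteq> 0} = {x \<in> X. p x \<noteq> 0}" by auto
  then show ?thesis using openin_zariski_basic[OF p(1)] by simp
qed

section \<open>Regular functions and biregular maps\<close>

abbreviation "fraction_at C X f x \<equiv> \<exists>U p q. openin (zariski C X) U \<and> x \<in> U \<and>
  p \<in> poly_funs C \<and> q \<in> poly_funs C \<and> (\<forall>y\<in>U. q y \<noteq> 0 \<and> f y = p y / q y)"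

lemma regular_fun_poly_on:
  assumes "f \<in> poly_on C X"
  shows "regular_fun C X f"
proof -
  obtain p where p: "p \<in> poly_funs C" "\<forall>x\<in>X. f x = p x" using assms unfolding poly_on_def by blast
  show ?thesis
    unfolding regular_fun_def
  proof
    fix x assume "x \<in> X"
    moreover have "openin (zariski C X) X" using openin_topspace[of "zariski C X"] by simp
    ultimately show "fraction_at C X f x"
      using p poly_funs.const[of 1 C] by (intro exI[of _ X] exI[of _ p] exI[of _ "\<lambda>_. 1"]) auto
  qed
qed

lemma regular_fun_cong:
  assumes "regular_fun C X f" and "\<And>x. x \<in> X \<Longrightarrow> f x = g x"
  shows "regular_fun C X g"
  unfolding regular_fun_def
proof
  fix x assume "x \<in> X"
  then obtain U p q where U: "openin (zariski C X) U" "x \<in> U" "p \<in> poly_funs C" "q \<in> poly_funs C"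
    "\<forall>y\<in>U. q y \<noteq> 0 \<and> f y = p y / q y"
    using assms(1) unfolding regular_fun_def by metis
  have "U \<subseteq> X" using U(1) by (auto simp: openin_zariski_iff)
  then have "\<forall>y\<in>U. q y \<noteq> 0 \<and> g y = p y / q y" using U(5) assms(2) by (metis subsetD)
  then show "fraction_at C X g x"
    using U by blast
qed

lemma regular_fun_local:
  assumes "\<And>x. x \<in> X \<Longrightarrow> \<exists>Y. openin (zariski C X) Y \<and> x \<in> Y \<and> regular_fun C Y f"
  shows "regular_fun C X f"
  unfolding regular_fun_def
proof
  fix x assume "x \<in> X"
  then obtain Y where Y: "openin (zariski C X) Y" "x \<in> Y" "regular_fun C Y f" using assms by blast
  then obtain U p q where "openin (zariski C Y) U" "x \<in> U" "p \<in> poly_funs C" "q \<in> poly_funs C"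
    "\<forall>y\<in>U. q y \<noteq> 0 \<and> f y = p y / q y"
    unfolding regular_fun_def by metis
  then show "fraction_at C X f x"
    using openin_zariski_trans[OF Y(1)] by metis
qed

text \<open>Treats sum and product at once: \<open>N\<close> is the numerator of the result over the
  common denominator \<open>q x * s x\<close>.\<close>

lemma regular_fun_binop:
  assumes "regular_fun C X f" and "regular_fun C X g"
    and "\<And>p q r s. p \<in> poly_funs C \<Longrightarrow> q \<in> poly_funs C \<Longrightarrow> r \<in> poly_funs C \<Longrightarrow> s \<in> poly_funs C \<Longrightarrow>
      N p q r s \<in> poly_funs C"
    and "\<And>p q r s x. q x \<noteq> 0 \<Longrightarrow> s x \<noteq> 0 \<Longrightarrow>
      op (p x / q x) (r x / s x) = N p q r s x / (q x * s x)"
  shows "regular_fun C X (\<lambda>x. op (f x) (g x))"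
  unfolding regular_fun_def
proof
  fix x assume x: "x \<in> X"
  obtain U p q where U: "openin (zariski C X) U" "x \<in> U" "p \<in> poly_funs C" "q \<in> poly_funs C"
    "\<forall>y\<in>U. q y \<noteq> 0 \<and> f y = p y / q y"
    using assms(1) x unfolding regular_fun_def by metis
  obtain V r s where V: "openin (zariski C X) V" "x \<in> V" "r \<in> poly_funs C" "s \<in> poly_funs C"
    "\<forall>y\<in>V. s y \<noteq> 0 \<and> g y = r y / s y"
    using assms(2) x unfolding regular_fun_def by metis
  show "fraction_at C X (\<lambda>y. op (f y) (g y)) x"
    using U V assms(3)[of p q r s] assms(4)[of q _ s p r] poly_funs.mult[OF U(4) V(4)]
    by (intro exI[of _ "U \<inter> V"] exI[of _ "N p q r s"] exI[of _ "\<lambda>y. q y * s y"])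
      (auto intro: openin_Int)
qed

lemma regular_fun_inverse:
  assumes "regular_fun C X f" and "\<And>x. x \<in> X \<Longrightarrow> f x \<noteq> 0"
  shows "regular_fun C X (\<lambda>x. inverse (f x))"
  unfolding regular_fun_def
proof
  fix x assume "x \<in> X"
  then obtain U p q where U: "openin (zariski C X) U" "x \<in> U" "p \<in> poly_funs C" "q \<in> poly_funs C"
    "\<forall>y\<in>U. q y \<noteq> 0 \<and> f y = p y / q y"
    using assms(1) unfolding regular_fun_def by metis
  moreover have "\<forall>y\<in>U. f y \<noteq> 0"
    using U(1) assms(2) by (auto simp: openin_zariski_iff)
  ultimately show "fraction_at C X (\<lambda>y. inverse (f y)) x"
    by (intro exI[of _ U] exI[of _ q] exI[of _ p]) auto
qed

lemma biregularI:
  assumes "regular_map C X D Y f" and "regular_map D Y C X g"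
    and "\<And>x. x \<in> X \<Longrightarrow> g (f x) = x" and "\<And>y. y \<in> Y \<Longrightarrow> f (g y) = y"
  shows "biregular C X D Y f"
proof -
  have maps: "f ` X \<subseteq> Y" "g ` Y \<subseteq> X" using assms(1,2) by (auto simp: regular_map_def)
  have bij: "bij_betw f X Y"
    using assms(3,4) maps by (intro bij_betw_byWitness[of X g]) auto
  have inv: "g y = inv_into X f y" if "y \<in> Y" for y
    using that assms(4) maps bij by (metis bij_betw_imp_inj_on image_subset_iff inv_into_f_f)
  have "regular_map D Y C X (inv_into X f)"
    unfolding regular_map_def
  proof (intro conjI ballI)
    show "inv_into X f ` Y \<subseteq> X" using inv maps by force
    fix d assume "d \<in> C"
    then have "regular_fun D Y (d \<circ> g)" using assms(2) by (auto simp: regular_map_def)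
    then show "regular_fun D Y (d \<circ> inv_into X f)" by (rule regular_fun_cong) (simp add: inv)
  qed
  then show ?thesis using bij assms(1) by (simp add: biregular_def)
qed

text \<open>A ring \<open>F\<close> of functions on \<open>X\<close>: polynomial functions, regular functions, functions that are
  differentiable at a point and rational functions of one variable are treated uniformly.\<close>

locale function_ring =
  fixes X :: "'p set" and F :: "('p \<Rightarrow> complex) set"
  assumes const: "(\<lambda>_. c) \<in> F"
    and add: "f \<in> F \<Longrightarrow> g \<in> F \<Longrightarrow> (\<lambda>x. f x + g x) \<in> F"
    and mult: "f \<in> F \<Longrightarrow> g \<in> F \<Longrightarrow> (\<lambda>x. f x * g x) \<in> F"
    and cong: "f \<in> F \<Longrightarrow> (\<And>x. x \<in> X \<Longrightarrow> f x = g x) \<Longrightarrow> g \<in> F"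
begin

lemma uminus: "f \<in> F \<Longrightarrow> (\<lambda>x. - f x) \<in> F"
  using mult[OF const[of "-1"]] by simp

lemma diff: "f \<in> F \<Longrightarrow> g \<in> F \<Longrightarrow> (\<lambda>x. f x - g x) \<in> F"
  using add[OF _ uminus] by simp

lemma sum: "(\<And>i. i \<in> I \<Longrightarrow> f i \<in> F) \<Longrightarrow> (\<lambda>x. \<Sum>i\<in>I. f i x) \<in> F"
  by (induction I rule: infinite_finite_induct) (auto intro: const add)

lemma prod: "(\<And>i. i \<in> I \<Longrightarrow> f i \<in> F) \<Longrightarrow> (\<lambda>x. \<Prod>i\<in>I. f i x) \<in> F"
  by (induction I rule: infinite_finite_induct) (auto intro: const mult)

lemma poly_funs_comp:
  assumes "p \<in> poly_funs C" and "\<And>c. c \<in> C \<Longrightarrow> (\<lambda>x. c (\<phi> x)) \<in> F"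
  shows "(\<lambda>x. p (\<phi> x)) \<in> F"
  using assms by induction (auto intro: const add mult)

definition mats :: "nat \<Rightarrow> nat \<Rightarrow> ('p \<Rightarrow> complex mat) set" where
  "mats r c = {G. (\<forall>x\<in>X. G x \<in> carrier_mat r c) \<and> (\<forall>i<r. \<forall>j<c. (\<lambda>x. G x $$ (i, j)) \<in> F)}"

lemma matsI:
  assumes "\<And>x. x \<in> X \<Longrightarrow> G x \<in> carrier_mat r c"
    and "\<And>i j. i < r \<Longrightarrow> j < c \<Longrightarrow> f i j \<in> F"
    and "\<And>i j x. x \<in> X \<Longrightarrow> i < r \<Longrightarrow> j < c \<Longrightarrow> f i j x = G x $$ (i, j)"
  shows "G \<in> mats r c"
  unfolding mats_def using assms(1) cong[OF assms(2,3)] by auto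

lemma mats_carrier: "G \<in> mats r c \<Longrightarrow> x \<in> X \<Longrightarrow> G x \<in> carrier_mat r c"
  by (simp add: mats_def)

lemma mats_dim: "G \<in> mats r c \<Longrightarrow> x \<in> X \<Longrightarrow> dim_row (G x) = r" "G \<in> mats r c \<Longrightarrow> x \<in> X \<Longrightarrow> dim_col (G x) = c"
  by (auto simp: mats_def)

lemma mats_entry: "G \<in> mats r c \<Longrightarrow> i < r \<Longrightarrow> j < c \<Longrightarrow> (\<lambda>x. G x $$ (i, j)) \<in> F"
  by (simp add: mats_def)

lemma mats_const: "A \<in> carrier_mat r c \<Longrightarrow> (\<lambda>_. A) \<in> mats r c"
  by (simp add: mats_def const)

lemma mats_add: "G \<in> mats r c \<Longrightarrow> H \<in> mats r c \<Longrightarrow> (\<lambda>x. G x + H x) \<in> mats r c"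
  by (rule matsI[where f = "\<lambda>i j x. G x $$ (i, j) + H x $$ (i, j)"])
    (auto simp: mats_dim intro!: carrier_matI add mats_entry)

lemma mats_uminus: "G \<in> mats r c \<Longrightarrow> (\<lambda>x. - G x) \<in> mats r c"
  by (rule matsI[where f = "\<lambda>i j x. - G x $$ (i, j)"])
    (auto simp: mats_dim intro!: carrier_matI uminus mats_entry)

lemma mats_minus: "G \<in> mats r c \<Longrightarrow> H \<in> mats r c \<Longrightarrow> (\<lambda>x. G x - H x) \<in> mats r c"
  by (rule matsI[where f = "\<lambda>i j x. G x $$ (i, j) - H x $$ (i, j)"])
    (auto simp: mats_dim intro!: carrier_matI diff mats_entry)

lemma mats_smult: "f \<in> F \<Longrightarrow> G \<in> mats r c \<Longrightarrow> (\<lambda>x. f x \<cdot>\<^sub>m G x) \<in> mats r c"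
  by (rule matsI[where f = "\<lambda>i j x. f x * G x $$ (i, j)"])
    (auto simp: mats_dim intro!: carrier_matI mult mats_entry)

lemma mats_mult: "G \<in> mats r k \<Longrightarrow> H \<in> mats k c \<Longrightarrow> (\<lambda>x. G x * H x) \<in> mats r c"
  by (rule matsI[where f = "\<lambda>i j x. \<Sum>l\<in>{0..<k}. G x $$ (i, l) * H x $$ (l, j)"])
    (auto simp: scalar_prod_def mats_dim intro!: carrier_matI sum mult mats_entry)

lemma mats_four_block:
  assumes G: "G1 \<in> mats r1 c1" "G2 \<in> mats r1 c2" "G3 \<in> mats r2 c1" "G4 \<in> mats r2 c2"
  shows "(\<lambda>x. four_block_mat (G1 x) (G2 x) (G3 x) (G4 x)) \<in> mats (r1 + r2) (c1 + c2)"
proof (rule matsI[where f = "\<lambda>i j. if i < r1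
    then if j < c1 then (\<lambda>x. G1 x $$ (i, j)) else (\<lambda>x. G2 x $$ (i, j - c1))
    else if j < c1 then (\<lambda>x. G3 x $$ (i - r1, j)) else (\<lambda>x. G4 x $$ (i - r1, j - c1))"])
  show "four_block_mat (G1 x) (G2 x) (G3 x) (G4 x) \<in> carrier_mat (r1 + r2) (c1 + c2)" if "x \<in> X" for x
    using G that by (intro four_block_carrier_mat mats_carrier)
qed (use G in \<open>auto simp: mats_dim intro!: mats_entry\<close>)

lemma det_in:
  assumes G: "G \<in> mats k k"
  shows "(\<lambda>x. det (G x)) \<in> F"
proof (rule cong)
  show "(\<lambda>x. \<Sum>p\<in>{p. p permutes {0..<k}}. signof p * (\<Prod>i = 0..<k. G x $$ (i, p i))) \<in> F"
    using G by (intro sum mult const prod mats_entry[OF G]) (auto simp: permutes_in_image)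
  show "(\<Sum>p\<in>{p. p permutes {0..<k}}. signof p * (\<Prod>i = 0..<k. G x $$ (i, p i))) = det (G x)"
    if "x \<in> X" for x
    using det_def'[OF mats_carrier[OF G that]] by simp
qed

lemma mats_adj:
  assumes G: "G \<in> mats k k"
  shows "(\<lambda>x. adj_mat (G x)) \<in> mats k k"
proof (rule matsI[where f = "\<lambda>i j x. cofactor (G x) j i"])
  fix i j assume ij: "i < k" "j < k"
  have "(\<lambda>x. mat_delete (G x) j i) \<in> mats (k - 1) (k - 1)"
  proof (rule matsI[where f = "\<lambda>a b x. G x $$ (if a < j then a else Suc a, if b < i then b else Suc b)"])
    fix a b assume "a < k - 1" "b < k - 1"
    then show "(\<lambda>x. G x $$ (if a < j then a else Suc a, if b < i then b else Suc b)) \<in> F"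
      using ij by (intro mats_entry[OF G]) auto
  qed (use G in \<open>auto simp: mat_delete_def mats_dim intro!: carrier_matI\<close>)
  then show "(\<lambda>x. cofactor (G x) j i) \<in> F"
    unfolding cofactor_def by (intro mult const det_in)
qed (use G in \<open>auto simp: adj_mat_def mats_dim intro!: carrier_matI\<close>)

text \<open>The inverse of the determinant is the one function that a ring does not supply. It comes
  from \<open>regular_fun_inverse\<close> for regular functions, from
  \<open>differentiable_inverse\<close> for differentiable ones, and for \<open>ratfuns q\<close>
  from choosing \<open>q\<close> as the determinant.\<close>

lemma mats_inv:
  assumes G: "G \<in> mats k k" and det: "\<And>x. x \<in> X \<Longrightarrow> det (G x) \<noteq> 0"
    and inv: "(\<lambda>x. inverse (det (G x))) \<in> F"
  shows "(\<lambda>x. mat_inv (G x)) \<in> mats k k"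
proof -
  note * = mats_smult[OF inv mats_adj[OF G]]
  have eq: "inverse (det (G x)) \<cdot>\<^sub>m adj_mat (G x) = mat_inv (G x)" if "x \<in> X" for x
    using mat_inv_adj_mat[OF mats_carrier[OF G that] det[OF that]] by simp
  show ?thesis
    by (rule matsI[where f = "\<lambda>i j x. (inverse (det (G x)) \<cdot>\<^sub>m adj_mat (G x)) $$ (i, j)"])
      (use mats_carrier[OF *] mats_entry[OF *] eq in auto)
qed

end

section \<open>Rings of polynomial, regular and rational functions\<close>

lemma function_ring_poly_on: "function_ring X (poly_on C X)"
proof
  show "(\<lambda>_. c) \<in> poly_on C X" for c by (auto simp: poly_on_def intro!: bexI poly_funs.const)
  fix f g assume "f \<in> poly_on C X" "g \<in> poly_on C X"
  then obtain p q where "p \<in> poly_funs C" "\<forall>x\<in>X. f x = p x" "q \<in> poly_funs C" "\<forall>x\<in>X. g x = q x"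
    unfolding poly_on_def by blast
  then show "(\<lambda>x. f x + g x) \<in> poly_on C X" "(\<lambda>x. f x * g x) \<in> poly_on C X"
    unfolding poly_on_def
    using poly_funs.add[of p C q] poly_funs.mult[of p C q] by (force intro!: bexI)+
qed (force simp: poly_on_def)

lemma poly_on_coord: "c \<in> C \<Longrightarrow> c \<in> poly_on C X"
  by (auto simp: poly_on_def intro!: bexI[of _ c] poly_funs.coord)

lemma function_ring_regular: "function_ring X {f. regular_fun C X f}"
proof
  show "(\<lambda>_. c) \<in> {f. regular_fun C X f}" for c
    using function_ring.const[OF function_ring_poly_on, of c C X] by (simp add: regular_fun_poly_on)
  fix f g assume "f \<in> {f. regular_fun C X f}" "g \<in> {f. regular_fun C X f}"
  then have fg: "regular_fun C X f" "regular_fun C X g" by auto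
  have "regular_fun C X (\<lambda>x. f x + g x)"
    by (rule regular_fun_binop[OF fg, where N = "\<lambda>p q r s x. p x * s x + r x * q x"])
      (auto intro!: poly_funs.add poly_funs.mult simp: field_simps)
  moreover have "regular_fun C X (\<lambda>x. f x * g x)"
    by (rule regular_fun_binop[OF fg, where N = "\<lambda>p q r s x. p x * r x"])
      (auto intro!: poly_funs.add poly_funs.mult simp: field_simps)
  ultimately show "(\<lambda>x. f x + g x) \<in> {f. regular_fun C X f}" "(\<lambda>x. f x * g x) \<in> {f. regular_fun C X f}"
    by auto
qed (auto intro: regular_fun_cong)

text \<open>The localization of the polynomial ring at the powers of \<open>q\<close>, as functions
  on the complement of the zeros of \<open>q\<close>; values at the zeros are arbitrary.\<close>

definition ratfuns :: "complex poly \<Rightarrow> (complex \<Rightarrow> complex) set" where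
  "ratfuns q = {f. \<exists>p k. \<forall>t. poly q t \<noteq> 0 \<longrightarrow> f t * poly q t ^ k = poly p t}"

lemma ratfunsI: "(\<And>t. poly q t \<noteq> 0 \<Longrightarrow> f t * poly q t ^ k = poly p t) \<Longrightarrow> f \<in> ratfuns q"
  unfolding ratfuns_def by blast

lemma function_ring_ratfuns: "function_ring {t. poly q t \<noteq> 0} (ratfuns q)"
proof
  show "(\<lambda>_. c) \<in> ratfuns q" for c by (rule ratfunsI[of _ _ 0 "[:c:]"]) simp
  fix f g assume f: "f \<in> ratfuns q"
  then obtain p k where p: "\<And>t. poly q t \<noteq> 0 \<Longrightarrow> f t * poly q t ^ k = poly p t"
    by (auto simp: ratfuns_def)
  show "g \<in> ratfuns q" if "\<And>x. x \<in> {t. poly q t \<noteq> 0} \<Longrightarrow> f x = g x"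
    using p that by (intro ratfunsI[of _ _ k p]) auto
  assume "g \<in> ratfuns q"
  then obtain r l where r: "\<And>t. poly q t \<noteq> 0 \<Longrightarrow> g t * poly q t ^ l = poly r t"
    by (auto simp: ratfuns_def)
  show "(\<lambda>x. f x + g x) \<in> ratfuns q"
    by (rule ratfunsI[of _ _ "k + l" "p * q ^ l + r * q ^ k"])
      (simp add: p[symmetric] r[symmetric] power_add algebra_simps)
  show "(\<lambda>x. f x * g x) \<in> ratfuns q"
    by (rule ratfunsI[of _ _ "k + l" "p * r"])
      (simp add: p[symmetric] r[symmetric] power_add algebra_simps)
qed

lemma ratfuns_poly: "poly p \<in> ratfuns q"
  by (rule ratfunsI[of _ _ 0 p]) simp

lemma ratfuns_inverse: "(\<lambda>t. inverse (poly q t)) \<in> ratfuns q"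
  by (rule ratfunsI[of _ _ 1 1]) simp

text \<open>Clearing denominators gives two nonzero polynomials; they and \<open>q\<close> have
  finitely many roots, while the field is infinite. This is the irreducibility of a punctured
  line.\<close>

lemma ratfuns_common_nonzero:
  assumes f: "f \<in> ratfuns q" "poly q a \<noteq> 0" "f a \<noteq> 0" and g: "g \<in> ratfuns q" "poly q b \<noteq> 0" "g b \<noteq> 0"
  obtains t where "poly q t \<noteq> 0" "f t \<noteq> 0" "g t \<noteq> 0"
proof -
  obtain p k where p: "\<And>t. poly q t \<noteq> 0 \<Longrightarrow> f t * poly q t ^ k = poly p t"
    using f(1) by (auto simp: ratfuns_def)
  obtain r l where r: "\<And>t. poly q t \<noteq> 0 \<Longrightarrow> g t * poly q t ^ l = poly r t"
    using g(1) by (auto simp: ratfuns_def)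
  have "p \<noteq> 0" "r \<noteq> 0" "q \<noteq> 0"
    using p[OF f(2)] r[OF g(2)] f g by auto
  then have "finite {t. poly (p * r * q) t = 0}" by (intro poly_roots_finite) auto
  then obtain t where "poly (p * r * q) t \<noteq> 0"
    using infinite_UNIV_char_0[where ?'a = complex] by (metis (mono_tags) UNIV_eq_I mem_Collect_eq)
  then have t: "poly q t \<noteq> 0" "poly p t \<noteq> 0" "poly r t \<noteq> 0" by auto
  then have "f t \<noteq> 0" "g t \<noteq> 0" using p[OF t(1)] r[OF t(1)] by auto
  with t show thesis using that by blast
qed

lemma sim_orbit_irreducible:
  assumes J: "J \<in> carrier_mat N N" and A: "A \<in> sim_orbit J" and B: "B \<in> sim_orbit J"
    and f: "f \<in> poly_funs (mat_coords N N)" "f A \<noteq> 0"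
    and g: "g \<in> poly_funs (mat_coords N N)" "g B \<noteq> 0"
  obtains D where "D \<in> sim_orbit J" "f D \<noteq> 0" "g D \<noteq> 0"
proof -
  obtain a where a: "a \<in> carrier_mat N N" "det a \<noteq> 0" "A = a * J * mat_inv a"
    using A sim_orbit_iff[OF J] by auto
  obtain b where b: "b \<in> carrier_mat N N" "det b \<noteq> 0" "B = b * J * mat_inv b"
    using B sim_orbit_iff[OF J] by auto
  define G where "G t = a + t \<cdot>\<^sub>m (b - a)" for t :: complex
  have id: "(\<lambda>t. t) \<in> ratfuns q" for q using ratfuns_poly[of "[:0, 1:]" q] by (simp add: poly_pCons[abs_def])
  have G: "G \<in> function_ring.mats {t. poly q t \<noteq> 0} (ratfuns q) N N" for q
  proof -
    interpret function_ring "{t. poly q t \<noteq> 0}" "ratfuns q" by (rule function_ring_ratfuns)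
    show ?thesis unfolding G_def using a b id by (intro mats_add mats_smult mats_const) auto
  qed
  \<comment> \<open>\<open>ratfuns 1\<close> is the ring of polynomials, so the determinant along
    the line is a polynomial \<open>q\<close>. It becomes the denominator of
    \<open>mat_inv (G t)\<close>, which is why \<open>G\<close> was placed in the ring for every
    \<open>q\<close>.\<close>
  obtain q where q: "det (G t) = poly q t" for t
  proof -
    have "(\<lambda>t. det (G t)) \<in> ratfuns 1"
      by (rule function_ring.det_in[OF function_ring_ratfuns G])
    then show thesis using that by (auto simp: ratfuns_def)
  qed
  interpret function_ring "{t. poly q t \<noteq> 0}" "ratfuns q" by (rule function_ring_ratfuns)
  define K where "K t = G t * J * mat_inv (G t)" for t
  have K: "K \<in> mats N N"
    unfolding K_def using q ratfuns_inverse[of q] by (intro mats_mult[OF mats_mult[OF G mats_const[OF J]] mats_inv] G) auto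
  have coord: "(\<lambda>t. c (K t)) \<in> ratfuns q" if "c \<in> mat_coords N N" for c
    using that mats_entry[OF K] by (auto simp: mat_coords_def)
  have G01: "G 0 = a" "G 1 = b" using a b by (auto simp: G_def intro!: eq_matI)
  have K01: "K 0 = A" "K 1 = B" using a b G01 by (auto simp: K_def)
  have q01: "poly q 0 \<noteq> 0" "poly q 1 \<noteq> 0" using a b by (auto simp: q[symmetric] G01)
  have fK: "(\<lambda>t. f (K t)) \<in> ratfuns q"
    by (rule poly_funs_comp[OF f(1)]) (rule coord)
  have gK: "(\<lambda>t. g (K t)) \<in> ratfuns q"
    by (rule poly_funs_comp[OF g(1)]) (rule coord)
  have "f (K 0) \<noteq> 0" "g (K 1) \<noteq> 0" using f(2) g(2) K01 by auto
  then obtain t where t: "poly q t \<noteq> 0" "f (K t) \<noteq> 0" "g (K t) \<noteq> 0"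
    using ratfuns_common_nonzero[OF fK q01(1) _ gK q01(2)] by blast
  have "K t \<in> sim_orbit J"
    unfolding sim_orbit_iff[OF J] using t(1) q mats_carrier[OF G]
    by (intro bexI[of _ "G t"]) (auto simp: K_def)
  then show thesis using t that by blast
qed

section \<open>Regularity of the block coordinates\<close>

abbreviation "poly_mats C X \<equiv> function_ring.mats X (poly_on C X)"
abbreviation "regular_mats C X \<equiv> function_ring.mats X {f. regular_fun C X f}"

lemma poly_mats_regular:
  assumes "G \<in> poly_mats C X r c"
  shows "G \<in> regular_mats C X r c"
  using assms regular_fun_poly_on
  unfolding function_ring.mats_def[OF function_ring_poly_on] function_ring.mats_def[OF function_ring_regular]
  by blast

lemma poly_mats_coord:
  assumes "\<And>x. x \<in> X \<Longrightarrow> \<phi> x \<in> carrier_mat r c" and "\<And>f. f \<in> mat_coords r c \<Longrightarrow> f \<circ> \<phi> \<in> C"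
  shows "\<phi> \<in> poly_mats C X r c"
proof -
  have "(\<lambda>x. \<phi> x $$ (i, j)) \<in> poly_on C X" if "i < r" "j < c" for i j
    using poly_on_coord[OF assms(2)[of "\<lambda>A. A $$ (i, j)"]] that
    by (auto simp: mat_coords_def o_def)
  then show ?thesis
    using assms(1) by (auto simp: function_ring.mats_def[OF function_ring_poly_on])
qed

lemma regular_mats_cong:
  assumes "G \<in> regular_mats C X r c" and "\<And>x. x \<in> X \<Longrightarrow> G x = H x"
  shows "H \<in> regular_mats C X r c"
  using function_ring.mats_carrier[OF function_ring_regular assms(1)]
    function_ring.mats_entry[OF function_ring_regular assms(1)] assms(2)
  by (intro function_ring.matsI[OF function_ring_regular, where f = "\<lambda>i j x. G x $$ (i, j)"]) auto

lemma regular_mats_coord: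
  assumes "G \<in> regular_mats C X r c" and "d \<in> mat_coords r c"
  shows "regular_fun C X (d \<circ> G)"
  using assms by (auto simp: function_ring.mats_def[OF function_ring_regular] mat_coords_def o_def)

lemma regular_map_matI:
  assumes "G \<in> regular_mats C X r c" and "G ` X \<subseteq> Y"
  shows "regular_map C X (mat_coords r c) Y G"
  using assms regular_mats_coord unfolding regular_map_def by blast

lemma regular_fun_prod_coords:
  assumes "d \<in> prod_coords D E"
    and "\<And>d. d \<in> D \<Longrightarrow> regular_fun C X (d \<circ> (\<lambda>x. fst (f x)))"
    and "\<And>e. e \<in> E \<Longrightarrow> regular_fun C X (e \<circ> (\<lambda>x. snd (f x)))"
  shows "regular_fun C X (d \<circ> f)"
  using assms by (auto simp: prod_coords_def o_def)

lemma regular_map_pairI: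
  assumes "(\<lambda>x. fst (f x)) \<in> regular_mats C X r c" and "(\<lambda>x. snd (f x)) \<in> regular_mats C X r' c'"
    and "f ` X \<subseteq> Y"
  shows "regular_map C X (prod_coords (mat_coords r c) (mat_coords r' c')) Y f"
  unfolding regular_map_def
  using assms by (auto intro!: regular_fun_prod_coords regular_mats_coord)

lemma regular_map_tripleI:
  assumes "(\<lambda>x. fst (f x)) \<in> regular_mats C X m n" and "(\<lambda>x. fst (snd (f x))) \<in> regular_mats C X n m"
    and "(\<lambda>x. snd (snd (f x))) \<in> regular_mats C X m m" and "f ` X \<subseteq> Y"
  shows "regular_map C X (triple_coords n m) Y f"
  unfolding regular_map_def triple_coords_def
  using assms by (auto intro!: regular_fun_prod_coords regular_mats_coord)

lemma sel_transpose_carrier: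
  "(sel1 n m)\<^sup>T \<in> carrier_mat n (n + m)" "(sel2 n m)\<^sup>T \<in> carrier_mat m (n + m)"
  by simp_all

lemma char_matrix_mats:
  assumes "function_ring X F" and G: "G \<in> function_ring.mats X F k k"
  shows "(\<lambda>x. char_matrix (G x) ev) \<in> function_ring.mats X F k k"
proof -
  interpret function_ring X F by fact
  have *: "(\<lambda>x. G x - ev \<cdot>\<^sub>m 1\<^sub>m k) \<in> mats k k" by (intro mats_minus mats_const G) auto
  show ?thesis
    using mats_carrier[OF *] mats_entry[OF *] char_matrix_eq_minus[OF mats_carrier[OF G]]
    by (intro matsI[where f = "\<lambda>i j x. (G x - ev \<cdot>\<^sub>m 1\<^sub>m k) $$ (i, j)"]) auto
qed

text \<open>\<open>P\<close> stacked on top of \<open>D\<close>: a joint kernel is the kernel of a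
  single matrix, so that a left inverse can witness its triviality.\<close>

lemma kernel_stack:
  assumes P: "P \<in> carrier_mat n m" and D: "D \<in> carrier_mat m m"
  shows "mat_kernel (sel1 n m * P + sel2 n m * D) = mat_kernel P \<inter> mat_kernel D"
proof -
  let ?C = "sel1 n m * P + sel2 n m * D"
  have C: "?C \<in> carrier_mat (n + m) m" using P D by auto
  have eqs: "(sel1 n m)\<^sup>T * ?C = P" "(sel2 n m)\<^sup>T * ?C = D"
    using P D by (auto simp: mat_distribs sel_cancel)
  have "v \<in> mat_kernel ?C" if "v \<in> mat_kernel P" "v \<in> mat_kernel D" for v
  proof -
    have v: "v \<in> carrier_vec m" "P *\<^sub>v v = 0\<^sub>v n" "D *\<^sub>v v = 0\<^sub>v m"
      using mat_kernelD[OF P that(1)] mat_kernelD[OF D that(2)] by auto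
    then have "?C *\<^sub>v v = sel1 n m *\<^sub>v (P *\<^sub>v v) + sel2 n m *\<^sub>v (D *\<^sub>v v)"
      using P D by (subst add_mult_distrib_mat_vec[of _ "n + m" m]) (auto simp: mult_vec_assoc_dim)
    also have "\<dots> = 0\<^sub>v (n + m)" unfolding v by (simp add: mult_zero_vec)
    finally show ?thesis using v by (simp add: mat_kernel[OF C])
  qed
  then show ?thesis
    using mat_kernel_mult_subset[OF C, of "(sel1 n m)\<^sup>T" n] mat_kernel_mult_subset[OF C, of "(sel2 n m)\<^sup>T" m]
    unfolding eqs by auto
qed

text \<open>The inverse of \<open>darboux_map\<close> on the target. Reading off the blocks by
  matrix products shows that it is polynomial.\<close>

definition offdiag_blocks :: "nat \<Rightarrow> nat \<Rightarrow> complex mat \<times> complex mat \<Rightarrow> complex mat \<times> complex mat \<times> complex mat" where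
  "offdiag_blocks n m = (\<lambda>(B, A').
     ((sel2 n m)\<^sup>T * (B * sel1 n m), (sel1 n m)\<^sup>T * (B * sel2 n m), A'))"

lemma offdiag_blocks_darboux:
  assumes "Q \<in> carrier_mat m n" "P \<in> carrier_mat n m"
  shows "offdiag_blocks n m (darboux_map n m (Q, P, A')) = (Q, P, A')"
  using assms four_block_eq_sel[of "0\<^sub>m n n" n P m Q "0\<^sub>m m m"]
  by (simp add: offdiag_blocks_def darboux_map_def)

section \<open>Open sets, biregular maps and density in the block setting\<close>

context block_setting
begin

abbreviation "N \<equiv> n + m"
abbreviation "enlarged \<equiv> enlarged_orbit ev n m bs"
abbreviation "target \<equiv> offdiag n m \<times> reduced"
abbreviation "pair_coords \<equiv> prod_coords (mat_coords N N) (mat_coords m m)"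

lemma admissible_subset_enlarged: "admissible \<subseteq> enlarged"
  by (auto simp: admissible_def enlarged_orbit_eq)

lemma enlarged_mats:
  assumes "X \<subseteq> enlarged"
  shows "fst \<in> poly_mats (triple_coords n m) X m n"
    and "(\<lambda>c. fst (snd c)) \<in> poly_mats (triple_coords n m) X n m"
    and "(\<lambda>c. snd (snd c)) \<in> poly_mats (triple_coords n m) X m m"
  using assms
  by (intro poly_mats_coord; force simp: enlarged_orbit_eq reduced_carrier triple_coords_def prod_coords_def o_def)+

lemma target_mats:
  assumes "X \<subseteq> target"
  shows "fst \<in> poly_mats pair_coords X N N" and "snd \<in> poly_mats pair_coords X m m"
  using assms
  by (intro poly_mats_coord; force simp: offdiag_def reduced_carrier prod_coords_def o_def)+

lemma orbit_mats:
  assumes "X \<subseteq> sim_orbit J"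
  shows "(\<lambda>A. A) \<in> poly_mats (mat_coords N N) X N N"
  using assms sim_orbit_carrier[OF J_carrier] by (intro poly_mats_coord) (auto simp: o_def)

text \<open>A left inverse \<open>L\<close> of the stacked matrix at \<open>x\<close> is kept fixed;
  where \<open>det (L * S y)\<close> does not vanish, the stacked matrix is still injective. The
  space \<open>X\<close> is arbitrary because the condition is needed on the enlarged manifold and
  on the target.\<close>

lemma admissible_open_condition:
  assumes P: "P \<in> poly_mats C X n m" and A': "A' \<in> poly_mats C X m m"
  shows "openin (zariski C X) {x \<in> X. mat_kernel (P x) \<inter> mat_kernel (char_matrix (A' x) ev) = {0\<^sub>v m}}"
    (is "openin _ ?U")
proof (subst openin_subopen, intro ballI)
  interpret function_ring X "poly_on C X" by (rule function_ring_poly_on)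
  define S where "S x = S1 * P x + S2 * char_matrix (A' x) ev" for x
  have S: "S \<in> mats N m"
    unfolding S_def
    by (rule mats_add[OF mats_mult[OF mats_const[OF sel_carrier(1)] P]
        mats_mult[OF mats_const[OF sel_carrier(2)] char_matrix_mats[OF function_ring_axioms A']]])
  have ker: "mat_kernel (P x) \<inter> mat_kernel (char_matrix (A' x) ev) = mat_kernel (S x)" if "x \<in> X" for x
    unfolding S_def using kernel_stack[OF mats_carrier[OF P that], of "char_matrix (A' x) ev"]
      mats_carrier[OF A' that] by simp
  fix x assume x: "x \<in> ?U"
  then have "mat_kernel (S x) = {0\<^sub>v m}" using ker by auto
  then obtain L where L: "L \<in> carrier_mat m N" "L * S x = 1\<^sub>m m"
    using left_inverse_of_injective[OF mats_carrier[OF S]] x by blast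
  define V where "V = {y \<in> X. det (L * S y) \<noteq> 0}"
  have "openin (zariski C X) V"
    unfolding V_def by (rule openin_zariski_poly_on[OF det_in[OF mats_mult[OF mats_const[OF L(1)] S]]])
  moreover have "x \<in> V" using x L by (simp add: V_def)
  moreover have "V \<subseteq> ?U"
    using injective_of_left_inverse[OF mats_carrier[OF S] L(1)] ker by (auto simp: V_def)
  ultimately show "\<exists>T. openin (zariski C X) T \<and> x \<in> T \<and> T \<subseteq> ?U" by blast
qed

lemma admissible_iff:
  "c \<in> admissible \<longleftrightarrow> c \<in> enlarged \<and>
    mat_kernel (fst (snd c)) \<inter> mat_kernel (char_matrix (snd (snd c)) ev) = {0\<^sub>v m}"
  by (cases c) (simp add: admissible_def enlarged_orbit_eq)

lemma admissible_open: "openin (zariski (triple_coords n m) enlarged) admissible"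
  using admissible_open_condition[OF enlarged_mats(2,3)[OF subset_refl]]
  by (simp flip: admissible_iff)

lemma block_coords_eqs:
  assumes "A \<in> transverse" and "block_coords ev n m bs A = (Q, P, A')"
  shows "Q \<in> carrier_mat m n" and "char_matrix A ev * graph_mat n m Q = 0\<^sub>m N n"
    and "P = S1\<^sup>T * (A * S2)" and "A' = cograph_mat n m Q * (A * S2)"
    and "P \<in> carrier_mat n m" and "A' \<in> reduced"
proof -
  note * = block_coords_transverse[OF assms(1), unfolded assms(2)]
  show Q: "Q \<in> carrier_mat m n" and P: "P \<in> carrier_mat n m" and A': "A' \<in> reduced"
    using *(1) by (auto simp: admissible_def)
  show "char_matrix A ev * graph_mat n m Q = 0\<^sub>m N n"
    and "P = S1\<^sup>T * (A * S2)" and "A' = cograph_mat n m Q * (A * S2)"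
    using *(2) assemble_iff[OF Q transverse_carrier[OF assms(1)] P reduced_carrier[OF A'], of ev] by auto
qed

abbreviation "q_coord A \<equiv> fst (block_coords ev n m bs A)"

lemma q_coord:
  assumes "A \<in> transverse"
  shows "q_coord A \<in> carrier_mat m n" "char_matrix A ev * graph_mat n m (q_coord A) = 0\<^sub>m N n"
  using block_coords_eqs(1,2)[OF assms] by (metis prod.collapse)+

lemma block_coords_eq:
  assumes "A \<in> transverse"
  shows "block_coords ev n m bs A = (q_coord A, S1\<^sup>T * (A * S2), cograph_mat n m (q_coord A) * (A * S2))"
  using block_coords_eqs(3,4)[OF assms] by (metis prod.collapse)

lemma transverse_left_inverse:
  assumes "A \<in> transverse"
  obtains L where "L \<in> carrier_mat m N" and "L * (char_matrix A ev * S2) = 1\<^sub>m m"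
  using left_inverse_of_injective[OF mult_carrier_mat[OF char_matrix_closed[OF transverse_carrier[OF assms]] sel_carrier(2)]]
    assms by (auto simp: transverse_iff)

lemma q_coord_formula:
  assumes "A \<in> transverse" and "L \<in> carrier_mat m N" and "det (L * (char_matrix A ev * S2)) \<noteq> 0"
  shows "q_coord A = - (mat_inv (L * (char_matrix A ev * S2)) * (L * (char_matrix A ev * S1)))"
  using q_coord[OF assms(1)] transverse_carrier[OF assms(1)] assms
  by (intro graph_mat_formula[where M = "char_matrix A ev"]) auto

lemma transverse_open: "openin (zariski (mat_coords N N) (sim_orbit J)) transverse"
proof (subst openin_subopen, intro ballI)
  interpret function_ring "sim_orbit J" "poly_on (mat_coords N N) (sim_orbit J)" by (rule function_ring_poly_on)
  fix A assume A: "A \<in> transverse"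
  obtain L where L: "L \<in> carrier_mat m N" "L * (char_matrix A ev * S2) = 1\<^sub>m m"
    using transverse_left_inverse[OF A] .
  define S where "S B = char_matrix B ev * S2" for B
  have S: "S \<in> mats N m"
    unfolding S_def
    by (rule mats_mult[OF char_matrix_mats[OF function_ring_axioms orbit_mats[OF subset_refl]]
        mats_const[OF sel_carrier(2)]])
  define V where "V = {B \<in> sim_orbit J. det (L * S B) \<noteq> 0}"
  have "openin (zariski (mat_coords N N) (sim_orbit J)) V"
    unfolding V_def by (rule openin_zariski_poly_on[OF det_in[OF mats_mult[OF mats_const[OF L(1)] S]]])
  moreover have "A \<in> V" using A L by (simp add: V_def S_def transverse_iff)
  moreover have "V \<subseteq> transverse"
    using injective_of_left_inverse[OF mats_carrier[OF S] L(1)] by (auto simp: V_def transverse_iff S_def)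
  ultimately show "\<exists>T. openin (zariski (mat_coords N N) (sim_orbit J)) T \<and> A \<in> T \<and> T \<subseteq> transverse" by blast
qed

lemma transverse_sub_orbit: "transverse \<subseteq> sim_orbit J"
  by (auto simp: transverse_iff)

lemma q_coord_regular: "q_coord \<in> regular_mats (mat_coords N N) transverse m n"
proof -
  interpret T: function_ring transverse "{f. regular_fun (mat_coords N N) transverse f}"
    by (rule function_ring_regular)
  have "regular_fun (mat_coords N N) transverse (\<lambda>A. q_coord A $$ (i, j))" if ij: "i < m" "j < n" for i j
  proof (rule regular_fun_local)
    fix A assume A: "A \<in> transverse"
    obtain L where L: "L \<in> carrier_mat m N" "L * (char_matrix A ev * S2) = 1\<^sub>m m"
      using transverse_left_inverse[OF A] .
    \<comment> \<open>The point \<open>A\<close> determines \<open>L\<close>; on \<open>Y\<close>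
      the formula \<open>q_coord_formula\<close> holds with this \<open>L\<close>, and its
      denominator does not vanish.\<close>
    define Y where "Y = {B \<in> transverse. det (L * (char_matrix B ev * S2)) \<noteq> 0}"
    have Y: "openin (zariski (mat_coords N N) transverse) Y"
      unfolding Y_def
      by (rule openin_zariski_poly_on[OF function_ring.det_in[OF function_ring_poly_on
        function_ring.mats_mult[OF function_ring_poly_on function_ring.mats_const[OF function_ring_poly_on L(1)]
        function_ring.mats_mult[OF function_ring_poly_on
          char_matrix_mats[OF function_ring_poly_on orbit_mats[OF transverse_sub_orbit]]
          function_ring.mats_const[OF function_ring_poly_on sel_carrier(2)]]]]])
    interpret function_ring Y "{f. regular_fun (mat_coords N N) Y f}"
      by (rule function_ring_regular)
    have id: "(\<lambda>A. A) \<in> mats N N"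
      using transverse_sub_orbit by (intro poly_mats_regular orbit_mats) (auto simp: Y_def)
    have X: "(\<lambda>B. L * (char_matrix B ev * S2)) \<in> mats m m" "(\<lambda>B. L * (char_matrix B ev * S1)) \<in> mats m n"
      by (rule mats_mult[OF mats_const[OF L(1)] mats_mult[OF char_matrix_mats[OF function_ring_axioms id]
          mats_const[OF sel_carrier(2)]]])
        (rule mats_mult[OF mats_const[OF L(1)] mats_mult[OF char_matrix_mats[OF function_ring_axioms id]
          mats_const[OF sel_carrier(1)]]])
    have det: "det (L * (char_matrix B ev * S2)) \<noteq> 0" if "B \<in> Y" for B
      using that by (simp add: Y_def)
    have "(\<lambda>B. - (mat_inv (L * (char_matrix B ev * S2)) * (L * (char_matrix B ev * S1)))) \<in> mats m n"
      using det_in[OF X(1)] regular_fun_inverse[OF _ det]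
      by (intro mats_uminus mats_mult[OF mats_inv[OF X(1) det] X(2)]) auto
    from mats_entry[OF this ij]
    have "regular_fun (mat_coords N N) Y (\<lambda>A. q_coord A $$ (i, j))"
      using q_coord_formula[OF _ L(1)]
      by (auto simp: Y_def elim!: regular_fun_cong)
    then show "\<exists>Y. openin (zariski (mat_coords N N) transverse) Y \<and> A \<in> Y \<and>
        regular_fun (mat_coords N N) Y (\<lambda>A. q_coord A $$ (i, j))"
      using Y A L by (intro exI[of _ Y]) (simp add: Y_def)
  qed
  then show ?thesis using q_coord(1) by (simp add: T.mats_def)
qed

lemma block_coords_regular:
  "(\<lambda>A. S1\<^sup>T * (A * S2)) \<in> regular_mats (mat_coords N N) transverse n m"
  "(\<lambda>A. cograph_mat n m (q_coord A) * (A * S2)) \<in> regular_mats (mat_coords N N) transverse m m"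
proof -
  interpret T: function_ring transverse "{f. regular_fun (mat_coords N N) transverse f}"
    by (rule function_ring_regular)
  note id = poly_mats_regular[OF orbit_mats[OF transverse_sub_orbit]]
  show "(\<lambda>A. S1\<^sup>T * (A * S2)) \<in> T.mats n m"
    by (rule T.mats_mult[OF T.mats_const[OF sel_transpose_carrier(1)] T.mats_mult[OF id T.mats_const[OF sel_carrier(2)]]])
  show "(\<lambda>A. cograph_mat n m (q_coord A) * (A * S2)) \<in> T.mats m m"
    unfolding cograph_mat_def
    by (rule T.mats_mult[OF T.mats_minus[OF T.mats_const[OF sel_transpose_carrier(2)]
          T.mats_mult[OF q_coord_regular T.mats_const[OF sel_transpose_carrier(1)]]]
      T.mats_mult[OF id T.mats_const[OF sel_carrier(2)]]])
qed

lemma assemble_mats: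
  assumes "function_ring X F" and Q: "Q \<in> function_ring.mats X F m n" and P: "P \<in> function_ring.mats X F n m"
    and A': "A' \<in> function_ring.mats X F m m"
  shows "(\<lambda>x. assemble ev n m (Q x, P x, A' x)) \<in> function_ring.mats X F N N"
proof -
  interpret function_ring X F by fact
  have *: "(\<lambda>x. four_block_mat (ev \<cdot>\<^sub>m 1\<^sub>m n - P x * Q x) (P x) (ev \<cdot>\<^sub>m Q x - (Q x * P x + A' x) * Q x)
      (Q x * P x + A' x)) \<in> mats N N" (is "?G \<in> _")
    by (rule mats_four_block mats_minus mats_smult mats_const mats_mult mats_add Q P A' const
      smult_carrier_mat one_carrier_mat)+
  have eq: "?G x = assemble ev n m (Q x, P x, A' x)" if "x \<in> X" for x
    using assemble_eq[OF mats_carrier[OF Q that] mats_carrier[OF P that] mats_carrier[OF A' that]] by simp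
  show ?thesis
    by (rule matsI[where f = "\<lambda>i j x. ?G x $$ (i, j)"]) (use mats_carrier[OF *] mats_entry[OF *] eq in auto)
qed

lemma biregular_block_coords:
  "biregular (mat_coords N N) transverse (triple_coords n m) admissible (block_coords ev n m bs)"
proof (rule biregularI)
  show "regular_map (mat_coords N N) transverse (triple_coords n m) admissible (block_coords ev n m bs)"
  proof (rule regular_map_tripleI)
    show "q_coord \<in> regular_mats (mat_coords N N) transverse m n" by (rule q_coord_regular)
    show "(\<lambda>A. fst (snd (block_coords ev n m bs A))) \<in> regular_mats (mat_coords N N) transverse n m"
      by (rule regular_mats_cong[OF block_coords_regular(1)]) (subst block_coords_eq; simp)
    show "(\<lambda>A. snd (snd (block_coords ev n m bs A))) \<in> regular_mats (mat_coords N N) transverse m m"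
      by (rule regular_mats_cong[OF block_coords_regular(2)]) (subst (2) block_coords_eq; simp)
  qed (use block_coords_transverse in auto)
  show "regular_map (triple_coords n m) admissible (mat_coords N N) transverse (assemble ev n m)"
  proof (rule regular_map_matI)
    show "assemble ev n m \<in> regular_mats (triple_coords n m) admissible N N"
      using poly_mats_regular[OF assemble_mats[OF function_ring_poly_on enlarged_mats[OF admissible_subset_enlarged]]]
      by simp
  qed (use assemble_admissible in auto)
qed (use block_coords_transverse block_coords_assemble in auto)

lemma darboux_mats:
  assumes "function_ring X F" and Q: "Q \<in> function_ring.mats X F m n" and P: "P \<in> function_ring.mats X F n m"
  shows "(\<lambda>x. four_block_mat (0\<^sub>m n n) (P x) (Q x) (0\<^sub>m m m)) \<in> function_ring.mats X F N N"
proof -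
  interpret function_ring X F by fact
  show ?thesis by (rule mats_four_block mats_const Q P zero_carrier_mat)+
qed

lemma darboux_enlarged: "c \<in> enlarged \<Longrightarrow> darboux_map n m c \<in> target"
  by (auto simp: enlarged_orbit_eq darboux_map_def offdiag_def)

lemma offdiag_blocks_target:
  assumes "y \<in> target"
  shows "offdiag_blocks n m y \<in> enlarged" "darboux_map n m (offdiag_blocks n m y) = y"
proof -
  obtain Q P A' where y: "y = darboux_map n m (Q, P, A')" "Q \<in> carrier_mat m n" "P \<in> carrier_mat n m" "A' \<in> reduced"
    using assms by (auto simp: offdiag_def darboux_map_def)
  show "offdiag_blocks n m y \<in> enlarged" "darboux_map n m (offdiag_blocks n m y) = y"
    unfolding y(1) offdiag_blocks_darboux[OF y(2,3)] using y by (auto simp: enlarged_orbit_eq)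
qed

lemma offdiag_blocks_mats:
  assumes "X \<subseteq> target"
  shows "(\<lambda>y. fst (offdiag_blocks n m y)) \<in> poly_mats pair_coords X m n"
    and "(\<lambda>y. fst (snd (offdiag_blocks n m y))) \<in> poly_mats pair_coords X n m"
    and "(\<lambda>y. snd (snd (offdiag_blocks n m y))) \<in> poly_mats pair_coords X m m"
proof -
  interpret function_ring X "poly_on pair_coords X" by (rule function_ring_poly_on)
  note t = target_mats[OF assms]
  have "(\<lambda>y. S2\<^sup>T * (fst y * S1)) \<in> mats m n"
    by (rule mats_mult[OF mats_const[OF sel_transpose_carrier(2)] mats_mult[OF t(1) mats_const[OF sel_carrier(1)]]])
  then show "(\<lambda>y. fst (offdiag_blocks n m y)) \<in> mats m n"
    by (simp add: offdiag_blocks_def case_prod_unfold)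
  have "(\<lambda>y. S1\<^sup>T * (fst y * S2)) \<in> mats n m"
    by (rule mats_mult[OF mats_const[OF sel_transpose_carrier(1)] mats_mult[OF t(1) mats_const[OF sel_carrier(2)]]])
  then show "(\<lambda>y. fst (snd (offdiag_blocks n m y))) \<in> mats n m"
    by (simp add: offdiag_blocks_def case_prod_unfold)
  show "(\<lambda>y. snd (snd (offdiag_blocks n m y))) \<in> mats m m"
    using t(2) by (simp add: offdiag_blocks_def case_prod_unfold)
qed

lemma biregular_darboux:
  "biregular (triple_coords n m) enlarged pair_coords target (darboux_map n m)"
proof (rule biregularI)
  show "regular_map (triple_coords n m) enlarged pair_coords target (darboux_map n m)"
  proof (rule regular_map_pairI)
    note e = enlarged_mats[OF subset_refl]
    show "(\<lambda>c. fst (darboux_map n m c)) \<in> regular_mats (triple_coords n m) enlarged N N"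
      using poly_mats_regular[OF darboux_mats[OF function_ring_poly_on e(1,2)]]
      by (simp add: darboux_map_def case_prod_unfold)
    show "(\<lambda>c. snd (darboux_map n m c)) \<in> regular_mats (triple_coords n m) enlarged m m"
      using poly_mats_regular[OF e(3)] by (simp add: darboux_map_def case_prod_unfold)
  qed (use darboux_enlarged in blast)
  show "regular_map pair_coords target (triple_coords n m) enlarged (offdiag_blocks n m)"
    using poly_mats_regular[OF offdiag_blocks_mats(1)[OF subset_refl]]
      poly_mats_regular[OF offdiag_blocks_mats(2)[OF subset_refl]]
      poly_mats_regular[OF offdiag_blocks_mats(3)[OF subset_refl]] offdiag_blocks_target(1)
    by (intro regular_map_tripleI) auto
qed (use offdiag_blocks_target offdiag_blocks_darboux in \<open>auto simp: enlarged_orbit_eq\<close>)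

lemma transverse_dense: "dense_open (mat_coords N N) (sim_orbit J) transverse"
proof (rule dense_openI[OF transverse_open])
  fix A f assume A: "A \<in> sim_orbit J" "f \<in> poly_funs (mat_coords N N)" "f A \<noteq> 0"
  obtain B where B: "B \<in> transverse" using transverse_nonempty by blast
  then obtain g where g: "g \<in> poly_funs (mat_coords N N)" "g B \<noteq> 0" "{y \<in> sim_orbit J. g y \<noteq> 0} \<subseteq> transverse"
    using transverse_open unfolding openin_zariski_iff by blast
  obtain D where "D \<in> sim_orbit J" "f D \<noteq> 0" "g D \<noteq> 0"
    using sim_orbit_irreducible[OF J_carrier A(1) _ A(2,3) g(1,2)] B transverse_sub_orbit by blast
  then show "\<exists>y\<in>transverse. f y \<noteq> 0" using g(3) by blast
qed

definition "target_admissible = {y \<in> target. offdiag_blocks n m y \<in> admissible}"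

lemma target_admissible_open: "openin (zariski pair_coords target) target_admissible"
proof -
  have "target_admissible = {y \<in> target. mat_kernel (fst (snd (offdiag_blocks n m y))) \<inter>
      mat_kernel (char_matrix (snd (snd (offdiag_blocks n m y))) ev) = {0\<^sub>v m}}"
    using offdiag_blocks_target(1) unfolding target_admissible_def admissible_iff by blast
  then show ?thesis
    using admissible_open_condition[OF offdiag_blocks_mats(2,3)[OF subset_refl]] by (simp only:)
qed

text \<open>With \<open>Q\<close> and \<open>A'\<close> fixed, \<open>P\<close> moves on the line to
  an admissible \<open>P1\<close> over the same \<open>A'\<close>. Along it \<open>f\<close> and
  \<open>g\<close> are polynomials in \<open>t\<close> (\<open>ratfuns 1\<close>), so they have a
  common nonzero.\<close>

lemma target_admissible_dense: "dense_open pair_coords target target_admissible"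
proof (rule dense_openI[OF target_admissible_open])
  fix y f assume y: "y \<in> target" and f: "f \<in> poly_funs pair_coords" "f y \<noteq> 0"
  obtain Q P A' where c: "y = darboux_map n m (Q, P, A')" "Q \<in> carrier_mat m n" "P \<in> carrier_mat n m" "A' \<in> reduced"
    using y by (auto simp: offdiag_def darboux_map_def)
  obtain P1 where P1: "P1 \<in> carrier_mat n m" "mat_kernel P1 \<inter> mat_kernel (char_matrix A' ev) = {0\<^sub>v m}"
    using fibre_nonempty[OF c(4)] .
  have "darboux_map n m (Q, P1, A') \<in> target_admissible"
    using c P1 darboux_enlarged offdiag_blocks_darboux[OF c(2) P1(1)]
    by (auto simp: target_admissible_def admissible_def enlarged_orbit_eq)
  then obtain g where g: "g \<in> poly_funs pair_coords" "g (darboux_map n m (Q, P1, A')) \<noteq> 0"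
    "{y \<in> target. g y \<noteq> 0} \<subseteq> target_admissible"
    using target_admissible_open unfolding openin_zariski_iff by blast
  interpret function_ring "{t. poly 1 t \<noteq> 0}" "ratfuns 1" by (rule function_ring_ratfuns)
  define R where "R t = P + t \<cdot>\<^sub>m (P1 - P)" for t :: complex
  have id: "(\<lambda>t. t) \<in> ratfuns 1" using ratfuns_poly[of "[:0, 1:]" 1] by (simp add: poly_pCons[abs_def])
  have R: "R \<in> mats n m"
    unfolding R_def using c P1 id by (intro mats_add mats_smult mats_const) auto
  define Y where "Y t = darboux_map n m (Q, R t, A')" for t
  have fb: "(\<lambda>t. four_block_mat (0\<^sub>m n n) (R t) Q (0\<^sub>m m m)) \<in> mats N N"
    using c by (intro darboux_mats[OF function_ring_axioms] mats_const R)
  have coord: "(\<lambda>t. d (Y t)) \<in> ratfuns 1" if "d \<in> pair_coords" for d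
    using that mats_entry[OF fb] const
    by (auto simp: Y_def darboux_map_def prod_coords_def mat_coords_def)
  have fY: "(\<lambda>t. f (Y t)) \<in> ratfuns 1"
    by (rule poly_funs_comp[OF f(1)]) (rule coord)
  have gY: "(\<lambda>t. g (Y t)) \<in> ratfuns 1"
    by (rule poly_funs_comp[OF g(1)]) (rule coord)
  have "R 0 = P" "R 1 = P1" using c P1 by (auto simp: R_def intro!: eq_matI)
  then have "f (Y 0) \<noteq> 0" "g (Y 1) \<noteq> 0" using f(2) g(2) c(1) by (auto simp: Y_def)
  then obtain t where t: "f (Y t) \<noteq> 0" "g (Y t) \<noteq> 0"
    using ratfuns_common_nonzero[OF fY, of 0, OF _ _ gY, of 1] by auto
  have "Y t \<in> target"
    unfolding Y_def using mats_carrier[OF R, of t] c by (intro darboux_enlarged) (simp add: enlarged_orbit_eq)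
  then have "Y t \<in> target_admissible" using subsetD[OF g(3), of "Y t"] t(2) by simp
  then show "\<exists>y\<in>target_admissible. f y \<noteq> 0" using t(1) by (intro bexI)
qed

section \<open>The pair of projections and birationality\<close>

abbreviation "proj_map \<equiv> (\<lambda>A. (proj_offdiag ev n m bs A, proj_reduced ev n m bs A))"

lemma proj_map_eq: "proj_map A = darboux_map n m (block_coords ev n m bs A)"
  by (simp add: proj_offdiag_def proj_reduced_def)

lemma proj_formulas:
  assumes "A \<in> transverse"
  shows "proj_offdiag ev n m bs A = four_block_mat (0\<^sub>m n n) (S1\<^sup>T * (A * S2)) (q_coord A) (0\<^sub>m m m)"
    and "proj_reduced ev n m bs A = cograph_mat n m (q_coord A) * (A * S2)"
proof -
  obtain Q P A' where c: "block_coords ev n m bs A = (Q, P, A')" by (cases "block_coords ev n m bs A")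
  show "proj_offdiag ev n m bs A = four_block_mat (0\<^sub>m n n) (S1\<^sup>T * (A * S2)) (q_coord A) (0\<^sub>m m m)"
    and "proj_reduced ev n m bs A = cograph_mat n m (q_coord A) * (A * S2)"
    using block_coords_eqs(3,4)[OF assms c] by (simp_all add: proj_offdiag_def proj_reduced_def darboux_map_def c)
qed

lemma proj_map_regular:
  "(\<lambda>A. proj_offdiag ev n m bs A) \<in> regular_mats (mat_coords N N) transverse N N"
  "(\<lambda>A. proj_reduced ev n m bs A) \<in> regular_mats (mat_coords N N) transverse m m"
  by (rule regular_mats_cong[OF darboux_mats[OF function_ring_regular q_coord_regular block_coords_regular(1)]
      proj_formulas(1)[symmetric]], assumption)
    (rule regular_mats_cong[OF block_coords_regular(2) proj_formulas(2)[symmetric]])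

lemma offdiag_blocks_proj_map:
  assumes "A \<in> transverse"
  shows "offdiag_blocks n m (proj_map A) = block_coords ev n m bs A" and "proj_map A \<in> target_admissible"
proof -
  note adm = block_coords_transverse(1)[OF assms]
  show *: "offdiag_blocks n m (proj_map A) = block_coords ev n m bs A"
    unfolding proj_map_eq using adm
    by (cases "block_coords ev n m bs A") (auto simp: admissible_def intro: offdiag_blocks_darboux)
  show "proj_map A \<in> target_admissible"
    unfolding target_admissible_def mem_Collect_eq * unfolding proj_map_eq
    by (intro conjI adm darboux_enlarged subsetD[OF admissible_subset_enlarged])
qed

lemma birational_proj_map:
  "birational (mat_coords N N) (sim_orbit J) transverse pair_coords target proj_map"
proof -
  \<comment> \<open>Used for two codomains: the whole target, as \<open>birational\<close> asks, and
    its admissible part, onto which the map is biregular.\<close>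
  have reg: "regular_map (mat_coords N N) transverse pair_coords Y proj_map" if "target_admissible \<subseteq> Y" for Y
    using proj_map_regular offdiag_blocks_proj_map(2) that by (intro regular_map_pairI) auto
  have sub: "target_admissible \<subseteq> target" by (auto simp: target_admissible_def)
  have "biregular (mat_coords N N) transverse pair_coords target_admissible proj_map"
  proof (rule biregularI[OF reg[OF subset_refl]])
    show "regular_map pair_coords target_admissible (mat_coords N N) transverse
        (\<lambda>y. assemble ev n m (offdiag_blocks n m y))"
    proof (rule regular_map_matI)
      show "(\<lambda>y. assemble ev n m (offdiag_blocks n m y)) \<in> regular_mats pair_coords target_admissible N N"
        using poly_mats_regular[OF assemble_mats[OF function_ring_poly_on offdiag_blocks_mats[OF sub]]] by simp
      show "(\<lambda>y. assemble ev n m (offdiag_blocks n m y)) ` target_admissible \<subseteq> transverse"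
        using assemble_admissible(1) unfolding target_admissible_def by blast
    qed
    show "assemble ev n m (offdiag_blocks n m (proj_map A)) = A" if "A \<in> transverse" for A
      using offdiag_blocks_proj_map(1)[OF that] block_coords_transverse(2)[OF that] by simp
    show "proj_map (assemble ev n m (offdiag_blocks n m y)) = y" if "y \<in> target_admissible" for y
      unfolding proj_map_eq using that block_coords_assemble offdiag_blocks_target(2)
      by (simp add: target_admissible_def)
  qed
  then show ?thesis
    unfolding birational_def using transverse_dense reg[OF sub] target_admissible_dense by blast
qed

end

section \<open>The symplectic form\<close>

lemma mat_trace_add:
  "dim_row A = dim_row B \<Longrightarrow> dim_col A = dim_col B \<Longrightarrow> dim_row A = dim_col A \<Longrightarrow>
    mat_trace (A + B) = mat_trace A + mat_trace B"
  by (simp add: mat_trace_def sum.distrib)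

lemma mat_trace_minus:
  "dim_row A = dim_row B \<Longrightarrow> dim_col A = dim_col B \<Longrightarrow> dim_row A = dim_col A \<Longrightarrow>
    mat_trace (A - B) = mat_trace A - mat_trace B"
  by (simp add: mat_trace_def sum_subtractf)

lemma mat_trace_uminus: "dim_row A = dim_col A \<Longrightarrow> mat_trace (- A) = - mat_trace A"
  by (simp add: mat_trace_def sum_negf)

lemma mat_trace_smult: "dim_row A = dim_col A \<Longrightarrow> mat_trace (c \<cdot>\<^sub>m A) = c * mat_trace A"
  by (simp add: mat_trace_def sum_distrib_left)

lemmas mat_trace_linear = mat_trace_add mat_trace_minus mat_trace_uminus mat_trace_smult

lemma mat_trace_mult_commute:
  assumes "dim_col A = dim_row B" and "dim_row A = dim_col B"
  shows "mat_trace (A * B) = mat_trace (B * A)"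
proof -
  have "mat_trace (A * B) = (\<Sum>i<dim_row A. \<Sum>j<dim_col A. A $$ (i, j) * B $$ (j, i))"
    using assms by (auto simp: mat_trace_def scalar_prod_def lessThan_atLeast0 intro!: sum.cong)
  also have "\<dots> = (\<Sum>j<dim_col A. \<Sum>i<dim_row A. A $$ (i, j) * B $$ (j, i))"
    by (rule sum.swap)
  also have "\<dots> = mat_trace (B * A)"
    using assms by (auto simp: mat_trace_def scalar_prod_def lessThan_atLeast0 mult.commute intro!: sum.cong)
  finally show ?thesis .
qed

section \<open>Velocities of matrix curves\<close>

lemma has_vector_derivative_transform_nhds:
  assumes "(f has_vector_derivative D) (at (0 :: real))" and "\<forall>\<^sub>F t in nhds 0. f t = g t"
  shows "(g has_vector_derivative D) (at 0)"
  unfolding has_vector_derivative_def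
proof (rule has_derivative_transform_eventually)
  show "(f has_derivative (\<lambda>x. x *\<^sub>R D)) (at 0)"
    using assms(1) by (simp add: has_vector_derivative_def)
  show "\<forall>\<^sub>F t in at 0. f t = g t"
    using assms(2) by (auto simp: eventually_at_filter elim: eventually_mono)
  show "f 0 = g 0"
    using assms(2) by (rule eventually_nhds_x_imp_x)
qed simp

lemma has_vector_derivative_unique:
  assumes "(f has_vector_derivative D) (at (0 :: real))" and "(f has_vector_derivative E) (at 0)"
  shows "D = E"
proof -
  have "(\<lambda>x. x *\<^sub>R D) = (\<lambda>x :: real. x *\<^sub>R E)"
    using assms unfolding has_vector_derivative_def by (rule has_derivative_unique)
  from fun_cong[OF this, of 1] show ?thesis by simp
qed

lemma differentiable_real_iff:
  fixes f :: "real \<Rightarrow> 'a :: real_normed_vector"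
  shows "f differentiable (at x) \<longleftrightarrow> (\<exists>D. (f has_vector_derivative D) (at x))"
proof
  assume "f differentiable (at x)"
  then obtain F where F: "(f has_derivative F) (at x)" by (auto simp: differentiable_def)
  interpret bounded_linear F using F by (rule has_derivative_bounded_linear)
  have "F = (\<lambda>y. y *\<^sub>R F 1)"
  proof
    show "F y = y *\<^sub>R F 1" for y using scaleR[of y 1] by simp
  qed
  then have "(f has_vector_derivative F 1) (at x)"
    using F by (simp add: has_vector_derivative_def)
  then show "\<exists>D. (f has_vector_derivative D) (at x)" ..
qed (auto simp: differentiable_def has_vector_derivative_def)

lemma has_velocity_carrier:
  assumes "has_velocity \<gamma> \<xi>"
  shows "\<gamma> 0 \<in> carrier_mat (dim_row \<xi>) (dim_col \<xi>)"
  using assms eventually_nhds_x_imp_x unfolding has_velocity_def by blast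

lemma has_velocity_unique:
  assumes "has_velocity \<gamma> \<xi>" and "has_velocity \<gamma> \<eta>"
  shows "\<xi> = \<eta>"
proof (rule eq_matI)
  show dims: "dim_row \<xi> = dim_row \<eta>" "dim_col \<xi> = dim_col \<eta>"
    using has_velocity_carrier[OF assms(1)] has_velocity_carrier[OF assms(2)] by auto
  show "\<xi> $$ (i, j) = \<eta> $$ (i, j)" if "i < dim_row \<eta>" "j < dim_col \<eta>" for i j
    using assms that dims unfolding has_velocity_def by (metis has_vector_derivative_unique)
qed

lemma has_velocityI:
  assumes "\<forall>\<^sub>F t in nhds 0. \<gamma> t \<in> carrier_mat r c" and "\<xi> \<in> carrier_mat r c"
    and "\<And>i j. i < r \<Longrightarrow> j < c \<Longrightarrow> \<forall>\<^sub>F t in nhds 0. \<gamma> t $$ (i, j) = f i j t"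
    and "\<And>i j. i < r \<Longrightarrow> j < c \<Longrightarrow> (f i j has_vector_derivative \<xi> $$ (i, j)) (at 0)"
  shows "has_velocity \<gamma> \<xi>"
  unfolding has_velocity_def
proof (intro conjI allI impI)
  fix i j assume "i < dim_row \<xi>" "j < dim_col \<xi>"
  then have ij: "i < r" "j < c" using assms(2) by auto
  have "\<forall>\<^sub>F t in nhds 0. f i j t = \<gamma> t $$ (i, j)"
    using assms(3)[OF ij] by (auto elim: eventually_mono)
  with assms(4)[OF ij] show "((\<lambda>t. \<gamma> t $$ (i, j)) has_vector_derivative \<xi> $$ (i, j)) (at 0)"
    by (rule has_vector_derivative_transform_nhds)
qed (use assms(1,2) in auto)

lemma has_velocityD:
  assumes "has_velocity \<gamma> \<xi>" and "\<xi> \<in> carrier_mat r c"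
  shows "\<forall>\<^sub>F t in nhds 0. \<gamma> t \<in> carrier_mat r c"
    and "i < r \<Longrightarrow> j < c \<Longrightarrow> ((\<lambda>t. \<gamma> t $$ (i, j)) has_vector_derivative \<xi> $$ (i, j)) (at 0)"
  using assms by (auto simp: has_velocity_def)

lemma has_velocity_cong:
  assumes "has_velocity \<gamma> \<xi>" and "\<forall>\<^sub>F t in nhds 0. \<gamma> t = \<delta> t"
  shows "has_velocity \<delta> \<xi>"
proof (rule has_velocityI[where f = "\<lambda>i j t. \<gamma> t $$ (i, j)"])
  show "\<forall>\<^sub>F t in nhds 0. \<delta> t \<in> carrier_mat (dim_row \<xi>) (dim_col \<xi>)"
    using has_velocityD(1)[OF assms(1) carrier_mat_triv] assms(2) by eventually_elim simp
  show "\<forall>\<^sub>F t in nhds 0. \<delta> t $$ (i, j) = \<gamma> t $$ (i, j)" for i j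
    using assms(2) by eventually_elim simp
qed (use has_velocityD(2)[OF assms(1) carrier_mat_triv] in auto)

lemma has_velocity_const: "A \<in> carrier_mat r c \<Longrightarrow> has_velocity (\<lambda>_. A) (0\<^sub>m r c)"
  by (auto simp: has_velocity_def)

lemma has_velocity_minus:
  assumes f: "has_velocity f f'" "f' \<in> carrier_mat r c" and g: "has_velocity g g'" "g' \<in> carrier_mat r c"
  shows "has_velocity (\<lambda>t. f t - g t) (f' - g')"
proof (rule has_velocityI[where f = "\<lambda>i j t. f t $$ (i, j) - g t $$ (i, j)"])
  note ev = has_velocityD(1)[OF f] has_velocityD(1)[OF g]
  show "\<forall>\<^sub>F t in nhds 0. f t - g t \<in> carrier_mat r c"
    using ev by eventually_elim auto
  show "\<forall>\<^sub>F t in nhds 0. (f t - g t) $$ (i, j) = f t $$ (i, j) - g t $$ (i, j)" if "i < r" "j < c" for i j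
    using ev by eventually_elim (use that in auto)
  show "((\<lambda>t. f t $$ (i, j) - g t $$ (i, j)) has_vector_derivative (f' - g') $$ (i, j)) (at 0)"
    if "i < r" "j < c" for i j
    using has_vector_derivative_diff[OF has_velocityD(2)[OF f that] has_velocityD(2)[OF g that]] that f g by simp
qed (use f g in auto)

lemma has_velocity_mult:
  assumes f: "has_velocity f f'" "f' \<in> carrier_mat r k" and g: "has_velocity g g'" "g' \<in> carrier_mat k c"
  shows "has_velocity (\<lambda>t. f t * g t) (f' * g 0 + f 0 * g')"
proof (rule has_velocityI[where f = "\<lambda>i j t. \<Sum>l\<in>{0..<k}. f t $$ (i, l) * g t $$ (l, j)"])
  note ev = has_velocityD(1)[OF f] has_velocityD(1)[OF g]
  have c0: "f 0 \<in> carrier_mat r k" "g 0 \<in> carrier_mat k c"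
    using ev[THEN eventually_nhds_x_imp_x] by auto
  show "\<forall>\<^sub>F t in nhds 0. f t * g t \<in> carrier_mat r c"
    using ev by eventually_elim auto
  show "\<forall>\<^sub>F t in nhds 0. (f t * g t) $$ (i, j) = (\<Sum>l\<in>{0..<k}. f t $$ (i, l) * g t $$ (l, j))"
    if "i < r" "j < c" for i j
    using ev by eventually_elim (use that in \<open>auto simp: scalar_prod_def intro!: sum.cong\<close>)
  show "((\<lambda>t. \<Sum>l\<in>{0..<k}. f t $$ (i, l) * g t $$ (l, j)) has_vector_derivative
      (f' * g 0 + f 0 * g') $$ (i, j)) (at 0)" if ij: "i < r" "j < c" for i j
  proof -
    have "((\<lambda>t. \<Sum>l\<in>{0..<k}. f t $$ (i, l) * g t $$ (l, j)) has_vector_derivative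
      (\<Sum>l\<in>{0..<k}. f 0 $$ (i, l) * g' $$ (l, j) + f' $$ (i, l) * g 0 $$ (l, j))) (at 0)"
      using ij by (intro has_vector_derivative_sum has_vector_derivative_mult
          has_velocityD(2)[OF f] has_velocityD(2)[OF g]) auto
    moreover have "(f' * g 0 + f 0 * g') $$ (i, j) =
      (\<Sum>l\<in>{0..<k}. f 0 $$ (i, l) * g' $$ (l, j) + f' $$ (i, l) * g 0 $$ (l, j))"
      using ij c0 f g by (auto simp: scalar_prod_def sum.distrib intro!: sum.cong)
    ultimately show ?thesis by simp
  qed
  show "f' * g 0 + f 0 * g' \<in> carrier_mat r c" using c0 f g by auto
qed

lemma has_velocity_mult_const:
  assumes "has_velocity g g'" "g' \<in> carrier_mat k c"
  shows "A \<in> carrier_mat r k \<Longrightarrow> has_velocity (\<lambda>t. A * g t) (A * g')"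
    and "B \<in> carrier_mat c d \<Longrightarrow> has_velocity (\<lambda>t. g t * B) (g' * B)"
proof -
  have c0: "g 0 \<in> carrier_mat k c" using has_velocity_carrier[OF assms(1)] assms(2) by simp
  show "has_velocity (\<lambda>t. A * g t) (A * g')" if A: "A \<in> carrier_mat r k"
  proof -
    have "0\<^sub>m r k * g 0 + A * g' = A * g'" using A c0 assms(2) by auto
    then show ?thesis
      using has_velocity_mult[OF has_velocity_const[OF A] zero_carrier_mat assms] by simp
  qed
  show "has_velocity (\<lambda>t. g t * B) (g' * B)" if B: "B \<in> carrier_mat c d"
  proof -
    have "g' * B + g 0 * 0\<^sub>m c d = g' * B" using B c0 assms(2) by auto
    then show ?thesis
      using has_velocity_mult[OF assms has_velocity_const[OF B] zero_carrier_mat] by simp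
  qed
qed

lemma has_velocity_offdiag:
  assumes P: "has_velocity P P'" "P' \<in> carrier_mat n m" and Q: "has_velocity Q Q'" "Q' \<in> carrier_mat m n"
  shows "has_velocity (\<lambda>t. four_block_mat (0\<^sub>m n n) (P t) (Q t) (0\<^sub>m m m))
    (four_block_mat (0\<^sub>m n n) P' Q' (0\<^sub>m m m))"
proof (rule has_velocityI[where r = "n + m" and c = "n + m" and f = "\<lambda>i j t. if i < n
    then if j < n then 0 else P t $$ (i, j - n) else if j < n then Q t $$ (i - n, j) else 0"])
  note ev = has_velocityD(1)[OF P] has_velocityD(1)[OF Q]
  show "\<forall>\<^sub>F t in nhds 0. four_block_mat (0\<^sub>m n n) (P t) (Q t) (0\<^sub>m m m) \<in> carrier_mat (n + m) (n + m)"
    by simp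
  show "\<forall>\<^sub>F t in nhds 0. four_block_mat (0\<^sub>m n n) (P t) (Q t) (0\<^sub>m m m) $$ (i, j) = (if i < n
    then if j < n then 0 else P t $$ (i, j - n) else if j < n then Q t $$ (i - n, j) else 0)"
    if "i < n + m" "j < n + m" for i j
    using ev by eventually_elim (use that in auto)
  show "((\<lambda>t. if i < n then if j < n then 0 else P t $$ (i, j - n) else if j < n then Q t $$ (i - n, j) else 0)
      has_vector_derivative four_block_mat (0\<^sub>m n n) P' Q' (0\<^sub>m m m) $$ (i, j)) (at 0)"
    if "i < n + m" "j < n + m" for i j
    using has_velocityD(2)[OF P, of i "j - n"] has_velocityD(2)[OF Q, of "i - n" j] that P(2) Q(2)
    by (cases "i < n"; cases "j < n") auto
qed simp

text \<open>Differentiability at zero depends on the germ only; as \<open>X\<close> is a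
  neighbourhood of zero, equality on \<open>X\<close> preserves it.\<close>

lemma function_ring_differentiable:
  assumes "\<forall>\<^sub>F t in nhds 0. t \<in> X"
  shows "function_ring X {f :: real \<Rightarrow> complex. f differentiable (at 0)}"
proof
  fix f g :: "real \<Rightarrow> complex"
  assume f: "f \<in> {f. f differentiable (at 0)}" and eq: "\<And>t. t \<in> X \<Longrightarrow> f t = g t"
  then obtain D where "(f has_vector_derivative D) (at 0)"
    by (auto simp: differentiable_real_iff)
  moreover have "\<forall>\<^sub>F t in nhds 0. f t = g t"
    using assms by eventually_elim (simp add: eq)
  ultimately have "(g has_vector_derivative D) (at 0)"
    by (rule has_vector_derivative_transform_nhds)
  then show "g \<in> {f. f differentiable (at 0)}"
    by (auto simp: differentiable_real_iff)
qed auto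

abbreviation "smooth_mats X \<equiv> function_ring.mats X {f :: real \<Rightarrow> complex. f differentiable (at 0)}"

lemma smooth_matsI:
  assumes X: "\<forall>\<^sub>F t in nhds 0. t \<in> X" and "has_velocity \<gamma> \<xi>" "\<xi> \<in> carrier_mat r c"
    and "\<And>t. t \<in> X \<Longrightarrow> \<gamma> t \<in> carrier_mat r c"
  shows "\<gamma> \<in> smooth_mats X r c"
  unfolding function_ring.mats_def[OF function_ring_differentiable[OF X]]
  using assms(4) has_velocityD(2)[OF assms(2,3)] by (auto simp: differentiable_real_iff)

lemma smooth_mats_velocity:
  assumes X: "\<forall>\<^sub>F t in nhds 0. t \<in> X" and G: "G \<in> smooth_mats X r c"
  obtains \<xi> where "\<xi> \<in> carrier_mat r c" "has_velocity G \<xi>"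
proof -
  interpret function_ring X "{f :: real \<Rightarrow> complex. f differentiable (at 0)}"
    by (rule function_ring_differentiable[OF X])
  let ?\<xi> = "mat r c (\<lambda>(i, j). SOME D. ((\<lambda>t. G t $$ (i, j)) has_vector_derivative D) (at 0))"
  have "has_velocity G ?\<xi>"
  proof (rule has_velocityI[where f = "\<lambda>i j t. G t $$ (i, j)"])
    show "\<forall>\<^sub>F t in nhds 0. G t \<in> carrier_mat r c"
      using X by eventually_elim (rule mats_carrier[OF G])
    show "((\<lambda>t. G t $$ (i, j)) has_vector_derivative ?\<xi> $$ (i, j)) (at 0)" if "i < r" "j < c" for i j
    proof -
      have "\<exists>D. ((\<lambda>t. G t $$ (i, j)) has_vector_derivative D) (at 0)"
        using mats_entry[OF G that] by (simp add: differentiable_real_iff)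
      from someI_ex[OF this] show ?thesis using that by simp
    qed
  qed auto
  then show thesis using that[of ?\<xi>] by simp
qed

lemma smooth_det_nonzero:
  assumes X: "\<forall>\<^sub>F t in nhds 0. t \<in> X" and G: "G \<in> smooth_mats X k k" and "det (G 0) \<noteq> 0"
  shows "\<forall>\<^sub>F t in nhds 0. det (G t) \<noteq> 0"
proof -
  have "(\<lambda>t. det (G t)) differentiable (at 0)"
    using function_ring.det_in[OF function_ring_differentiable[OF X] G] by simp
  then have "isCont (\<lambda>t. det (G t)) 0"
    unfolding differentiable_def using has_derivative_continuous by blast
  then have "((\<lambda>t. det (G t)) \<longlongrightarrow> det (G 0)) (nhds 0)"
    using tendsto_at_iff_tendsto_nhds[of "\<lambda>t. det (G t)" 0] by (simp add: isCont_def)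
  then show ?thesis using assms(3) by (rule tendsto_imp_eventually_ne)
qed

lemma smooth_mats_inv:
  assumes X: "\<forall>\<^sub>F t in nhds 0. t \<in> X" and G: "G \<in> smooth_mats X k k"
    and det: "\<And>t. t \<in> X \<Longrightarrow> det (G t) \<noteq> 0"
  shows "(\<lambda>t. mat_inv (G t)) \<in> smooth_mats X k k"
proof -
  interpret function_ring X "{f :: real \<Rightarrow> complex. f differentiable (at 0)}"
    by (rule function_ring_differentiable[OF X])
  show ?thesis
    using det_in[OF G] det[OF eventually_nhds_x_imp_x[OF X]] det
    by (intro mats_inv[OF G]) (auto intro: differentiable_inverse)
qed

section \<open>Tangent vectors and the orbit form\<close>

lemma orbit_curveD:
  assumes J: "J \<in> carrier_mat N N" and "orbit_curve J A g g' \<xi>"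
  shows "g 0 \<in> carrier_mat N N" "det (g 0) \<noteq> 0" "g' \<in> carrier_mat N N" "A = g 0 * J * mat_inv (g 0)"
    "\<forall>\<^sub>F t in nhds 0. conj_curve J g t \<in> sim_orbit J"
    "has_velocity (conj_curve J g) \<xi>" "\<xi> \<in> carrier_mat N N" "A \<in> sim_orbit J"
    "\<xi> = g' * mat_inv (g 0) * A - A * (g' * mat_inv (g 0))"
proof -
  have g': "g' \<in> carrier_mat N N" and vel: "has_velocity g g'"
    and inv: "\<forall>\<^sub>F t in nhds 0. invertible_mat (g t)"
    and A: "conj_curve J g 0 = A" and h: "has_velocity (conj_curve J g) \<xi>"
    using assms by (auto simp: orbit_curve_def)
  have ev: "\<forall>\<^sub>F t in nhds 0. g t \<in> carrier_mat N N \<and> det (g t) \<noteq> 0"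
    using has_velocityD(1)[OF vel g'] inv by eventually_elim (auto simp: invertible_mat_iff_det)
  show g0: "g 0 \<in> carrier_mat N N" "det (g 0) \<noteq> 0"
    using eventually_nhds_x_imp_x[OF ev] by auto
  note inv0 = mat_inv[OF g0]
  show Aeq: "A = g 0 * J * mat_inv (g 0)" using A by (simp add: conj_curve_def)
  have Ac: "A \<in> carrier_mat N N" using Aeq g0 inv0 J by auto
  show orbit: "\<forall>\<^sub>F t in nhds 0. conj_curve J g t \<in> sim_orbit J"
    using ev by eventually_elim (auto simp: sim_orbit_iff[OF J] conj_curve_def)
  show \<xi>: "\<xi> \<in> carrier_mat N N"
    using has_velocity_carrier[OF h] A Ac by (metis carrier_matD carrier_matI)
  show "A \<in> sim_orbit J" using eventually_nhds_x_imp_x[OF orbit] A by simp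
  \<comment> \<open>Differentiating \<open>h g = g J\<close> for the conjugated curve
    \<open>h\<close> gives its velocity without a derivative of the inverse:
    \<open>\<xi> g + A g' = g' J\<close>.\<close>
  have eq: "\<forall>\<^sub>F t in nhds 0. conj_curve J g t * g t = g t * J"
    using ev
  proof eventually_elim
    case (elim t)
    then have gt: "g t \<in> carrier_mat N N" "det (g t) \<noteq> 0" by auto
    show ?case
      using mat_inv[OF gt] gt(1) J by (simp add: conj_curve_def mult_assoc_dim)
  qed
  have "has_velocity (\<lambda>t. g t * J) (\<xi> * g 0 + A * g')"
    using has_velocity_cong[OF has_velocity_mult[OF h \<xi> vel g'] eq] A by simp
  from has_velocity_unique[OF this has_velocity_mult_const(2)[OF vel g' J]]
  have der: "\<xi> * g 0 + A * g' = g' * J" .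
  have "\<xi> * g 0 = g' * J - A * g'"
  proof (rule eq_matI)
    fix i j assume "i < dim_row (g' * J - A * g')" "j < dim_col (g' * J - A * g')"
    then show "(\<xi> * g 0) $$ (i, j) = (g' * J - A * g') $$ (i, j)"
      using arg_cong[OF der, of "\<lambda>X. X $$ (i, j)"] \<xi> g' g0 Ac J
      by (simp add: eq_diff_eq del: index_mult_mat(1))
  qed (use \<xi> g' g0 Ac J in auto)
  then have "\<xi> * g 0 * mat_inv (g 0) = (g' * J - A * g') * mat_inv (g 0)" by simp
  moreover have "\<xi> * g 0 * mat_inv (g 0) = \<xi>"
    using \<xi> g0 inv0 by (simp add: mult_assoc_dim)
  moreover have "g' * mat_inv (g 0) * A = g' * J * mat_inv (g 0)"
    using mult_cancel_dim[OF inv0(3), of "J * mat_inv (g 0)"] g' J inv0 g0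
    by (simp add: Aeq mult_assoc_dim)
  ultimately show "\<xi> = g' * mat_inv (g 0) * A - A * (g' * mat_inv (g 0))"
    using g' J Ac inv0 by (simp add: mat_distribs mult_assoc_dim)
qed (use assms in \<open>auto simp: orbit_curve_def\<close>)

text \<open>The curve \<open>(1 + t Y) g\<close> stays invertible near zero because its determinant
  is continuous there. It is enough to know that the conjugated curve has some velocity;
  \<open>orbit_curveD\<close> then identifies it.\<close>

lemma orbit_curve_exists:
  assumes J: "J \<in> carrier_mat N N" and g: "g \<in> carrier_mat N N" "det g \<noteq> 0"
    and A: "A = g * J * mat_inv g" and Y: "Y \<in> carrier_mat N N"
  shows "orbit_curve J A (\<lambda>t. g + of_real t \<cdot>\<^sub>m (Y * g)) (Y * g) (Y * A - A * Y)"
proof -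
  let ?g = "\<lambda>t. g + complex_of_real t \<cdot>\<^sub>m (Y * g)"
  note inv = mat_inv[OF g]
  have Yg: "Y * g \<in> carrier_mat N N" using Y g by simp
  have gc: "?g t \<in> carrier_mat N N" for t using g Yg by simp
  have vel: "has_velocity ?g (Y * g)"
  proof (rule has_velocityI[where f = "\<lambda>i j t. g $$ (i, j) + complex_of_real t * (Y * g) $$ (i, j)"])
    show "((\<lambda>t. g $$ (i, j) + complex_of_real t * (Y * g) $$ (i, j)) has_vector_derivative (Y * g) $$ (i, j)) (at 0)"
      if "i < N" "j < N" for i j
      by (auto intro!: derivative_eq_intros)
    show "\<forall>\<^sub>F t in nhds 0. ?g t \<in> carrier_mat N N"
      by (rule always_eventually) (rule allI, rule gc)
    show "\<forall>\<^sub>F t in nhds 0. ?g t $$ (i, j) = g $$ (i, j) + complex_of_real t * (Y * g) $$ (i, j)"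
      if "i < N" "j < N" for i j
      by (rule always_eventually) (use that g(1) Y in \<open>simp del: index_mult_mat(1)\<close>)
  qed (rule Yg)
  have "complex_of_real 0 \<cdot>\<^sub>m (Y * g) = 0\<^sub>m N N"
    using Y g(1) by (intro eq_matI) (simp_all del: index_mult_mat(1))
  then have g0: "?g 0 = g" using g(1) by (simp only: right_add_zero_mat)
  have smooth: "?g \<in> smooth_mats UNIV N N" by (rule smooth_matsI[OF _ vel Yg gc]) simp
  have det0: "det (?g 0) \<noteq> 0" unfolding g0 by (rule g(2))
  have det: "\<forall>\<^sub>F t in nhds 0. det (?g t) \<noteq> 0"
    by (rule smooth_det_nonzero[OF _ smooth det0]) simp
  define X where "X = {t. det (?g t) \<noteq> 0}"
  have X: "\<forall>\<^sub>F t in nhds 0. t \<in> X" using det by (simp add: X_def)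
  interpret function_ring X "{f :: real \<Rightarrow> complex. f differentiable (at 0)}"
    by (rule function_ring_differentiable[OF X])
  have G: "?g \<in> mats N N" by (rule smooth_matsI[OF X vel Yg gc])
  have "conj_curve J ?g \<in> mats N N"
    unfolding conj_curve_def
    by (rule mats_mult[OF mats_mult[OF G mats_const[OF J]] smooth_mats_inv[OF X G]]) (simp add: X_def)
  then obtain \<zeta> where \<zeta>: "has_velocity (conj_curve J ?g) \<zeta>"
    using smooth_mats_velocity[OF X] by blast
  have "orbit_curve J A ?g (Y * g) \<zeta>"
    unfolding orbit_curve_def
  proof (intro conjI)
    show "Y * g \<in> carrier_mat (dim_row J) (dim_row J)" using Yg J by simp
    show "\<forall>\<^sub>F t in nhds 0. invertible_mat (?g t)"
      using det by eventually_elim (simp add: invertible_mat_iff_det[OF gc])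
    show "conj_curve J ?g 0 = A" unfolding conj_curve_def g0 A ..
  qed (use vel \<zeta> in auto)
  moreover have "Y * g * mat_inv (?g 0) = Y" unfolding g0 using Y g inv by (simp add: mult_assoc_dim)
  ultimately show ?thesis using orbit_curveD(9)[OF J, of A ?g "Y * g" \<zeta>] by simp
qed

text \<open>Invariance of the trace form: commutation with \<open>A\<close> is skew-adjoint.\<close>

lemma trace_commutator_shift:
  assumes "X \<in> carrier_mat N N" "Y \<in> carrier_mat N N" "A \<in> carrier_mat N N"
  shows "mat_trace (X * (Y * A - A * Y)) = - mat_trace ((X * A - A * X) * Y)"
  using assms mat_trace_mult_commute[of "X * Y" A]
  by (simp add: mat_distribs mat_trace_linear mult_assoc_dim)

text \<open>Since \<open>w = tr (Y\<^sub>1 \<xi>\<^sub>2) = - tr (\<xi>\<^sub>1 Y\<^sub>2)\<close>, the value of the form depends on the first curve only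
  through \<open>\<xi>\<^sub>1\<close> and on the second one only through \<open>\<xi>\<^sub>2\<close>.\<close>

lemma orbit_form_eq:
  assumes J: "J \<in> carrier_mat N N" and A: "A \<in> sim_orbit J"
    and Y1: "Y\<^sub>1 \<in> carrier_mat N N" and Y2: "Y\<^sub>2 \<in> carrier_mat N N"
  shows "orbit_form J A (Y\<^sub>1 * A - A * Y\<^sub>1) (Y\<^sub>2 * A - A * Y\<^sub>2) = mat_trace (Y\<^sub>1 * (Y\<^sub>2 * A - A * Y\<^sub>2))"
proof -
  let ?\<xi>1 = "Y\<^sub>1 * A - A * Y\<^sub>1" and ?\<xi>2 = "Y\<^sub>2 * A - A * Y\<^sub>2"
  have Ac: "A \<in> carrier_mat N N" using sim_orbit_carrier[OF J A] .
  have val: "mat_trace (J * commutator (mat_inv (g1 0) * g1') (mat_inv (g1 0) * g2')) = mat_trace (Y\<^sub>1 * ?\<xi>2)"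
    if c1: "orbit_curve J A g1 g1' ?\<xi>1" and c2: "orbit_curve J A g2 g2' ?\<xi>2" and same: "g1 0 = g2 0"
    for g1 g1' g2 g2'
  proof -
    note d1 = orbit_curveD[OF J c1] and d2 = orbit_curveD[OF J c2, folded same]
    note inv = mat_inv[OF d1(1,2)]
    let ?i = "mat_inv (g1 0)"
    let ?Z1 = "g1' * ?i" and ?Z2 = "g2' * ?i"
    have Z: "?Z1 \<in> carrier_mat N N" "?Z2 \<in> carrier_mat N N" using d1 d2 inv by auto
    \<comment> \<open>Moving \<open>J * ?i\<close> cyclically to the end and using
      \<open>J * ?i = ?i * A\<close> turns the factors \<open>?i * a\<close> into
      \<open>a * ?i\<close>, so that everything is expressed at the point \<open>A\<close>.\<close>
    have cyc: "mat_trace (J * (?i * (a * (?i * b)))) = mat_trace (a * ?i * (b * ?i * A))"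
      if "a \<in> carrier_mat N N" "b \<in> carrier_mat N N" for a b
    proof -
      have "mat_trace (J * (?i * (a * (?i * b)))) = mat_trace (a * (?i * (b * (J * ?i))))"
        using that J inv mat_trace_mult_commute[of "J * ?i" "a * (?i * b)"] by (simp add: mult_assoc_dim)
      also have "b * (J * ?i) = b * ?i * A"
        using that J inv d1(1) mult_cancel_dim[OF inv(3), of "J * ?i"]
        by (subst d1(4)) (simp add: mult_assoc_dim)
      finally show ?thesis using that inv Ac by (simp add: mult_assoc_dim)
    qed
    have "mat_trace (J * commutator (?i * g1') (?i * g2')) =
        mat_trace (J * (?i * (g1' * (?i * g2')))) - mat_trace (J * (?i * (g2' * (?i * g1'))))"
      using d1 d2 inv J by (simp add: commutator_def mat_distribs mult_assoc_dim mat_trace_linear)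
    also have "\<dots> = mat_trace (?Z1 * (?Z2 * A)) - mat_trace (?Z2 * (?Z1 * A))"
      using cyc[OF d1(3) d2(3)] cyc[OF d2(3) d1(3)] by simp
    also have "mat_trace (?Z2 * (?Z1 * A)) = mat_trace (?Z1 * (A * ?Z2))"
      using mat_trace_mult_commute[of ?Z2 "?Z1 * A"] Z Ac d1(3) d2(3) inv(1) by (simp add: mult_assoc_dim)
    also have "mat_trace (?Z1 * (?Z2 * A)) - \<dots> = mat_trace (?Z1 * (?Z2 * A - A * ?Z2))"
      using d1(3) d2(3) inv(1) Ac by (simp add: mat_distribs mat_trace_linear)
    also have "?Z2 * A - A * ?Z2 = ?\<xi>2" using d2(9) by simp
    \<comment> \<open>Shifting the commutator forth and back replaces \<open>?Z1\<close> by
      \<open>Y\<^sub>1\<close>: the two may differ, but their commutators with \<open>A\<close> are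
      the same.\<close>
    also have "mat_trace (?Z1 * ?\<xi>2) = - mat_trace ((?Z1 * A - A * ?Z1) * Y\<^sub>2)"
      by (rule trace_commutator_shift[OF Z(1) Y2 Ac])
    also have "?Z1 * A - A * ?Z1 = ?\<xi>1" using d1(9) by simp
    also have "- mat_trace (?\<xi>1 * Y\<^sub>2) = mat_trace (Y\<^sub>1 * ?\<xi>2)"
      by (rule trace_commutator_shift[OF Y1 Y2 Ac, symmetric])
    finally show ?thesis .
  qed
  obtain g where g: "g \<in> carrier_mat N N" "det g \<noteq> 0" "A = g * J * mat_inv g"
    using A sim_orbit_iff[OF J] by auto
  let ?c = "\<lambda>Y t. g + complex_of_real t \<cdot>\<^sub>m (Y * g)"
  note c1 = orbit_curve_exists[OF J g Y1] and c2 = orbit_curve_exists[OF J g Y2]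
  have same: "?c Y\<^sub>1 0 = ?c Y\<^sub>2 0" using g Y1 Y2 by (intro eq_matI) auto
  show ?thesis
    unfolding orbit_form_def
  proof (rule the_equality)
    show "\<exists>g1 g1' g2 g2'. orbit_curve J A g1 g1' ?\<xi>1 \<and> orbit_curve J A g2 g2' ?\<xi>2 \<and> g1 0 = g2 0 \<and>
      mat_trace (Y\<^sub>1 * ?\<xi>2) = mat_trace (J * commutator (mat_inv (g1 0) * g1') (mat_inv (g1 0) * g2'))"
      using c1 c2 same val[OF c1 c2 same] by metis
  qed (use val in auto)
qed

text \<open>The velocity is asked for along every curve representing \<open>\<xi>\<close>: this
  gives uniqueness in the definite description, and tangency provides one such curve.\<close>

lemma orbit_differential_eq:
  assumes "\<xi> \<in> tangent_vectors J A"
    and "\<And>g g'. orbit_curve J A g g' \<xi> \<Longrightarrow> has_velocity (\<pi> \<circ> conj_curve J g) \<eta>"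
  shows "orbit_differential J \<pi> A \<xi> = \<eta>"
  unfolding orbit_differential_def
proof (rule the_equality)
  show "\<exists>g g'. orbit_curve J A g g' \<xi> \<and> has_velocity (\<pi> \<circ> conj_curve J g) \<eta>"
    using assms by (auto simp: tangent_vectors_def)
qed (use assms(2) has_velocity_unique in blast)

lemma tangent_vectorsE:
  assumes "J \<in> carrier_mat N N" and "\<xi> \<in> tangent_vectors J A"
  obtains Y where "Y \<in> carrier_mat N N" "\<xi> = Y * A - A * Y"
proof -
  obtain g g' where c: "orbit_curve J A g g' \<xi>" using assms(2) by (auto simp: tangent_vectors_def)
  note d = orbit_curveD[OF assms(1) c]
  show thesis
    using that[of "g' * mat_inv (g 0)"] d(3,9) mat_inv(1)[OF d(1,2)] by auto
qed

lemma offdiag_form_four_block: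
  assumes "P \<in> carrier_mat n m" "Q \<in> carrier_mat m n" "P' \<in> carrier_mat n m" "Q' \<in> carrier_mat m n"
  shows "offdiag_form n (four_block_mat (0\<^sub>m n n) P Q (0\<^sub>m m m)) (four_block_mat (0\<^sub>m n n) P' Q' (0\<^sub>m m m)) =
    mat_trace (Q * P') - mat_trace (P * Q')"
proof -
  have "split_block (four_block_mat (0\<^sub>m n n) a b (0\<^sub>m m m)) n n = (0\<^sub>m n n, a, b, 0\<^sub>m m m)"
    if "a \<in> carrier_mat n m" "b \<in> carrier_mat m n" for a b :: "complex mat"
    using that by (auto simp: split_block_def Let_def intro!: eq_matI)
  then show ?thesis using assms by (simp add: offdiag_form_def)
qed

section \<open>The symplectic form in block coordinates\<close>

context block_setting
begin

context
  fixes A :: "complex mat"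
  assumes A: "A \<in> transverse"
begin

abbreviation (input) "Q \<equiv> q_coord A"
abbreviation (input) "P \<equiv> S1\<^sup>T * (A * S2)"
abbreviation (input) "A' \<equiv> cograph_mat n m (q_coord A) * (A * S2)"
abbreviation (input) "G \<equiv> graph_mat n m (q_coord A)"
abbreviation (input) "R \<equiv> cograph_mat n m (q_coord A)"

lemmas A_carrier = transverse_carrier[OF A]
lemmas Q_carrier = q_coord(1)[OF A]
lemmas GR_carrier = graph_mat_carrier[OF Q_carrier]
lemmas GR_relations = graph_mat_relations[OF Q_carrier]

lemma A_mult_G: "A * G = ev \<cdot>\<^sub>m G"
proof (rule eq_matI)
  have 0: "A * G - ev \<cdot>\<^sub>m G = 0\<^sub>m N n"
    using q_coord(2)[OF A] A_carrier GR_carrier char_matrix_eq_minus[OF A_carrier, of ev, symmetric]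
    by (simp add: mat_distribs)
  fix i j assume "i < dim_row (ev \<cdot>\<^sub>m G)" "j < dim_col (ev \<cdot>\<^sub>m G)"
  then show "(A * G) $$ (i, j) = (ev \<cdot>\<^sub>m G) $$ (i, j)"
    using arg_cong[OF 0, of "\<lambda>X. X $$ (i, j)"] A_carrier GR_carrier
    by (simp del: index_mult_mat(1))
qed (use A_carrier GR_carrier in auto)

lemma GR_cancel:
  "dim_row X = n \<Longrightarrow> S1\<^sup>T * (G * X) = X" "dim_row X = m \<Longrightarrow> R * (S2 * X) = X"
  "dim_row X = n \<Longrightarrow> R * (G * X) = 0\<^sub>m m (dim_col X)"
  using mult_cancel_dim[OF GR_relations(3), of X] mult_cancel_dim[OF GR_relations(2), of X]
    mult_zero_cancel_dim[OF GR_relations(1), of X] GR_carrier by auto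

lemma A_mult:
  assumes X: "X \<in> carrier_mat N k"
  shows "A * X = ev \<cdot>\<^sub>m (G * (S1\<^sup>T * X)) + (G * (P * (R * X)) + S2 * (A' * (R * X)))"
proof -
  note c = A_carrier GR_carrier
  have "A * X = A * (G * (S1\<^sup>T * X) + S2 * (R * X))"
    using graph_mat_decompose[OF Q_carrier X] by simp
  also have "\<dots> = A * G * (S1\<^sup>T * X) + A * S2 * (R * X)"
    using c X by (simp add: mat_distribs mult_assoc_dim)
  also have "A * S2 = G * P + S2 * A'"
    using c by (intro graph_mat_decompose[OF Q_carrier]) auto
  finally show ?thesis
    using c X by (simp add: A_mult_G mat_distribs mult_assoc_dim)
qed

text \<open>In the basis \<open>(G, S2)\<close> the matrix of \<open>A\<close> is block triangular,
  with rows \<open>(ev, P)\<close> and \<open>(0, A')\<close>. The claims are the four blocks of its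
  commutator with the matrix of \<open>Y\<close>.\<close>

lemma commutator_blocks:
  assumes Y: "Y \<in> carrier_mat N N"
  shows "S1\<^sup>T * ((Y * A - A * Y) * G) = - (P * (R * (Y * G)))"
    and "S1\<^sup>T * ((Y * A - A * Y) * S2) =
      S1\<^sup>T * (Y * G) * P + S1\<^sup>T * (Y * S2) * A' - ev \<cdot>\<^sub>m (S1\<^sup>T * (Y * S2)) - P * (R * (Y * S2))"
    and "R * ((Y * A - A * Y) * G) = ev \<cdot>\<^sub>m (R * (Y * G)) - A' * (R * (Y * G))"
    and "R * ((Y * A - A * Y) * S2) =
      R * (Y * G) * P + (R * (Y * S2) * A' - A' * (R * (Y * S2)))"
proof -
  note c = A_carrier GR_carrier Y
  have AS: "A * S2 = G * P + S2 * A'"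
    using c by (intro graph_mat_decompose[OF Q_carrier]) auto
  have AYG: "A * (Y * G) = ev \<cdot>\<^sub>m (G * (S1\<^sup>T * (Y * G))) + (G * (P * (R * (Y * G))) + S2 * (A' * (R * (Y * G))))"
    using c by (intro A_mult) auto
  have AYS: "A * (Y * S2) = ev \<cdot>\<^sub>m (G * (S1\<^sup>T * (Y * S2))) + (G * (P * (R * (Y * S2))) + S2 * (A' * (R * (Y * S2))))"
    using c by (intro A_mult) auto
  \<comment> \<open>\<open>P\<close> and \<open>A'\<close> are products themselves; opaque names
    keep the associative and distributive laws from taking them apart.\<close>
  define p where "p = P"
  define a where "a = A'"
  have pa: "p \<in> carrier_mat n m" "a \<in> carrier_mat m m" using c by (auto simp: p_def a_def)
  note AS = AS[folded p_def a_def] and AYG = AYG[folded p_def a_def] and AYS = AYS[folded p_def a_def]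
  have exp: "(Y * A - A * Y) * G = ev \<cdot>\<^sub>m (Y * G) - A * (Y * G)"
    "(Y * A - A * Y) * S2 = Y * (G * p) + Y * (S2 * a) - A * (Y * S2)"
    using c pa by (simp_all add: mat_distribs mult_assoc_dim A_mult_G AS)
  note rules = exp AYG AYS mat_distribs mult_assoc_dim GR_cancel GR_relations sel_cancel sel_orthonormal
  show "S1\<^sup>T * ((Y * A - A * Y) * G) = - (P * (R * (Y * G)))"
    unfolding p_def[symmetric] rules(1)
    using c pa by (simp add: rules; intro eq_matI; auto simp del: index_mult_mat(1))
  show "S1\<^sup>T * ((Y * A - A * Y) * S2) =
      S1\<^sup>T * (Y * G) * P + S1\<^sup>T * (Y * S2) * A' - ev \<cdot>\<^sub>m (S1\<^sup>T * (Y * S2)) - P * (R * (Y * S2))"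
    unfolding p_def[symmetric] a_def[symmetric] rules(2)
    using c pa by (simp add: rules; intro eq_matI; auto simp del: index_mult_mat(1))
  show "R * ((Y * A - A * Y) * G) = ev \<cdot>\<^sub>m (R * (Y * G)) - A' * (R * (Y * G))"
    unfolding a_def[symmetric] rules(1)
    using c pa by (simp add: rules; intro eq_matI; auto simp del: index_mult_mat(1))
  show "R * ((Y * A - A * Y) * S2) =
      R * (Y * G) * P + (R * (Y * S2) * A' - A' * (R * (Y * S2)))"
    unfolding p_def[symmetric] a_def[symmetric] rules(2)
    using c pa by (simp add: rules; intro eq_matI; auto simp del: index_mult_mat(1))
qed

text \<open>The resolution of the identity \<open>G S1^T + S2 R = 1\<close> is inserted once to
  split the trace and once between \<open>Y\<close> and \<open>X\<close>.\<close>

lemma trace_blocks: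
  assumes X: "X \<in> carrier_mat N N" and Y: "Y \<in> carrier_mat N N"
  shows "mat_trace (Y * X) =
    mat_trace (S1\<^sup>T * (Y * G) * (S1\<^sup>T * (X * G))) + mat_trace (S1\<^sup>T * (Y * S2) * (R * (X * G))) +
    mat_trace (R * (Y * G) * (S1\<^sup>T * (X * S2))) + mat_trace (R * (Y * S2) * (R * (X * S2)))"
proof -
  note c = GR_carrier X Y
  have split: "mat_trace Z = mat_trace (S1\<^sup>T * (Z * G)) + mat_trace (R * (Z * S2))"
    if Z: "Z \<in> carrier_mat N N" for Z
  proof -
    have "mat_trace Z = mat_trace (G * (S1\<^sup>T * Z) + S2 * (R * Z))"
      using graph_mat_decompose[OF Q_carrier Z] by simp
    also have "\<dots> = mat_trace (G * (S1\<^sup>T * Z)) + mat_trace (S2 * (R * Z))"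
      using c Z by (intro mat_trace_add) auto
    finally show ?thesis
      using c Z mat_trace_mult_commute[of G "S1\<^sup>T * Z"] mat_trace_mult_commute[of S2 "R * Z"]
      by (simp add: mult_assoc_dim)
  qed
  have mid: "Y * (X * W) = Y * (G * (S1\<^sup>T * (X * W))) + Y * (S2 * (R * (X * W)))"
    if "W \<in> carrier_mat N k" for W k
  proof -
    have "X * W \<in> carrier_mat N k" using c that by auto
    from graph_mat_decompose[OF Q_carrier this] show ?thesis
      using c that by (metis (no_types, lifting) carrier_matD index_mult_mat(2,3) mult_add_dim sel_dim)
  qed
  show ?thesis
    using split[of "Y * X"] mid[OF GR_carrier(1)] mid[OF sel_carrier(2)] c
    by (simp add: mult_assoc_dim mat_distribs mat_trace_linear)
qed

text \<open>Of the expansion of the trace, the terms containing \<open>y21\<close>, the velocity of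
  \<open>Q\<close> along the second vector, collect to \<open>- tr (P1' y21)\<close>, with
  \<open>P1'\<close> the upper right block of the first tangent vector. Its summand
  \<open>- p * x22\<close> comes from \<open>tr (x22 y21 p)\<close> by cyclic rotation.\<close>

lemma symplectic_identity:
  assumes Y1: "Y\<^sub>1 \<in> carrier_mat N N" and Y2: "Y\<^sub>2 \<in> carrier_mat N N"
  shows "mat_trace (Y\<^sub>1 * (Y\<^sub>2 * A - A * Y\<^sub>2)) =
    mat_trace (R * (Y\<^sub>1 * G) * (S1\<^sup>T * ((Y\<^sub>2 * A - A * Y\<^sub>2) * S2))) -
    mat_trace (S1\<^sup>T * ((Y\<^sub>1 * A - A * Y\<^sub>1) * S2) * (R * (Y\<^sub>2 * G))) +
    mat_trace (R * (Y\<^sub>1 * S2) * (R * (Y\<^sub>2 * S2) * A' - A' * (R * (Y\<^sub>2 * S2))))"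
proof -
  note c = A_carrier GR_carrier Y1 Y2
  define x11 x12 x22 where "x11 = S1\<^sup>T * (Y\<^sub>1 * G)" and "x12 = S1\<^sup>T * (Y\<^sub>1 * S2)" and "x22 = R * (Y\<^sub>1 * S2)"
  define y21 y22 where "y21 = R * (Y\<^sub>2 * G)" and "y22 = R * (Y\<^sub>2 * S2)"
  define p a where "p = P" and "a = A'"
  have carr: "x11 \<in> carrier_mat n n" "x12 \<in> carrier_mat n m" "x22 \<in> carrier_mat m m"
    "y21 \<in> carrier_mat m n" "y22 \<in> carrier_mat m m" "p \<in> carrier_mat n m" "a \<in> carrier_mat m m"
    using c by (auto simp: x11_def x12_def x22_def y21_def y22_def p_def a_def)
  note b2 = commutator_blocks[OF Y2, folded p_def a_def y21_def y22_def]
  note b1 = commutator_blocks(2)[OF Y1, folded p_def a_def x11_def x12_def x22_def]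
  have "Y\<^sub>2 * A - A * Y\<^sub>2 \<in> carrier_mat N N" using c by auto
  from trace_blocks[OF this Y1, folded x11_def x12_def x22_def, unfolded b2(1,3,4)]
  have "mat_trace (Y\<^sub>1 * (Y\<^sub>2 * A - A * Y\<^sub>2)) =
    mat_trace (x11 * (- (p * y21))) + mat_trace (x12 * (ev \<cdot>\<^sub>m y21 - a * y21)) +
    mat_trace (R * (Y\<^sub>1 * G) * (S1\<^sup>T * ((Y\<^sub>2 * A - A * Y\<^sub>2) * S2))) +
    mat_trace (x22 * (y21 * p + (y22 * a - a * y22)))" .
  also have "mat_trace (x22 * (y21 * p + (y22 * a - a * y22))) =
      mat_trace (x22 * (y21 * p)) + mat_trace (x22 * (y22 * a - a * y22))"
    using carr by (simp add: mult_add_dim mat_trace_add)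
  also have "mat_trace (x22 * (y21 * p)) = mat_trace (p * (x22 * y21))"
    using carr mat_trace_mult_commute[of "x22 * y21" p] by (simp add: mult_assoc_dim)
  finally have "mat_trace (Y\<^sub>1 * (Y\<^sub>2 * A - A * Y\<^sub>2)) =
    mat_trace (R * (Y\<^sub>1 * G) * (S1\<^sup>T * ((Y\<^sub>2 * A - A * Y\<^sub>2) * S2))) -
    (mat_trace (x11 * (p * y21)) + mat_trace (x12 * (a * y21)) - ev * mat_trace (x12 * y21) -
      mat_trace (p * (x22 * y21))) + mat_trace (x22 * (y22 * a - a * y22))"
    using carr by (simp add: mat_distribs mat_trace_linear)
  also have "mat_trace (x11 * (p * y21)) + mat_trace (x12 * (a * y21)) - ev * mat_trace (x12 * y21) -
      mat_trace (p * (x22 * y21)) = mat_trace ((x11 * p + x12 * a - ev \<cdot>\<^sub>m x12 - p * x22) * y21)"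
    using carr by (simp add: mat_distribs mat_trace_linear mult_assoc_dim)
  finally show ?thesis
    unfolding b1 by (simp only: y21_def y22_def x22_def a_def)
qed

text \<open>The formula with \<open>L\<close> only shows that the derivative \<open>Q'\<close>
  exists. Its value comes from \<open>(A - ev) S1 + (A - ev) S2 Q = 0\<close>: differentiation gives
  \<open>(A - ev) S2 Q' = - \<xi> G = (A - ev) Y G\<close>, and \<open>L\<close> cancels
  \<open>(A - ev) S2\<close>.\<close>

lemma coord_velocities:
  assumes curve: "orbit_curve J A g g' (Y * A - A * Y)" and Y: "Y \<in> carrier_mat N N"
  shows "\<forall>\<^sub>F t in nhds 0. conj_curve J g t \<in> transverse"
    and "has_velocity (\<lambda>t. q_coord (conj_curve J g t)) (R * (Y * G))"
proof -
  let ?h = "conj_curve J g" and ?\<xi> = "Y * A - A * Y" and ?M = "char_matrix A ev"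
  note d = orbit_curveD[OF J_carrier curve]
  note c = A_carrier GR_carrier Y char_matrix_closed[OF A_carrier, of ev]
  have h0: "?h 0 = A" using curve by (simp add: orbit_curve_def)
  obtain L where L: "L \<in> carrier_mat m N" "L * (?M * S2) = 1\<^sub>m m"
    using transverse_left_inverse[OF A] .
  \<comment> \<open>The neighbourhood of zero is shrunk in two stages: on \<open>X0\<close> the
    curve lies in the orbit, so its matrices have the right size and the determinant that defines
    \<open>X\<close> below is differentiable.\<close>
  define X0 where "X0 = {t. ?h t \<in> sim_orbit J}"
  have X0: "\<forall>\<^sub>F t in nhds 0. t \<in> X0" using d(5) by (simp add: X0_def)
  have mats: "(\<lambda>t. L * (char_matrix (?h t) ev * S2)) \<in> smooth_mats X m m"
    "(\<lambda>t. L * (char_matrix (?h t) ev * S1)) \<in> smooth_mats X m n"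
    if X: "\<forall>\<^sub>F t in nhds 0. t \<in> X" and "X \<subseteq> X0" for X
  proof -
    interpret function_ring X "{f :: real \<Rightarrow> complex. f differentiable (at 0)}"
      by (rule function_ring_differentiable[OF X])
    have h: "?h \<in> mats N N"
      using that sim_orbit_carrier[OF J_carrier] by (intro smooth_matsI[OF X d(6,7)]) (auto simp: X0_def)
    show "(\<lambda>t. L * (char_matrix (?h t) ev * S2)) \<in> mats m m"
      "(\<lambda>t. L * (char_matrix (?h t) ev * S1)) \<in> mats m n"
      by (rule mats_mult[OF mats_const[OF L(1)] mats_mult[OF char_matrix_mats[OF function_ring_axioms h]
          mats_const[OF sel_carrier(2)]]])
        (rule mats_mult[OF mats_const[OF L(1)] mats_mult[OF char_matrix_mats[OF function_ring_axioms h]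
          mats_const[OF sel_carrier(1)]]])
  qed
  define X where "X = {t \<in> X0. det (L * (char_matrix (?h t) ev * S2)) \<noteq> 0}"
  have X: "\<forall>\<^sub>F t in nhds 0. t \<in> X"
    using X0 smooth_det_nonzero[OF X0 mats(1)[OF X0 subset_refl]] L(2)
    by (auto simp: X_def h0 eventually_conj_iff)
  have trans: "?h t \<in> transverse" if "t \<in> X" for t
  proof -
    have "?h t \<in> carrier_mat N N" using that sim_orbit_carrier[OF J_carrier] by (auto simp: X_def X0_def)
    then have "char_matrix (?h t) ev * S2 \<in> carrier_mat N m"
      by (intro mult_carrier_mat[OF char_matrix_closed sel_carrier(2)])
    from injective_of_left_inverse[OF this L(1)] that show ?thesis
      by (auto simp: X_def X0_def transverse_iff)
  qed
  show "\<forall>\<^sub>F t in nhds 0. ?h t \<in> transverse"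
    using X by eventually_elim (rule trans)
  interpret function_ring X "{f :: real \<Rightarrow> complex. f differentiable (at 0)}"
    by (rule function_ring_differentiable[OF X])
  have sub: "X \<subseteq> X0" by (auto simp: X_def)
  have "(\<lambda>t. - (mat_inv (L * (char_matrix (?h t) ev * S2)) * (L * (char_matrix (?h t) ev * S1)))) \<in> mats m n"
    by (intro mats_uminus mats_mult[OF smooth_mats_inv[OF X mats(1)[OF X sub]] mats(2)[OF X sub]])
      (simp add: X_def)
  then obtain Q' where Q': "Q' \<in> carrier_mat m n" and vel0:
    "has_velocity (\<lambda>t. - (mat_inv (L * (char_matrix (?h t) ev * S2)) * (L * (char_matrix (?h t) ev * S1)))) Q'"
    using smooth_mats_velocity[OF X] by blast
  have "\<forall>\<^sub>F t in nhds 0. - (mat_inv (L * (char_matrix (?h t) ev * S2)) * (L * (char_matrix (?h t) ev * S1))) = q_coord (?h t)"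
    using X by eventually_elim (use q_coord_formula[OF trans L(1)] in \<open>auto simp: X_def\<close>)
  with vel0 have vel: "has_velocity (\<lambda>t. q_coord (?h t)) Q'" by (rule has_velocity_cong)
  have evI: "ev \<cdot>\<^sub>m 1\<^sub>m N \<in> carrier_mat N N" by simp
  have "has_velocity (\<lambda>t. ?h t - ev \<cdot>\<^sub>m 1\<^sub>m N) (?\<xi> - 0\<^sub>m N N)"
    by (rule has_velocity_minus[OF d(6,7) has_velocity_const[OF evI] zero_carrier_mat])
  moreover have "?\<xi> - 0\<^sub>m N N = ?\<xi>" using c by (intro eq_matI) auto
  ultimately have "has_velocity (\<lambda>t. ?h t - ev \<cdot>\<^sub>m 1\<^sub>m N) ?\<xi>" by simp
  moreover have "\<forall>\<^sub>F t in nhds 0. ?h t - ev \<cdot>\<^sub>m 1\<^sub>m N = char_matrix (?h t) ev"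
    using X by eventually_elim (use transverse_carrier[OF trans] char_matrix_eq_minus in blast)
  ultimately have velM: "has_velocity (\<lambda>t. char_matrix (?h t) ev) ?\<xi>" by (rule has_velocity_cong)
  have velS1: "has_velocity (\<lambda>t. char_matrix (?h t) ev * S1) (?\<xi> * S1)"
    by (rule has_velocity_mult_const(2)[OF velM d(7) sel_carrier(1)])
  have \<xi>S2: "?\<xi> * S2 \<in> carrier_mat N m" by (rule mult_carrier_mat[OF d(7) sel_carrier(2)])
  have velSQ: "has_velocity (\<lambda>t. char_matrix (?h t) ev * S2 * q_coord (?h t)) (?\<xi> * S2 * Q + ?M * S2 * Q')"
    using has_velocity_mult[OF has_velocity_mult_const(2)[OF velM d(7) sel_carrier(2)] \<xi>S2 vel Q'] h0
    by simp
  have c1: "?\<xi> * S1 \<in> carrier_mat N n" and c2: "?\<xi> * S2 * Q + ?M * S2 * Q' \<in> carrier_mat N n"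
    by (rule mult_carrier_mat[OF d(7) sel_carrier(1)])
      (rule add_carrier_mat[OF mult_carrier_mat[OF mult_carrier_mat[OF char_matrix_closed[OF A_carrier]
          sel_carrier(2)] Q']])
  have "\<forall>\<^sub>F t in nhds 0. char_matrix (?h t) ev * S2 * q_coord (?h t) = 0\<^sub>m N n - char_matrix (?h t) ev * S1"
    using X
  proof eventually_elim
    case (elim t)
    note tr = trans[OF elim]
    have cc: "char_matrix (?h t) ev \<in> carrier_mat N N" "q_coord (?h t) \<in> carrier_mat m n"
      using transverse_carrier[OF tr] q_coord(1)[OF tr] by auto
    have 0: "char_matrix (?h t) ev * S1 + char_matrix (?h t) ev * S2 * q_coord (?h t) = 0\<^sub>m N n"
      using q_coord(2)[OF tr] cc by (simp add: graph_mat_def mat_distribs mult_assoc_dim)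
    show ?case
    proof (rule eq_matI)
      fix i j assume "i < dim_row (0\<^sub>m N n - char_matrix (?h t) ev * S1)" "j < dim_col (0\<^sub>m N n - char_matrix (?h t) ev * S1)"
      then show "(char_matrix (?h t) ev * S2 * q_coord (?h t)) $$ (i, j) = (0\<^sub>m N n - char_matrix (?h t) ev * S1) $$ (i, j)"
        using arg_cong[OF 0, of "\<lambda>X. X $$ (i, j)"] cc
        by (simp add: add_eq_0_iff del: index_mult_mat(1))
    qed (use cc in auto)
  qed
  from has_velocity_unique[OF has_velocity_cong[OF velSQ this]
      has_velocity_minus[OF has_velocity_const[OF zero_carrier_mat] zero_carrier_mat velS1 c1]]
  have der: "?\<xi> * S2 * Q + ?M * S2 * Q' = 0\<^sub>m N n - ?\<xi> * S1" .
  \<comment> \<open>\<open>A\<close> and \<open>?M\<close> differ by a scalar matrix, so the tangent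
    vector is also the commutator of \<open>Y\<close> with \<open>?M\<close>, and
    \<open>?M * G = 0\<close> removes one of its two terms.\<close>
  have \<xi>M: "?\<xi> * G = - (?M * (Y * G))"
    using c char_matrix_eq_minus[OF A_carrier, of ev, symmetric]
    by (simp add: mat_distribs mult_assoc_dim A_mult_G, intro eq_matI) (auto simp del: index_mult_mat(1))
  have RYG: "R * (Y * G) \<in> carrier_mat m n" using c by auto
  have dimM: "dim_row ?M = N" "dim_col ?M = N" using char_matrix_closed[OF A_carrier, of ev] by (auto simp del: char_matrix_closed)
  have "?M * S2 * Q' = ?M * (Y * G)"
  proof (rule eq_matI)
    fix i j assume ij: "i < dim_row (?M * (Y * G))" "j < dim_col (?M * (Y * G))"
    have "(?\<xi> * S1 + ?\<xi> * S2 * Q) $$ (i, j) = (?\<xi> * G) $$ (i, j)"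
      using d(7) Q_carrier c by (simp add: graph_mat_def mult_add_dim mult_assoc_dim)
    then have e1: "(?\<xi> * S1) $$ (i, j) + (?\<xi> * S2 * Q) $$ (i, j) = - (?M * (Y * G)) $$ (i, j)"
      using ij c d(7) Q_carrier by (simp add: \<xi>M dimM del: index_mult_mat(1))
    have e2: "(?\<xi> * S2 * Q) $$ (i, j) + (?M * S2 * Q') $$ (i, j) = - (?\<xi> * S1) $$ (i, j)"
      using ij c d(7) Q_carrier Q' arg_cong[OF der, of "\<lambda>X. X $$ (i, j)"]
      by (simp add: dimM del: index_mult_mat(1))
    have "q = e" if "a + b = - e" and "b + q = - a" for a b q e :: complex
    proof -
      have "a = - (b + q)" by (simp only: that(2) minus_minus)
      with that(1) have "- (b + q) + b = - e" by (simp only:)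
      then show ?thesis by (simp add: algebra_simps)
    qed
    from this[OF e1 e2] show "(?M * S2 * Q') $$ (i, j) = (?M * (Y * G)) $$ (i, j)" .
  qed (use c Q' dimM in auto)
  \<comment> \<open>Of the expansion of \<open>Y * G\<close> in the basis \<open>(G, S2)\<close>
    only the second part survives, again by \<open>?M * G = 0\<close>.\<close>
  also have "?M * (Y * G) = ?M * G * (S1\<^sup>T * (Y * G)) + ?M * S2 * (R * (Y * G))"
  proof -
    have YG: "Y * G \<in> carrier_mat N n" using c by auto
    show ?thesis
      using arg_cong[OF graph_mat_decompose[OF Q_carrier YG], of "\<lambda>X. ?M * X"] c
      by (simp add: dimM mult_add_dim mult_assoc_dim)
  qed
  also have "\<dots> = ?M * S2 * (R * (Y * G))"
    using c left_add_zero_mat[OF mult_carrier_mat[OF mult_carrier_mat[OF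
        char_matrix_closed[OF A_carrier] sel_carrier(2)] RYG], of ev]
    by (simp add: q_coord(2)[OF A])
  finally have LMS: "L * (?M * S2 * Q') = L * (?M * S2 * (R * (Y * G)))" by simp
  have LW: "L * (?M * S2 * W) = W" if "W \<in> carrier_mat m n" for W
    using mult_cancel_dim[OF L(2), of W] L(1) that c by (simp add: dimM mult_assoc_dim)
  from LMS have "Q' = R * (Y * G)" using LW[OF Q'] LW[OF RYG] by simp
  then show "has_velocity (\<lambda>t. q_coord (?h t)) (R * (Y * G))" using vel by simp
qed

text \<open>As \<open>P = S1^T A S2\<close> with constant outer factors, its velocity is a block of
  the tangent vector. In \<open>A' = R A S2\<close> the factor \<open>R\<close> moves as well: its
  velocity \<open>- Q' S1^T\<close> contributes \<open>- R Y G P\<close>, which cancels the part of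
  the lower right block of the tangent vector that is not a commutator with
  \<open>A'\<close>.\<close>

lemma proj_velocities:
  assumes curve: "orbit_curve J A g g' (Y * A - A * Y)" and Y: "Y \<in> carrier_mat N N"
  shows "has_velocity (proj_offdiag ev n m bs \<circ> conj_curve J g)
      (four_block_mat (0\<^sub>m n n) (S1\<^sup>T * ((Y * A - A * Y) * S2)) (R * (Y * G)) (0\<^sub>m m m))"
    and "has_velocity (proj_reduced ev n m bs \<circ> conj_curve J g)
      (R * (Y * S2) * A' - A' * (R * (Y * S2)))"
proof -
  let ?h = "conj_curve J g" and ?\<xi> = "Y * A - A * Y"
  note d = orbit_curveD[OF J_carrier curve]
  note c = A_carrier GR_carrier Y
  note trans = coord_velocities(1)[OF assms] and vel = coord_velocities(2)[OF assms]
  have h0: "?h 0 = A" using curve by (simp add: orbit_curve_def)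
  have Q': "R * (Y * G) \<in> carrier_mat m n" using c by auto
  have vS: "has_velocity (\<lambda>t. ?h t * S2) (?\<xi> * S2)"
    by (rule has_velocity_mult_const(2)[OF d(6,7) sel_carrier(2)])
  have \<xi>S: "?\<xi> * S2 \<in> carrier_mat N m" using d(7) by auto
  have vP: "has_velocity (\<lambda>t. S1\<^sup>T * (?h t * S2)) (S1\<^sup>T * (?\<xi> * S2))"
    by (rule has_velocity_mult_const(1)[OF vS \<xi>S sel_transpose_carrier(1)])
  have P': "S1\<^sup>T * (?\<xi> * S2) \<in> carrier_mat n m" using \<xi>S by auto
  have "\<forall>\<^sub>F t in nhds 0. four_block_mat (0\<^sub>m n n) (S1\<^sup>T * (?h t * S2)) (q_coord (?h t)) (0\<^sub>m m m) =
      (proj_offdiag ev n m bs \<circ> ?h) t"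
    using trans by eventually_elim (simp add: proj_formulas)
  from has_velocity_cong[OF has_velocity_offdiag[OF vP P' vel Q'] this]
  show "has_velocity (proj_offdiag ev n m bs \<circ> ?h)
      (four_block_mat (0\<^sub>m n n) (S1\<^sup>T * (?\<xi> * S2)) (R * (Y * G)) (0\<^sub>m m m))" .
  have QS: "R * (Y * G) * S1\<^sup>T \<in> carrier_mat m N"
    by (rule mult_carrier_mat[OF Q' sel_transpose_carrier(1)])
  have vR: "has_velocity (\<lambda>t. cograph_mat n m (q_coord (?h t))) (0\<^sub>m m N - R * (Y * G) * S1\<^sup>T)"
    unfolding cograph_mat_def[of n m "q_coord (?h _)"]
    by (rule has_velocity_minus[OF has_velocity_const[OF sel_transpose_carrier(2)] zero_carrier_mat
          has_velocity_mult_const(2)[OF vel Q' sel_transpose_carrier(1)] QS])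
  have R': "0\<^sub>m m N - R * (Y * G) * S1\<^sup>T \<in> carrier_mat m N"
    by (rule minus_carrier_mat[OF QS])
  have "has_velocity (\<lambda>t. cograph_mat n m (q_coord (?h t)) * (?h t * S2))
      ((0\<^sub>m m N - R * (Y * G) * S1\<^sup>T) * (A * S2) + R * (?\<xi> * S2))"
    using has_velocity_mult[OF vR R' vS \<xi>S] h0 by simp
  moreover have "(0\<^sub>m m N - R * (Y * G) * S1\<^sup>T) * (A * S2) + R * (?\<xi> * S2) =
      R * (Y * S2) * A' - A' * (R * (Y * S2))"
  proof -
    have "(0\<^sub>m m N - R * (Y * G) * S1\<^sup>T) * (A * S2) = 0\<^sub>m m m - R * (Y * G) * P"
      using c by (simp add: minus_mult_dim mult_assoc_dim)
    then show ?thesis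
      unfolding commutator_blocks(4)[OF Y] using c
      by (simp, intro eq_matI) (auto simp del: index_mult_mat(1))
  qed
  ultimately have "has_velocity (\<lambda>t. cograph_mat n m (q_coord (?h t)) * (?h t * S2))
      (R * (Y * S2) * A' - A' * (R * (Y * S2)))" by simp
  moreover have "\<forall>\<^sub>F t in nhds 0. cograph_mat n m (q_coord (?h t)) * (?h t * S2) = (proj_reduced ev n m bs \<circ> ?h) t"
    using trans by eventually_elim (simp add: proj_formulas)
  ultimately show "has_velocity (proj_reduced ev n m bs \<circ> ?h) (R * (Y * S2) * A' - A' * (R * (Y * S2)))"
    by (rule has_velocity_cong)
qed

text \<open>The velocity of \<open>A'\<close> is the commutator of \<open>R Y S2\<close> with
  \<open>A'\<close>, so \<open>orbit_form_eq\<close> evaluates the form on the reduced orbit by the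
  same trace formula as on the orbit of \<open>J\<close>. The values are then the terms of
  \<open>symplectic_identity\<close>.\<close>

lemma symplectic:
  assumes "\<xi>\<^sub>1 \<in> tangent_vectors J A" and "\<xi>\<^sub>2 \<in> tangent_vectors J A"
  shows "orbit_form J A \<xi>\<^sub>1 \<xi>\<^sub>2 =
    orbit_pullback J (proj_offdiag ev n m bs) (\<lambda>_. offdiag_form n) A \<xi>\<^sub>1 \<xi>\<^sub>2 +
    orbit_pullback J (proj_reduced ev n m bs) (orbit_form (jordan_matrix bs')) A \<xi>\<^sub>1 \<xi>\<^sub>2"
proof -
  note c = A_carrier GR_carrier
  obtain Y\<^sub>1 where Y1: "Y\<^sub>1 \<in> carrier_mat N N" "\<xi>\<^sub>1 = Y\<^sub>1 * A - A * Y\<^sub>1"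
    using tangent_vectorsE[OF J_carrier assms(1)] .
  obtain Y\<^sub>2 where Y2: "Y\<^sub>2 \<in> carrier_mat N N" "\<xi>\<^sub>2 = Y\<^sub>2 * A - A * Y\<^sub>2"
    using tangent_vectorsE[OF J_carrier assms(2)] .
  have d: "orbit_differential J (proj_offdiag ev n m bs) A (Y * A - A * Y) =
      four_block_mat (0\<^sub>m n n) (S1\<^sup>T * ((Y * A - A * Y) * S2)) (R * (Y * G)) (0\<^sub>m m m)"
    "orbit_differential J (proj_reduced ev n m bs) A (Y * A - A * Y) =
      R * (Y * S2) * A' - A' * (R * (Y * S2))"
    if "Y \<in> carrier_mat N N" "Y * A - A * Y \<in> tangent_vectors J A" for Y
    using orbit_differential_eq[OF that(2) proj_velocities(1)[OF _ that(1)]]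
      orbit_differential_eq[OF that(2) proj_velocities(2)[OF _ that(1)]] by auto
  note d1 = d[OF Y1(1) assms(1)[unfolded Y1(2)]] and d2 = d[OF Y2(1) assms(2)[unfolded Y2(2)]]
  have red: "proj_reduced ev n m bs A = A'" by (rule proj_formulas(2)[OF A])
  have "A' \<in> reduced"
    using block_coords_eqs(4,6)[OF A] by (metis prod.collapse)
  then have A': "A' \<in> sim_orbit (jordan_matrix bs')" by (simp add: reduced_eq_sim_orbit)
  have J': "jordan_matrix bs' \<in> carrier_mat m m"
    using jordan_matrix_carrier[of bs'] by (simp add: reduced_size)
  have orb: "A \<in> sim_orbit J" using A by (simp add: transverse_iff)
  have Z: "R * (Y * S2) \<in> carrier_mat m m" "S1\<^sup>T * ((Y * A - A * Y) * S2) \<in> carrier_mat n m"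
    "R * (Y * G) \<in> carrier_mat m n" if "Y \<in> carrier_mat N N" for Y
    using c that by auto
  show ?thesis
    unfolding orbit_pullback_def Y1(2) Y2(2) d1 d2 red
      orbit_form_eq[OF J_carrier orb Y1(1) Y2(1)] orbit_form_eq[OF J' A' Z(1)[OF Y1(1)] Z(1)[OF Y2(1)]]
      offdiag_form_four_block[OF Z(2)[OF Y1(1)] Z(3)[OF Y1(1)] Z(2)[OF Y2(1)] Z(3)[OF Y2(1)]]
      symplectic_identity[OF Y1(1) Y2(1)] ..
qed

end

end

theorem theorem3:
  fixes bs :: "(nat \<times> complex) list" and J :: "complex mat" and ev :: complex and N n m :: nat
  assumes "0 \<notin> fst ` set bs" and "J = jordan_matrix bs" and "J \<in> carrier_mat N N"
    and "eigenvalue J ev"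
    and "n = kernel_dim (J - ev \<cdot>\<^sub>m 1\<^sub>m N)" and "m = N - n"
    and "0 < n" and "n < N"
  shows
    "(\<forall>A \<in> transverse_orbit J ev n. \<exists>!c. is_block_form ev n m bs A c) \<and>

     openin (zariski (triple_coords n m) (enlarged_orbit ev n m bs))
       (block_coords ev n m bs ` transverse_orbit J ev n) \<and>
     biregular (mat_coords N N) (transverse_orbit J ev n)
       (triple_coords n m) (block_coords ev n m bs ` transverse_orbit J ev n)
       (block_coords ev n m bs) \<and>

     biregular (triple_coords n m) (enlarged_orbit ev n m bs)
       (prod_coords (mat_coords N N) (mat_coords m m))
       (offdiag n m \<times> jordan_class m (shorten_chains ev bs))
       (darboux_map n m) \<and>

     birational (mat_coords N N) (sim_orbit J) (transverse_orbit J ev n)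
       (prod_coords (mat_coords N N) (mat_coords m m))
       (offdiag n m \<times> jordan_class m (shorten_chains ev bs))
       (\<lambda>A. (proj_offdiag ev n m bs A, proj_reduced ev n m bs A)) \<and>

     (\<forall>A \<in> transverse_orbit J ev n. \<forall>\<xi>\<^sub>1 \<in> tangent_vectors J A. \<forall>\<xi>\<^sub>2 \<in> tangent_vectors J A.
       orbit_form J A \<xi>\<^sub>1 \<xi>\<^sub>2 =
         orbit_pullback J (proj_offdiag ev n m bs) (\<lambda>_. offdiag_form n) A \<xi>\<^sub>1 \<xi>\<^sub>2 +
         orbit_pullback J (proj_reduced ev n m bs)
           (orbit_form (jordan_matrix (shorten_chains ev bs))) A \<xi>\<^sub>1 \<xi>\<^sub>2)"
proof -
  \<comment> \<open>\<open>m\<close> is a truncated difference; \<open>n < N\<close> makes it a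
    genuine one.\<close>
  have N: "N = n + m" using \<open>m = N - n\<close> \<open>n < N\<close> by simp
  have dim: "dim_row J = N" using \<open>J \<in> carrier_mat N N\<close> by simp
  interpret B: block_setting bs ev n m
  proof
    show "0 \<notin> fst ` set bs" by fact
    show "sum_list (map fst bs) = n + m" using dim N \<open>J = jordan_matrix bs\<close> by simp
    show "dim_gen_eigenspace (jordan_matrix bs) ev 1 = n"
      using \<open>n = kernel_dim (J - ev \<cdot>\<^sub>m 1\<^sub>m N)\<close> \<open>J \<in> carrier_mat N N\<close> \<open>J = jordan_matrix bs\<close>
        char_matrix_eq_minus[of J N ev] char_matrix_closed[of J N ev]
      by (simp add: dim_gen_eigenspace_def)
  qed
  show ?thesis
    unfolding N \<open>J = jordan_matrix bs\<close> B.block_coords_image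
    by (intro conjI ballI B.block_form_ex1 B.admissible_open B.biregular_block_coords
        B.biregular_darboux B.birational_proj_map B.symplectic)
qed

end
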